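(* Let $n\ge 1$ and let $A_1, A_2$ be the generalised integral operators on $\mathcal{G}_\tau=\mathcal{G}_\tau(\mathbb{R}^n)$ with kernels $K^1=[(K^1_\varepsilon)_\varepsilon]$, $K^2=[(K^2_\varepsilon)_\varepsilon]\in\mathcal{G}_\tau(\mathbb{R}^{2n})$, where $(K^1_\varepsilon)_\varepsilon,(K^2_\varepsilon)_\varepsilon\in\mathcal{E}_\tau(\mathbb{R}^{2n})$; that is, for every $\phi=[(\phi_\varepsilon)_\varepsilon]\in\mathcal{G}_\tau$ and $i=1,2$, $$A_i\phi=\left(\int_{\mathbb{R}^n}K^i_\varepsilon(x,y)\,\phi_\varepsilon(y)\,e^{-\varepsilon|y|^2}\,dy\right)_\varepsilon+\mathcal{N}_\tau(\mathbb{R}^n),$$ so that $A_1,A_2\in\mathcal{L}(\mathcal{G}_\tau,\mathcal{G}_\tau)$. Then the composition $A_2\circ A_1$ belongs to $\mathcal{L}(\mathcal{G}_\tau,\mathcal{G}_\tau)$ and is a generalised integral operator of the same form, i.e. $$(A_2\circ A_1)\phi=\left(\int_{\mathbb{R}^n}K_\varepsilon(x,y)\,\phi_\varepsilon(y)\,e^{-\varepsilon|y|^2}\,dy\right)_\varepsilon+\mathcal{N}_\tau(\mathbb{R}^n)\qquad\text{for all }\phi=[(\phi_\varepsilon)_\varepsilon]\in\mathcal{G}_\tau,$$ with kernel given by $$K_\varepsilon(x,y)=\int_{\mathbb{R}^n}K^2_\varepsilon(x,z)\,K^1_\varepsilon(z,y)\,e^{-\varepsilon|z|^2}\,dz,\qquad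 [(K_\varepsilon)_\varepsilon]\in\mathcal{G}_\tau(\mathbb{R}^{2n}).$$
   Context: Let $\Omega=\mathbb{R}^d$, $d\ge 1$. For $f\in C^\infty(\Omega)$, $q\in\mathbb{Z}$, $l\in\mathbb{N}$ (with $0\in\mathbb{N}$), put $$\mu_{q,l}(f)=\sup_{x\in\Omega,\ |\alpha|\le l}(1+|x|)^q\,|\partial^\alpha f(x)|\in[0,\infty].$$ The algebra of smooth functions with slow growth is $$\mathcal{O}_M(\Omega)=\{f\in C^\infty(\Omega):\ \forall l\in\mathbb{N}\ \exists q\in\mathbb{N}:\ \mu_{-q,l}(f)<\infty\},$$ with its usual topology. $\mathcal{O}_M(\Omega)^{(0,1]}$ denotes the set of nets $(f_\varepsilon)_{\varepsilon\in(0,1]}$ with every $f_\varepsilon\in\mathcal{O}_M(\Omega)$. Define $$\mathcal{E}_\tau(\Omega)=\{(f_\varepsilon)_\varepsilon\in\mathcal{O}_M(\Omega)^{(0,1]}:\ \forall l\in\mathbb{N}\ \exists q,m\in\mathbb{N}:\ \mu_{-q,l}(f_\varepsilon)=O(\varepsilon^{-m})\text{ as }\varepsilon\to0\},$$ $$\mathcal{N}_\tau(\Omega)=\{(f_\varepsilon)_\varepsilon\in\mathcal{O}_M(\Omega)^{(0,1]}:\ \forall l\in\mathbb{N}\ \exists q\in\mathbb{N}\ \forall p\in\mathbb{N}:\ \mu_{-q,l}(f_\varepsilon)=O(\varepsilon^{p})\text{ as }\varepsilon\to0\}.$$ $\mathcal{N}_\tau(\Omega)$ is an ideal of the algebra $\mathcal{E}_\tau(\Omega)$,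 and $\mathcal{G}_\tau(\Omega)=\mathcal{E}_\tau(\Omega)/\mathcal{N}_\tau(\Omega)$ is the Colombeau algebra of tempered generalised functions; $[(f_\varepsilon)_\varepsilon]$ denotes the class of $(f_\varepsilon)_\varepsilon$. Write $\mathcal{O}_M=\mathcal{O}_M(\mathbb{R}^n)$ and $\mathcal{G}_\tau=\mathcal{G}_\tau(\mathbb{R}^n)$. Let $\mathcal{E}_M(\mathbb{R}_+)$ be the set of nets $(C_\varepsilon)_{\varepsilon\in(0,1]}$ in $\mathbb{R}_+$ for which there is $m\in\mathbb{N}$ with $C_\varepsilon=O(\varepsilon^{-m})$ as $\varepsilon\to0$. A net $(A_\varepsilon)_{\varepsilon\in(0,1]}$ of continuous linear maps $A_\varepsilon:\mathcal{O}_M\to\mathcal{O}_M$ is of moderate growth if $$\forall \ell\in\mathbb{N}\ \exists (C_\varepsilon)_\varepsilon\in\mathcal{E}_M(\mathbb{R}_+)\ \exists p,q,\ell'\in\mathbb{N}:\quad \mu_{-p,\ell}(A_\varepsilon f)\le C_\varepsilon\,\mu_{-q,\ell'}(f)\quad\text{for all } f\in\mathcal{O}_M,\ \varepsilon\in(0,1].$$ $\mathcal{L}(\mathcal{G}_\tau,\mathcal{G}_\tau)$ denotes the set of (well-defined) linear maps $A:\mathcal{G}_\tau\to\mathcal{G}_\tau$ that are represented by a net $(A_\varepsilon)_\varepsilon$ of moderate growth, i.e. $A[(f_\varepsilon)_\varepsilon]=[(A_\varepsilon f_\varepsilon)_\varepsilon]$ for all $(f_\varepsilon)_\varepsilon\in\mathcal{E}_\tau(\mathbb{R}^n)$.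 For a kernel in $\mathcal{G}_\tau(\mathbb{R}^{2n})$, the generalised integral operator given by the formula in the claim is represented by the maps $f\mapsto\int_{\mathbb{R}^n}K_\varepsilon(\cdot,y)f(y)e^{-\varepsilon|y|^2}dy$. *)

theory Defs
  imports "HOL-Analysis.Analysis" "HOL-Library.Landau_Symbols"
begin

definition partial_deriv :: "'a::euclidean_space \<Rightarrow> ('a \<Rightarrow> complex) \<Rightarrow> 'a \<Rightarrow> complex" where
  "partial_deriv b f = (\<lambda>x. frechet_derivative f (at x) b)"

text \<open>
  A partial derivative of order \<open>k\<close> is indexed by a list of \<open>k\<close> coordinate directions. For smooth
  functions the order of differentiation is irrelevant, so the derivatives indexed by lists of
  length at most \<open>l\<close> are exactly the \<open>\<partial>\<^sup>\<alpha> f\<close> with \<open>\<bar>\<alpha>\<bar> \<le> l\<close>.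
\<close>

fun iter_partial :: "'a::euclidean_space list \<Rightarrow> ('a \<Rightarrow> complex) \<Rightarrow> 'a \<Rightarrow> complex" where
  "iter_partial [] f = f"
| "iter_partial (b # bs) f = partial_deriv b (iter_partial bs f)"

definition indices :: "nat \<Rightarrow> 'a::euclidean_space list set" where
  "indices l = {bs. set bs \<subseteq> Basis \<and> length bs \<le> l}"

definition smooth :: "('a::euclidean_space \<Rightarrow> complex) set" where
  "smooth = {f. \<forall>bs. set bs \<subseteq> Basis \<longrightarrow> (\<forall>x. iter_partial bs f differentiable (at x))}"

definition mu :: "int \<Rightarrow> nat \<Rightarrow> ('a::euclidean_space \<Rightarrow> complex) \<Rightarrow> ennreal" where
  "mu q l f = (SUP x. SUP bs\<in>indices l. ennreal ((1 + norm x) powi q * norm (iter_partial bs f x)))"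

definition OM :: "('a::euclidean_space \<Rightarrow> complex) set" where
  "OM = {f \<in> smooth. \<forall>l. \<exists>q::nat. mu (- int q) l f < \<infinity>}"

text \<open>
  The usual topology of the space of slowly increasing smooth functions is the locally convex
  one given by the seminorms \<open>f \<mapsto> sup \<bar>\<phi> \<cdot> \<partial>\<^sup>\<alpha> f\<bar>\<close>, with \<open>\<phi>\<close> a Schwartz function.
\<close>

definition schwartz :: "('a::euclidean_space \<Rightarrow> complex) set" where
  "schwartz = {\<phi> \<in> smooth. \<forall>(q::nat) l. mu (int q) l \<phi> < \<infinity>}"

definition OM_seminorm ::
    "('a::euclidean_space \<Rightarrow> complex) \<Rightarrow> 'a list \<Rightarrow> ('a \<Rightarrow> complex) \<Rightarrow> ennreal" where
  "OM_seminorm \<phi> bs f = (SUP x. ennreal (norm (\<phi> x * iter_partial bs f x)))"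

definition OM_topology :: "('a::euclidean_space \<Rightarrow> complex) topology" where
  "OM_topology = topology_generated_by
     {{g \<in> OM. OM_seminorm \<phi> bs (\<lambda>x. g x - f x) < ennreal r} | \<phi> bs f r.
        \<phi> \<in> schwartz \<and> set bs \<subseteq> Basis \<and> f \<in> OM \<and> 0 < r}"

definition cont_linear_OM :: "(('a::euclidean_space \<Rightarrow> complex) \<Rightarrow> ('a \<Rightarrow> complex)) \<Rightarrow> bool" where
  "cont_linear_OM A \<longleftrightarrow>
     A ` OM \<subseteq> OM \<and>
     (\<forall>f\<in>OM. \<forall>g\<in>OM. A (\<lambda>x. f x + g x) = (\<lambda>x. A f x + A g x)) \<and>
     (\<forall>c. \<forall>f\<in>OM. A (\<lambda>x. c * f x) = (\<lambda>x. c * A f x)) \<and>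
     continuous_map OM_topology OM_topology A"

text \<open>
  Nets indexed by \<open>(0,1]\<close> are functions on \<^typ>\<open>real\<close>; all conditions on them, including the
  equality of generalised functions below, only involve their values on \<open>(0,1]\<close>.
\<close>

definition E_tau :: "(real \<Rightarrow> 'a::euclidean_space \<Rightarrow> complex) set" where
  "E_tau = {f. (\<forall>\<epsilon>\<in>{0<..1}. f \<epsilon> \<in> OM) \<and>
     (\<forall>l. \<exists>(q::nat) (m::nat). \<exists>C::real. \<forall>\<^sub>F \<epsilon> in at_right 0.
        mu (- int q) l (f \<epsilon>) \<le> ennreal (C * \<epsilon> powi (- int m)))}"

definition N_tau :: "(real \<Rightarrow> 'a::euclidean_space \<Rightarrow> complex) set" where
  "N_tau = {f. (\<forall>\<epsilon>\<in>{0<..1}. f \<epsilon> \<in> OM) \<and>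
     (\<forall>l. \<exists>q::nat. \<forall>p::nat. \<exists>C::real. \<forall>\<^sub>F \<epsilon> in at_right 0.
        mu (- int q) l (f \<epsilon>) \<le> ennreal (C * \<epsilon> ^ p))}"

lemma smooth_differentiable:
  "f \<in> smooth \<Longrightarrow> set bs \<subseteq> Basis \<Longrightarrow> iter_partial bs f differentiable (at x)"
  by (simp add: smooth_def)

lemma iter_partial_add:
  assumes "f \<in> smooth" "g \<in> smooth" "set bs \<subseteq> Basis"
  shows "iter_partial bs (\<lambda>x. f x + g x) = (\<lambda>x. iter_partial bs f x + iter_partial bs g x)"
  using assms(3)
proof (induction bs)
  case (Cons b bs)
  have "frechet_derivative (\<lambda>x. iter_partial bs f x + iter_partial bs g x) (at x) b =
        frechet_derivative (iter_partial bs f) (at x) b + frechet_derivative (iter_partial bs g) (at x) b" for x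
  proof -
    have "iter_partial bs f differentiable (at x)" "iter_partial bs g differentiable (at x)"
      using assms Cons.prems by (auto intro: smooth_differentiable)
    then have "((\<lambda>x. iter_partial bs f x + iter_partial bs g x) has_derivative
        (\<lambda>h. frechet_derivative (iter_partial bs f) (at x) h + frechet_derivative (iter_partial bs g) (at x) h)) (at x)"
      by (intro has_derivative_add) (simp_all add: frechet_derivative_works)
    from frechet_derivative_at[OF this, symmetric] show ?thesis
      by simp
  qed
  with Cons show ?case
    by (simp add: partial_deriv_def)
qed simp

lemma iter_partial_cmult:
  assumes "f \<in> smooth" "set bs \<subseteq> Basis"
  shows "iter_partial bs (\<lambda>x. c * f x) = (\<lambda>x. c * iter_partial bs f x)"
  using assms(2)
proof (induction bs)
  case (Cons b bs)
  have "frechet_derivative (\<lambda>x. c * iter_partial bs f x) (at x) b =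
        c * frechet_derivative (iter_partial bs f) (at x) b" for x
  proof -
    have "iter_partial bs f differentiable (at x)"
      using assms Cons.prems by (auto intro: smooth_differentiable)
    then have "((\<lambda>x. c * iter_partial bs f x) has_derivative
        (\<lambda>h. c * frechet_derivative (iter_partial bs f) (at x) h)) (at x)"
      by (intro has_derivative_mult_right) (simp_all add: frechet_derivative_works)
    from frechet_derivative_at[OF this, symmetric] show ?thesis
      by simp
  qed
  with Cons show ?case
    by (simp add: partial_deriv_def)
qed simp

lemma smooth_add:
  assumes "f \<in> smooth" "g \<in> smooth"
  shows "(\<lambda>x. f x + g x) \<in> smooth"
  unfolding smooth_def
proof (intro CollectI allI impI)
  fix bs :: "'a list" and x
  assume bs: "set bs \<subseteq> Basis"
  show "iter_partial bs (\<lambda>x. f x + g x) differentiable at x"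
    unfolding iter_partial_add[OF assms bs]
    by (intro differentiable_add smooth_differentiable assms bs)
qed

lemma smooth_cmult:
  assumes "f \<in> smooth"
  shows "(\<lambda>x. c * f x) \<in> smooth"
  unfolding smooth_def
proof (intro CollectI allI impI)
  fix bs :: "'a list" and x
  assume bs: "set bs \<subseteq> Basis"
  show "iter_partial bs (\<lambda>x. c * f x) differentiable at x"
    unfolding iter_partial_cmult[OF assms bs]
    by (intro differentiable_mult differentiable_const smooth_differentiable assms bs)
qed

lemma mu_le_iff:
  "mu q l f \<le> B \<longleftrightarrow>
     (\<forall>x. \<forall>bs\<in>indices l. ennreal ((1 + norm x) powi q * norm (iter_partial bs f x)) \<le> B)"
  by (auto simp: mu_def SUP_le_iff)

lemma mu_upper:
  "bs \<in> indices l \<Longrightarrow> ennreal ((1 + norm x) powi q * norm (iter_partial bs f x)) \<le> mu q l f"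
  using mu_le_iff by blast

lemma mu_mono:
  assumes "q \<le> q'"
  shows "mu q l f \<le> mu q' l f"
  unfolding mu_le_iff
proof (intro allI ballI)
  fix x :: 'a and bs :: "'a list"
  assume bs: "bs \<in> indices l"
  have "(1 + norm x) powi q \<le> (1 + norm x) powi q'"
    using assms by (intro power_int_increasing) auto
  then have "(1 + norm x) powi q * norm (iter_partial bs f x)
      \<le> (1 + norm x) powi q' * norm (iter_partial bs f x)"
    by (intro mult_right_mono) auto
  then show "ennreal ((1 + norm x) powi q * norm (iter_partial bs f x)) \<le> mu q' l f"
    using mu_upper[OF bs, of x q' f] by (meson ennreal_leI order_trans)
qed

lemma mu_add:
  assumes "f \<in> smooth" "g \<in> smooth"
  shows "mu q l (\<lambda>x. f x + g x) \<le> mu q l f + mu q l g"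
  unfolding mu_le_iff
proof (intro allI ballI)
  fix x :: 'a and bs :: "'a list"
  assume bs: "bs \<in> indices l"
  let ?w = "(1 + norm x) powi q"
  have w: "0 \<le> ?w" by simp
  have "iter_partial bs (\<lambda>x. f x + g x) x = iter_partial bs f x + iter_partial bs g x"
    using assms bs by (simp add: iter_partial_add indices_def)
  then have "?w * norm (iter_partial bs (\<lambda>x. f x + g x) x)
      \<le> ?w * norm (iter_partial bs f x) + ?w * norm (iter_partial bs g x)"
    using mult_left_mono[OF norm_triangle_ineq w] by (simp add: distrib_left)
  then have "ennreal (?w * norm (iter_partial bs (\<lambda>x. f x + g x) x))
      \<le> ennreal (?w * norm (iter_partial bs f x)) + ennreal (?w * norm (iter_partial bs g x))"
    using w by (simp add: ennreal_leI ennreal_plus[symmetric] del: ennreal_plus)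
  also have "\<dots> \<le> mu q l f + mu q l g"
    using bs by (intro add_mono mu_upper)
  finally show "ennreal (?w * norm (iter_partial bs (\<lambda>x. f x + g x) x)) \<le> mu q l f + mu q l g" .
qed

lemma mu_cmult:
  assumes "f \<in> smooth"
  shows "mu q l (\<lambda>x. c * f x) \<le> ennreal (norm c) * mu q l f"
  unfolding mu_le_iff
proof (intro allI ballI)
  fix x :: 'a and bs :: "'a list"
  assume bs: "bs \<in> indices l"
  let ?w = "(1 + norm x) powi q"
  have "ennreal (?w * norm (iter_partial bs (\<lambda>x. c * f x) x)) =
        ennreal (norm c) * ennreal (?w * norm (iter_partial bs f x))"
    using assms bs
    by (simp add: iter_partial_cmult indices_def norm_mult ennreal_mult[symmetric] mult.left_commute)
  also have "\<dots> \<le> ennreal (norm c) * mu q l f"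
    using bs by (intro mult_left_mono mu_upper) auto
  finally show "ennreal (?w * norm (iter_partial bs (\<lambda>x. c * f x) x)) \<le> ennreal (norm c) * mu q l f" .
qed

lemma mu_add_le:
  assumes "f \<in> smooth" "g \<in> smooth" "mu (- int q) l f \<le> a" "mu (- int q') l g \<le> b"
  shows "mu (- int (max q q')) l (\<lambda>x. f x + g x) \<le> a + b"
proof -
  have "mu (- int (max q q')) l f \<le> a"
    by (rule order_trans[OF mu_mono assms(3)]) simp
  moreover have "mu (- int (max q q')) l g \<le> b"
    by (rule order_trans[OF mu_mono assms(4)]) simp
  ultimately show ?thesis
    by (rule order_trans[OF mu_add[OF assms(1,2)] add_mono])
qed

lemma OM_smooth: "f \<in> OM \<Longrightarrow> f \<in> smooth"
  by (simp add: OM_def)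

lemma OM_add:
  assumes "f \<in> OM" "g \<in> OM"
  shows "(\<lambda>x. f x + g x) \<in> OM"
proof -
  have "\<exists>q::nat. mu (- int q) l (\<lambda>x. f x + g x) < \<infinity>" for l
  proof -
    obtain q q' :: nat where "mu (- int q) l f < \<infinity>" "mu (- int q') l g < \<infinity>"
      using assms unfolding OM_def by blast
    moreover have "mu (- int (max q q')) l (\<lambda>x. f x + g x) \<le> mu (- int q) l f + mu (- int q') l g"
      using assms by (intro mu_add_le) (auto intro: OM_smooth)
    ultimately show ?thesis
      by (intro exI[of _ "max q q'"]) (simp add: le_less_trans)
  qed
  then show ?thesis
    using assms by (simp add: OM_def smooth_add)
qed

lemma OM_cmult:
  assumes "f \<in> OM"
  shows "(\<lambda>x. c * f x) \<in> OM"
proof -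
  have "\<exists>q::nat. mu (- int q) l (\<lambda>x. c * f x) < \<infinity>" for l
  proof -
    obtain q :: nat where "mu (- int q) l f < \<infinity>"
      using assms unfolding OM_def by blast
    moreover have "mu (- int q) l (\<lambda>x. c * f x) \<le> ennreal (norm c) * mu (- int q) l f"
      using assms by (intro mu_cmult OM_smooth)
    ultimately show ?thesis
      by (intro exI[of _ q]) (simp add: ennreal_mult_less_top le_less_trans)
  qed
  then show ?thesis
    using assms by (simp add: OM_def smooth_cmult)
qed

lemma at_right_0_in_unit: "\<forall>\<^sub>F \<epsilon> in at_right (0::real). \<epsilon> \<in> {0<..1}"
  using eventually_at_right_real[of 0 "1::real"] by (auto elim: eventually_mono)

lemma E_tau_add:
  assumes "f \<in> E_tau" "g \<in> E_tau"
  shows "(\<lambda>\<epsilon> x. f \<epsilon> x + g \<epsilon> x) \<in> E_tau"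
proof -
  have "\<exists>(q::nat) (m::nat). \<exists>C::real. \<forall>\<^sub>F \<epsilon> in at_right 0.
          mu (- int q) l (\<lambda>x. f \<epsilon> x + g \<epsilon> x) \<le> ennreal (C * \<epsilon> powi (- int m))" for l
  proof -
    obtain q m :: nat and C where f: "\<forall>\<^sub>F \<epsilon> in at_right 0. mu (- int q) l (f \<epsilon>) \<le> ennreal (C * \<epsilon> powi (- int m))"
      using assms(1) unfolding E_tau_def by blast
    obtain q' m' :: nat and C' where g: "\<forall>\<^sub>F \<epsilon> in at_right 0. mu (- int q') l (g \<epsilon>) \<le> ennreal (C' * \<epsilon> powi (- int m'))"
      using assms(2) unfolding E_tau_def by blast
    have "\<forall>\<^sub>F \<epsilon> in at_right 0. mu (- int (max q q')) l (\<lambda>x. f \<epsilon> x + g \<epsilon> x)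
        \<le> ennreal ((\<bar>C\<bar> + \<bar>C'\<bar>) * \<epsilon> powi (- int (max m m')))"
      using f g at_right_0_in_unit
    proof eventually_elim
      case (elim \<epsilon>)
      let ?M = "\<epsilon> powi (- int (max m m'))"
      have le: "\<epsilon> powi (- int m) \<le> ?M" "\<epsilon> powi (- int m') \<le> ?M"
        using elim(3) by (auto intro!: power_int_decreasing)
      have pos: "0 \<le> ?M" "0 \<le> \<epsilon> powi (- int m)" "0 \<le> \<epsilon> powi (- int m')"
        using elim(3) by auto
      have "mu (- int (max q q')) l (\<lambda>x. f \<epsilon> x + g \<epsilon> x)
          \<le> ennreal (C * \<epsilon> powi (- int m)) + ennreal (C' * \<epsilon> powi (- int m'))"
        using elim assms by (intro mu_add_le) (simp_all add: E_tau_def OM_smooth)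
      also have "\<dots> \<le> ennreal (\<bar>C\<bar> * ?M) + ennreal (\<bar>C'\<bar> * ?M)"
        using le pos by (intro add_mono ennreal_leI mult_mono) auto
      also have "\<dots> = ennreal ((\<bar>C\<bar> + \<bar>C'\<bar>) * ?M)"
        using pos by (simp add: ennreal_plus[symmetric] distrib_right del: ennreal_plus)
      finally show ?case .
    qed
    then show ?thesis by blast
  qed
  then show ?thesis
    using assms by (simp add: E_tau_def OM_add)
qed

lemma N_tau_bound:
  "f \<in> N_tau \<Longrightarrow> \<exists>q::nat. \<forall>p::nat. \<exists>C::real. \<forall>\<^sub>F \<epsilon> in at_right 0. mu (- int q) l (f \<epsilon>) \<le> ennreal (C * \<epsilon> ^ p)"
  by (simp add: N_tau_def)

lemma N_tau_add:
  assumes "f \<in> N_tau" "g \<in> N_tau"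
  shows "(\<lambda>\<epsilon> x. f \<epsilon> x + g \<epsilon> x) \<in> N_tau"
proof -
  have "\<exists>q::nat. \<forall>p::nat. \<exists>C::real. \<forall>\<^sub>F \<epsilon> in at_right 0.
          mu (- int q) l (\<lambda>x. f \<epsilon> x + g \<epsilon> x) \<le> ennreal (C * \<epsilon> ^ p)" for l
  proof -
    obtain q :: nat where f: "\<forall>p::nat. \<exists>C::real. \<forall>\<^sub>F \<epsilon> in at_right 0. mu (- int q) l (f \<epsilon>) \<le> ennreal (C * \<epsilon> ^ p)"
      using N_tau_bound[OF assms(1)] by (rule exE)
    obtain q' :: nat where g: "\<forall>p::nat. \<exists>C::real. \<forall>\<^sub>F \<epsilon> in at_right 0. mu (- int q') l (g \<epsilon>) \<le> ennreal (C * \<epsilon> ^ p)"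
      using N_tau_bound[OF assms(2)] by (rule exE)
    have "\<exists>C::real. \<forall>\<^sub>F \<epsilon> in at_right 0. mu (- int (max q q')) l (\<lambda>x. f \<epsilon> x + g \<epsilon> x) \<le> ennreal (C * \<epsilon> ^ p)" for p
    proof -
      obtain C where f': "\<forall>\<^sub>F \<epsilon> in at_right 0. mu (- int q) l (f \<epsilon>) \<le> ennreal (C * \<epsilon> ^ p)"
        using spec[OF f, of p] by (rule exE)
      obtain C' where g': "\<forall>\<^sub>F \<epsilon> in at_right 0. mu (- int q') l (g \<epsilon>) \<le> ennreal (C' * \<epsilon> ^ p)"
        using spec[OF g, of p] by (rule exE)
      have "\<forall>\<^sub>F \<epsilon> in at_right 0. mu (- int (max q q')) l (\<lambda>x. f \<epsilon> x + g \<epsilon> x)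
          \<le> ennreal ((\<bar>C\<bar> + \<bar>C'\<bar>) * \<epsilon> ^ p)"
        using f' g' at_right_0_in_unit
      proof eventually_elim
        case (elim \<epsilon>)
        have pos: "0 \<le> \<epsilon> ^ p"
          using elim(3) by auto
        have "mu (- int (max q q')) l (\<lambda>x. f \<epsilon> x + g \<epsilon> x) \<le> ennreal (C * \<epsilon> ^ p) + ennreal (C' * \<epsilon> ^ p)"
          using elim assms by (intro mu_add_le) (simp_all add: N_tau_def OM_smooth)
        also have "\<dots> \<le> ennreal (\<bar>C\<bar> * \<epsilon> ^ p) + ennreal (\<bar>C'\<bar> * \<epsilon> ^ p)"
          using pos by (intro add_mono ennreal_leI mult_right_mono) auto
        also have "\<dots> = ennreal ((\<bar>C\<bar> + \<bar>C'\<bar>) * \<epsilon> ^ p)"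
          using pos by (simp add: ennreal_plus[symmetric] distrib_right del: ennreal_plus)
        finally show ?case .
      qed
      then show ?thesis by blast
    qed
    then show ?thesis by blast
  qed
  then show ?thesis
    using assms by (simp add: N_tau_def OM_add)
qed

lemma mu_cmult_le:
  assumes "f \<in> smooth" "mu q l f \<le> ennreal (C * e)" "0 \<le> e"
  shows "mu q l (\<lambda>x. c * f x) \<le> ennreal ((norm c * \<bar>C\<bar>) * e)"
proof -
  have "mu q l (\<lambda>x. c * f x) \<le> ennreal (norm c) * mu q l f"
    using assms(1) by (rule mu_cmult)
  also have "\<dots> \<le> ennreal (norm c) * ennreal (\<bar>C\<bar> * e)"
    using assms(2,3) by (intro mult_left_mono order_trans[OF assms(2)] ennreal_leI mult_right_mono) auto
  also have "\<dots> = ennreal ((norm c * \<bar>C\<bar>) * e)"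
    using assms(3) by (simp add: ennreal_mult[symmetric] mult.assoc)
  finally show ?thesis .
qed

lemma E_tau_cmult:
  assumes "f \<in> E_tau"
  shows "(\<lambda>\<epsilon> x. c * f \<epsilon> x) \<in> E_tau"
proof -
  have "\<exists>(q::nat) (m::nat). \<exists>C::real. \<forall>\<^sub>F \<epsilon> in at_right 0.
          mu (- int q) l (\<lambda>x. c * f \<epsilon> x) \<le> ennreal (C * \<epsilon> powi (- int m))" for l
  proof -
    obtain q m :: nat and C where "\<forall>\<^sub>F \<epsilon> in at_right 0. mu (- int q) l (f \<epsilon>) \<le> ennreal (C * \<epsilon> powi (- int m))"
      using assms unfolding E_tau_def by blast
    then have "\<forall>\<^sub>F \<epsilon> in at_right 0. mu (- int q) l (\<lambda>x. c * f \<epsilon> x)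
        \<le> ennreal ((norm c * \<bar>C\<bar>) * \<epsilon> powi (- int m))"
      using at_right_0_in_unit
    proof eventually_elim
      case (elim \<epsilon>)
      then show ?case
        using assms by (intro mu_cmult_le) (simp_all add: E_tau_def OM_smooth)
    qed
    then show ?thesis by blast
  qed
  then show ?thesis
    using assms by (simp add: E_tau_def OM_cmult)
qed

lemma N_tau_cmult:
  assumes "f \<in> N_tau"
  shows "(\<lambda>\<epsilon> x. c * f \<epsilon> x) \<in> N_tau"
proof -
  have "\<exists>q::nat. \<forall>p::nat. \<exists>C::real. \<forall>\<^sub>F \<epsilon> in at_right 0.
          mu (- int q) l (\<lambda>x. c * f \<epsilon> x) \<le> ennreal (C * \<epsilon> ^ p)" for l
  proof -
    obtain q :: nat where f: "\<forall>p::nat. \<exists>C::real. \<forall>\<^sub>F \<epsilon> in at_right 0. mu (- int q) l (f \<epsilon>) \<le> ennreal (C * \<epsilon> ^ p)"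
      using N_tau_bound[OF assms] by (rule exE)
    have "\<exists>C::real. \<forall>\<^sub>F \<epsilon> in at_right 0. mu (- int q) l (\<lambda>x. c * f \<epsilon> x) \<le> ennreal (C * \<epsilon> ^ p)" for p
    proof -
      obtain C where "\<forall>\<^sub>F \<epsilon> in at_right 0. mu (- int q) l (f \<epsilon>) \<le> ennreal (C * \<epsilon> ^ p)"
        using spec[OF f, of p] by (rule exE)
      then have "\<forall>\<^sub>F \<epsilon> in at_right 0. mu (- int q) l (\<lambda>x. c * f \<epsilon> x) \<le> ennreal ((norm c * \<bar>C\<bar>) * \<epsilon> ^ p)"
        using at_right_0_in_unit
      proof eventually_elim
        case (elim \<epsilon>)
        then show ?case
          using assms by (intro mu_cmult_le) (simp_all add: N_tau_def OM_smooth)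
      qed
      then show ?thesis by blast
    qed
    then show ?thesis by blast
  qed
  then show ?thesis
    using assms by (simp add: N_tau_def OM_cmult)
qed

lemma iter_partial_zero: "iter_partial bs (\<lambda>x. 0) = (\<lambda>x. 0)"
  by (induction bs) (simp_all add: partial_deriv_def)

lemma mu_zero: "mu q l (\<lambda>x. 0) = 0"
proof -
  have "mu q l (\<lambda>x. 0) \<le> 0"
    unfolding mu_le_iff by (simp add: iter_partial_zero)
  then show ?thesis by simp
qed

lemma zero_OM: "(\<lambda>x. 0) \<in> OM"
  by (simp add: OM_def smooth_def iter_partial_zero mu_zero)

lemma zero_E_tau: "(\<lambda>\<epsilon> x. 0) \<in> E_tau"
  by (simp add: E_tau_def zero_OM mu_zero)

lemma zero_N_tau: "(\<lambda>\<epsilon> x. 0) \<in> N_tau"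
  by (simp add: N_tau_def zero_OM mu_zero)

definition tau_rel ::
    "(real \<Rightarrow> 'a::euclidean_space \<Rightarrow> complex) \<Rightarrow> (real \<Rightarrow> 'a \<Rightarrow> complex) \<Rightarrow> bool" where
  "tau_rel f g \<longleftrightarrow> f \<in> E_tau \<and> g \<in> E_tau \<and> (\<lambda>\<epsilon> x. f \<epsilon> x - g \<epsilon> x) \<in> N_tau"

lemma part_equivp_tau_rel: "part_equivp (tau_rel :: (real \<Rightarrow> 'a::euclidean_space \<Rightarrow> complex) \<Rightarrow> _)" (is "part_equivp ?R")
proof (rule part_equivpI)
  show "\<exists>f. ?R f f"
    using zero_E_tau zero_N_tau by (auto simp: tau_rel_def)
  show "symp ?R"
  proof (rule sympI)
    fix f g :: "real \<Rightarrow> 'a \<Rightarrow> complex"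
    assume "tau_rel f g"
    then show "tau_rel g f"
      using N_tau_cmult[of "\<lambda>\<epsilon> x. f \<epsilon> x - g \<epsilon> x" "-1"] by (simp add: tau_rel_def)
  qed
  show "transp ?R"
  proof (rule transpI)
    fix f g h :: "real \<Rightarrow> 'a \<Rightarrow> complex"
    assume "tau_rel f g" "tau_rel g h"
    then show "tau_rel f h"
      using N_tau_add[of "\<lambda>\<epsilon> x. f \<epsilon> x - g \<epsilon> x" "\<lambda>\<epsilon> x. g \<epsilon> x - h \<epsilon> x"] by (simp add: tau_rel_def)
  qed
qed

text \<open>
  \<open>Gtau u\<close> is the class of the net \<open>u\<close>; it is only meaningful for \<open>u \<in> E_tau\<close>.
\<close>

quotient_type (overloaded) 'a G_tau = "real \<Rightarrow> 'a::euclidean_space \<Rightarrow> complex" / partial: tau_rel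
  morphisms rep_Gtau Gtau
  by (rule part_equivp_tau_rel)

lift_definition gscale :: "complex \<Rightarrow> 'a::euclidean_space G_tau \<Rightarrow> 'a G_tau" is
  "\<lambda>c f \<epsilon> x. c * f \<epsilon> x"
  using N_tau_cmult by (fastforce simp: tau_rel_def E_tau_cmult right_diff_distrib[symmetric])

instantiation G_tau :: (euclidean_space) ab_group_add
begin

lift_definition zero_G_tau :: "'a G_tau" is "\<lambda>\<epsilon> x. 0"
  by (simp add: tau_rel_def zero_E_tau zero_N_tau)

lift_definition plus_G_tau :: "'a G_tau \<Rightarrow> 'a G_tau \<Rightarrow> 'a G_tau" is "\<lambda>f g \<epsilon> x. f \<epsilon> x + g \<epsilon> x"
proof -
  fix f f' g g' :: "real \<Rightarrow> 'a \<Rightarrow> complex"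
  assume "tau_rel f f'" "tau_rel g g'"
  then show "tau_rel (\<lambda>\<epsilon> x. f \<epsilon> x + g \<epsilon> x) (\<lambda>\<epsilon> x. f' \<epsilon> x + g' \<epsilon> x)"
    using N_tau_add[of "\<lambda>\<epsilon> x. f \<epsilon> x - f' \<epsilon> x" "\<lambda>\<epsilon> x. g \<epsilon> x - g' \<epsilon> x"]
    by (simp add: tau_rel_def E_tau_add add_diff_add)
qed

definition uminus_G_tau :: "'a G_tau \<Rightarrow> 'a G_tau" where
  "uminus_G_tau u = gscale (-1) u"

definition minus_G_tau :: "'a G_tau \<Rightarrow> 'a G_tau \<Rightarrow> 'a G_tau" where
  "minus_G_tau u v = u + gscale (-1) v"

instance
proof
  fix a b c :: "'a G_tau"
  show "a + b + c = a + (b + c)"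
    by transfer (simp add: tau_rel_def E_tau_add zero_N_tau add.assoc)
  show "a + b = b + a"
    by transfer (simp add: tau_rel_def E_tau_add zero_N_tau add.commute)
  show "0 + a = a"
    by transfer (simp add: tau_rel_def zero_N_tau)
  show "- a + a = 0"
    unfolding uminus_G_tau_def by transfer (simp add: tau_rel_def zero_N_tau zero_E_tau)
  show "a - b = a + - b"
    by (simp add: minus_G_tau_def uminus_G_tau_def)
qed

end

lemma vector_space_gscale: "vector_space (gscale :: complex \<Rightarrow> 'a::euclidean_space G_tau \<Rightarrow> 'a G_tau)"
proof
  fix a b :: complex and x y :: "'a G_tau"
  show "gscale a (x + y) = gscale a x + gscale a y"
    by transfer (simp add: tau_rel_def E_tau_add E_tau_cmult zero_N_tau distrib_left)
  show "gscale (a + b) x = gscale a x + gscale b x"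
    by transfer (simp add: tau_rel_def E_tau_add E_tau_cmult zero_N_tau distrib_right)
  show "gscale a (gscale b x) = gscale (a * b) x"
    by transfer (simp add: tau_rel_def E_tau_add E_tau_cmult zero_N_tau mult.assoc)
  show "gscale 1 x = x"
    by transfer (simp add: tau_rel_def zero_N_tau)
qed

definition E_M :: "(real \<Rightarrow> real) set" where
  "E_M = {C. (\<forall>\<epsilon>\<in>{0<..1}. 0 \<le> C \<epsilon>) \<and> (\<exists>m::nat. C \<in> O[at_right 0](\<lambda>\<epsilon>. \<epsilon> powi (- int m)))}"

definition moderate_growth ::
    "(real \<Rightarrow> ('a::euclidean_space \<Rightarrow> complex) \<Rightarrow> ('a \<Rightarrow> complex)) \<Rightarrow> bool" where
  "moderate_growth A \<longleftrightarrow>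
     (\<forall>\<epsilon>\<in>{0<..1}. cont_linear_OM (A \<epsilon>)) \<and>
     (\<forall>l. \<exists>C\<in>E_M. \<exists>(p::nat) (q::nat) (l'::nat). \<forall>f\<in>OM. \<forall>\<epsilon>\<in>{0<..1}.
        mu (- int p) l (A \<epsilon> f) \<le> ennreal (C \<epsilon>) * mu (- int q) l' f)"

definition L_G_tau :: "('a::euclidean_space G_tau \<Rightarrow> 'a G_tau) set" where
  "L_G_tau = {A. Vector_Spaces.linear gscale gscale A \<and>
     (\<exists>B. moderate_growth B \<and>
        (\<forall>f\<in>E_tau. (\<lambda>\<epsilon>. B \<epsilon> (f \<epsilon>)) \<in> E_tau \<and> A (Gtau f) = Gtau (\<lambda>\<epsilon>. B \<epsilon> (f \<epsilon>))))}"

definition kernel_op ::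
    "real \<Rightarrow> ('a::euclidean_space \<times> 'a \<Rightarrow> complex) \<Rightarrow> ('a \<Rightarrow> complex) \<Rightarrow> 'a \<Rightarrow> complex" where
  "kernel_op \<epsilon> K f x = (\<integral>y. K (x, y) * f y * of_real (exp (- \<epsilon> * (norm y)\<^sup>2)) \<partial>lborel)"

definition kernel_comp ::
    "real \<Rightarrow> ('a::euclidean_space \<times> 'a \<Rightarrow> complex) \<Rightarrow> ('a \<times> 'a \<Rightarrow> complex) \<Rightarrow> 'a \<times> 'a \<Rightarrow> complex" where
  "kernel_comp \<epsilon> K2 K1 = (\<lambda>(x, y). \<integral>z. K2 (x, z) * K1 (z, y) * of_real (exp (- \<epsilon> * (norm z)\<^sup>2)) \<partial>lborel)"

end

theory Submission
  imports Defs "HOL-Probability.Sinc_Integral"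
begin

text \<open>
  Two estimates govern everything. The weight \<open>exp (- \<epsilon> * (norm y)\<^sup>2)\<close> dominates every polynomial, and
  its moments grow at most like a power of \<open>1 / \<epsilon>\<close> (\<open>gauss_moment_bound\<close>). Consequently the integrals
  defining \<open>kernel_op\<close> and \<open>kernel_comp\<close> may be differentiated under the integral sign
  (\<open>iter_partial_integral\<close>), and polynomial bounds on the kernels and on the argument, with constants
  moderate in \<open>\<epsilon>\<close>, pass to polynomial bounds of the same kind on the results (\<open>kernel_op_E_tau\<close>,
  \<open>kernel_comp_E_tau\<close>). The same bounds justify Fubini's theorem, so that for each \<open>\<epsilon>\<close> the composition
  of the two operators is the operator with the composed kernel (\<open>kernel_op_kernel_op\<close>).

  What remains is that a moderate kernel defines an element of \<open>L_G_tau\<close>. The obvious representative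
  \<open>kernel_op \<epsilon> (K \<epsilon>)\<close> need not be of moderate growth: the polynomial order of the \<open>l\<close>-th derivatives of
  \<open>K \<epsilon>\<close> is controlled only for \<open>\<epsilon>\<close> below a threshold that depends on \<open>l\<close>, whereas moderate growth asks,
  for every \<open>l\<close>, for one order \<open>p\<close> that serves all \<open>\<epsilon>\<close> in \<open>(0,1]\<close>. The representative is therefore multiplied
  by the very flat Gaussian \<open>damp \<epsilon> x = exp (- exp (- 1 / \<epsilon>) * (norm x)\<^sup>2)\<close>. For each fixed \<open>\<epsilon>\<close>, bounded
  functions now have images that are bounded together with all their derivatives, so above the threshold
  any order will do and only the constant, which is unrestricted there, depends on \<open>\<epsilon>\<close>
  (\<open>moderate_growth_damped_kernel_op\<close>). The class of the result does not change, because
  \<open>1 - damp \<epsilon>\<close> and its derivatives are at most polynomials times \<open>exp (- 1 / \<epsilon>)\<close>, which is smaller than every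
  power of \<open>\<epsilon>\<close> (\<open>tau_rel_damp\<close>). Since the composed kernel is again moderate, the
  composition is covered by the same lemma, \<open>generalised_integral_operator_in_L\<close>.
\<close>


section \<open>Partial derivatives of products, slices and tensor products\<close>

text \<open>
  All estimates below are carried out as pointwise real inequalities; this is the bridge to the
  extended-real seminorms of the definitions.
\<close>

lemma mu_le_ennreal_iff:
  assumes "0 \<le> M"
  shows "mu (- int q) l f \<le> ennreal M \<longleftrightarrow>
    (\<forall>bs\<in>indices l. \<forall>x. norm (iter_partial bs f x) \<le> M * (1 + norm x) ^ q)"
proof -
  have "(1 + norm x) powi (- int q) * c \<le> M \<longleftrightarrow> c \<le> M * (1 + norm x) ^ q" for x :: 'a and c
  proof -
    have "0 < (1 + norm x) ^ q"
      by (simp add: add_pos_nonneg)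
    then show ?thesis
      by (simp add: power_int_minus field_simps)
  qed
  then show ?thesis
    using assms by (auto simp: mu_le_iff)
qed

lemma iter_partial_append: "iter_partial (cs @ bs) f = iter_partial cs (iter_partial bs f)"
  by (induction cs) simp_all

lemma has_derivative_partial_deriv:
  assumes "f differentiable (at x)"
  shows "(f has_derivative (\<lambda>h. \<Sum>b\<in>Basis. (h \<bullet> b) *\<^sub>R partial_deriv b f x)) (at x)"
proof -
  have f: "(f has_derivative frechet_derivative f (at x)) (at x)"
    using assms by (simp add: frechet_derivative_works)
  then interpret D: bounded_linear "frechet_derivative f (at x)"
    by (rule has_derivative_bounded_linear)
  have "frechet_derivative f (at x) = (\<lambda>h. \<Sum>b\<in>Basis. (h \<bullet> b) *\<^sub>R partial_deriv b f x)"
  proof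
    fix h
    have "frechet_derivative f (at x) h = frechet_derivative f (at x) (\<Sum>b\<in>Basis. (h \<bullet> b) *\<^sub>R b)"
      by (simp only: euclidean_representation)
    then show "frechet_derivative f (at x) h = (\<Sum>b\<in>Basis. (h \<bullet> b) *\<^sub>R partial_deriv b f x)"
      by (simp only: D.sum D.scaleR partial_deriv_def)
  qed
  with f show ?thesis
    by simp
qed

lemma partial_deriv_eq:
  assumes "(f has_derivative D) (at x)"
  shows "partial_deriv b f x = D b"
  using frechet_derivative_at[OF assms] by (simp add: partial_deriv_def)

lemma smooth_has_derivative:
  assumes "f \<in> smooth" "set bs \<subseteq> Basis"
  shows "(iter_partial bs f has_derivative (\<lambda>h. \<Sum>b\<in>Basis. (h \<bullet> b) *\<^sub>R iter_partial (b # bs) f x)) (at x)"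
  using has_derivative_partial_deriv[OF smooth_differentiable[OF assms]] by simp

lemma smooth_continuous:
  assumes "f \<in> smooth" "set bs \<subseteq> Basis"
  shows "continuous_on A (iter_partial bs f)"
  using smooth_differentiable[OF assms]
  by (meson continuous_at_imp_continuous_on differentiable_imp_continuous_within)

text \<open>
  The terms of the Leibniz rule: every derivative falls on the first or on the second factor. A list
  is used, rather than a set, because equal terms must be counted with their multiplicities.
\<close>

fun splits :: "'a list \<Rightarrow> ('a list \<times> 'a list) list" where
  "splits [] = [([], [])]"
| "splits (b # bs) = map (\<lambda>(cs, ds). (b # cs, ds)) (splits bs) @ map (\<lambda>(cs, ds). (cs, b # ds)) (splits bs)"

lemma length_splits: "length (splits bs) = 2 ^ length bs"
  by (induction bs) simp_all

lemma splitsD: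
  "(cs, ds) \<in> set (splits bs) \<Longrightarrow> set cs \<subseteq> set bs \<and> set ds \<subseteq> set bs \<and> length cs + length ds = length bs"
  by (induction bs arbitrary: cs ds) fastforce+

lemma has_derivative_sum_list:
  assumes "\<And>p. p \<in> set ps \<Longrightarrow> (F p has_derivative F' p) (at x)"
  shows "((\<lambda>y. \<Sum>p\<leftarrow>ps. F p y) has_derivative (\<lambda>h. \<Sum>p\<leftarrow>ps. F' p h)) (at x)"
  using assms by (induction ps) (auto intro!: has_derivative_add)

text \<open>
  Only derivatives of order less than that of the product rule are required to be differentiable. This
  is what makes the rule available while the smoothness of a factor is itself being proved by
  induction on the order, as happens in \<open>gauss_smooth\<close>.
\<close>

lemma iter_partial_mult:
  assumes "\<And>cs x. set cs \<subseteq> Basis \<Longrightarrow> length cs < length bs \<Longrightarrow> iter_partial cs f differentiable (at x)"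
    and "\<And>cs x. set cs \<subseteq> Basis \<Longrightarrow> length cs < length bs \<Longrightarrow> iter_partial cs g differentiable (at x)"
    and "set bs \<subseteq> Basis"
  shows "iter_partial bs (\<lambda>x. f x * g x) = (\<lambda>x. \<Sum>(cs, ds)\<leftarrow>splits bs. iter_partial cs f x * iter_partial ds g x)"
  using assms
proof (induction bs)
  case (Cons b bs)
  have IH: "iter_partial bs (\<lambda>x. f x * g x) = (\<lambda>x. \<Sum>(cs, ds)\<leftarrow>splits bs. iter_partial cs f x * iter_partial ds g x)"
    using Cons by simp
  have "partial_deriv b (iter_partial bs (\<lambda>x. f x * g x)) x
      = (\<Sum>p\<leftarrow>splits bs. iter_partial (fst p) f x * iter_partial (b # snd p) g x
          + iter_partial (b # fst p) f x * iter_partial (snd p) g x)" for x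
    unfolding IH case_prod_unfold
  proof (subst partial_deriv_eq[OF has_derivative_sum_list])
    fix p assume p: "p \<in> set (splits bs)"
    then have "iter_partial (fst p) f differentiable (at x)" "iter_partial (snd p) g differentiable (at x)"
      using splitsD[of "fst p" "snd p" bs] Cons.prems by auto
    then show "((\<lambda>x. iter_partial (fst p) f x * iter_partial (snd p) g x) has_derivative
        (\<lambda>h. iter_partial (fst p) f x * frechet_derivative (iter_partial (snd p) g) (at x) h
          + frechet_derivative (iter_partial (fst p) f) (at x) h * iter_partial (snd p) g x)) (at x)"
      by (intro has_derivative_mult) (simp_all add: frechet_derivative_works)
  qed (simp add: partial_deriv_def)
  then show ?case
    by (simp add: fun_eq_iff sum_list_addf case_prod_unfold o_def add.commute)
qed simp

lemma iter_partial_mult_smooth: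
  assumes "f \<in> smooth" "g \<in> smooth" "set bs \<subseteq> Basis"
  shows "iter_partial bs (\<lambda>x. f x * g x) = (\<lambda>x. \<Sum>(cs, ds)\<leftarrow>splits bs. iter_partial cs f x * iter_partial ds g x)"
  using assms by (intro iter_partial_mult) (auto intro: smooth_differentiable)

lemma differentiable_sum_list:
  assumes "\<And>p. p \<in> set ps \<Longrightarrow> F p differentiable (at x)"
  shows "(\<lambda>y. \<Sum>p\<leftarrow>ps. F p y) differentiable (at x)"
  using assms has_derivative_sum_list unfolding differentiable_def by metis

lemma smooth_mult:
  assumes "f \<in> smooth" "g \<in> smooth"
  shows "(\<lambda>x. f x * g x) \<in> smooth"
  unfolding smooth_def
proof (intro CollectI allI impI)
  fix bs :: "'a list" and x
  assume bs: "set bs \<subseteq> Basis"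
  have "(\<lambda>x. iter_partial (fst p) f x * iter_partial (snd p) g x) differentiable at x"
    if "p \<in> set (splits bs)" for p
    using splitsD[of "fst p" "snd p" bs] that bs assms
    by (intro differentiable_mult smooth_differentiable) auto
  then show "iter_partial bs (\<lambda>x. f x * g x) differentiable at x"
    unfolding iter_partial_mult_smooth[OF assms bs] case_prod_unfold by (intro differentiable_sum_list)
qed

lemma norm_sum_list_le:
  fixes F :: "'b \<Rightarrow> 'c::real_normed_vector"
  assumes "\<And>p. p \<in> set ps \<Longrightarrow> norm (F p) \<le> B"
  shows "norm (\<Sum>p\<leftarrow>ps. F p) \<le> real (length ps) * B"
  using assms
proof (induction ps)
  case (Cons p ps)
  then have "norm (F p) \<le> B" "norm (\<Sum>p\<leftarrow>ps. F p) \<le> real (length ps) * B"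
    by auto
  then show ?case
    using norm_triangle_ineq[of "F p" "\<Sum>p\<leftarrow>ps. F p"] by (simp add: algebra_simps)
qed simp

lemma norm_iter_partial_mult_le:
  assumes "f \<in> smooth" "g \<in> smooth" "bs \<in> indices l"
    and f: "\<And>cs. cs \<in> indices l \<Longrightarrow> norm (iter_partial cs f x) \<le> M"
    and g: "\<And>cs. cs \<in> indices l \<Longrightarrow> norm (iter_partial cs g x) \<le> N"
  shows "norm (iter_partial bs (\<lambda>x. f x * g x) x) \<le> 2 ^ l * (M * N)"
proof -
  have bs: "set bs \<subseteq> Basis" "length bs \<le> l"
    using assms(3) by (auto simp: indices_def)
  have "[] \<in> (indices l :: 'a list set)"
    by (simp add: indices_def)
  then have "0 \<le> M" "0 \<le> N"
    using f g norm_ge_zero order_trans by blast+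
  have "norm (\<Sum>p\<leftarrow>splits bs. iter_partial (fst p) f x * iter_partial (snd p) g x)
      \<le> real (length (splits bs)) * (M * N)"
  proof (rule norm_sum_list_le)
    fix p assume "p \<in> set (splits bs)"
    then have "fst p \<in> indices l" "snd p \<in> indices l"
      using splitsD[of "fst p" "snd p" bs] bs by (auto simp: indices_def)
    then show "norm (iter_partial (fst p) f x * iter_partial (snd p) g x) \<le> M * N"
      unfolding norm_mult using \<open>0 \<le> M\<close> by (intro mult_mono f g) auto
  qed
  also have "\<dots> \<le> 2 ^ l * (M * N)"
    using bs \<open>0 \<le> M\<close> \<open>0 \<le> N\<close> by (intro mult_right_mono) (auto simp: length_splits)
  finally show ?thesis
    by (simp add: iter_partial_mult_smooth[OF assms(1,2) bs(1)] case_prod_unfold)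
qed

lemma const_smooth: "(\<lambda>x. c) \<in> smooth"
proof -
  have "iter_partial bs (\<lambda>x::'a. c) = (\<lambda>x. if bs = [] then c else 0)" for bs
    by (induction bs) (auto simp: partial_deriv_def)
  then show ?thesis
    by (simp add: smooth_def)
qed

lemma iter_partial_fst_slice:
  fixes K :: "'a::euclidean_space \<times> 'b::euclidean_space \<Rightarrow> complex"
  assumes "K \<in> smooth" "set bs \<subseteq> Basis"
  shows "iter_partial bs (\<lambda>x. K (x, y)) = (\<lambda>x. iter_partial (map (\<lambda>b. (b, 0)) bs) K (x, y))"
  using assms(2)
proof (induction bs)
  case (Cons b bs)
  let ?D = "iter_partial (map (\<lambda>b. (b, 0)) bs) K"
  have "((\<lambda>x. ?D (x, y)) has_derivative (\<lambda>h. frechet_derivative ?D (at (x, y)) (h, 0))) (at x)" for x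
  proof (rule has_derivative_compose[where f = "\<lambda>x. (x, y)" and g = ?D])
    show "((\<lambda>x. (x, y)) has_derivative (\<lambda>h. (h, 0))) (at x)"
      by (auto intro!: derivative_eq_intros)
    show "(?D has_derivative frechet_derivative ?D (at (x, y))) (at (x, y))"
      unfolding frechet_derivative_works[symmetric]
      using Cons.prems assms(1) by (intro smooth_differentiable) (auto simp: Basis_prod_def)
  qed
  from partial_deriv_eq[OF this] show ?case
    using Cons by (auto simp: partial_deriv_def)
qed simp

lemma iter_partial_snd_slice:
  fixes K :: "'a::euclidean_space \<times> 'b::euclidean_space \<Rightarrow> complex"
  assumes "K \<in> smooth" "set bs \<subseteq> Basis"
  shows "iter_partial bs (\<lambda>y. K (x, y)) = (\<lambda>y. iter_partial (map (\<lambda>b. (0, b)) bs) K (x, y))"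
  using assms(2)
proof (induction bs)
  case (Cons b bs)
  let ?D = "iter_partial (map (\<lambda>b. (0, b)) bs) K"
  have "((\<lambda>y. ?D (x, y)) has_derivative (\<lambda>h. frechet_derivative ?D (at (x, y)) (0, h))) (at y)" for y
  proof (rule has_derivative_compose[where f = "\<lambda>y. (x, y)" and g = ?D])
    show "((\<lambda>y. (x, y)) has_derivative (\<lambda>h. (0, h))) (at y)"
      by (auto intro!: derivative_eq_intros)
    show "(?D has_derivative frechet_derivative ?D (at (x, y))) (at (x, y))"
      unfolding frechet_derivative_works[symmetric]
      using Cons.prems assms(1) by (intro smooth_differentiable) (auto simp: Basis_prod_def)
  qed
  from partial_deriv_eq[OF this] show ?case
    using Cons by (auto simp: partial_deriv_def)
qed simp

lemma fst_directions_Basis: "set bs \<subseteq> Basis \<Longrightarrow> set (map (\<lambda>b. (b, 0)) bs) \<subseteq> Basis"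
  by (auto simp: Basis_prod_def)

lemma snd_directions_Basis: "set bs \<subseteq> Basis \<Longrightarrow> set (map (\<lambda>b. (0, b)) bs) \<subseteq> Basis"
  by (auto simp: Basis_prod_def)

lemma smooth_fst_slice:
  fixes K :: "'a::euclidean_space \<times> 'b::euclidean_space \<Rightarrow> complex"
  assumes "K \<in> smooth"
  shows "(\<lambda>x. K (x, y)) \<in> smooth"
  unfolding smooth_def
proof (intro CollectI allI impI)
  fix bs :: "'a list" and x
  assume bs: "set bs \<subseteq> Basis"
  have "iter_partial (map (\<lambda>b. (b, 0)) bs) K differentiable at (x, y)"
    using assms fst_directions_Basis[OF bs] by (rule smooth_differentiable)
  moreover have "(\<lambda>x. (x, y)) differentiable at x"
    unfolding differentiable_def by (auto intro!: derivative_eq_intros)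
  ultimately show "iter_partial bs (\<lambda>x. K (x, y)) differentiable at x"
    unfolding iter_partial_fst_slice[OF assms bs]
    using differentiable_chain_at[of "\<lambda>x. (x, y)" x] by (simp add: o_def)
qed

lemma smooth_snd_slice:
  fixes K :: "'a::euclidean_space \<times> 'b::euclidean_space \<Rightarrow> complex"
  assumes "K \<in> smooth"
  shows "(\<lambda>y. K (x, y)) \<in> smooth"
  unfolding smooth_def
proof (intro CollectI allI impI)
  fix bs :: "'b list" and y
  assume bs: "set bs \<subseteq> Basis"
  have "iter_partial (map (\<lambda>b. (0, b)) bs) K differentiable at (x, y)"
    using assms snd_directions_Basis[OF bs] by (rule smooth_differentiable)
  moreover have "(\<lambda>y. (x, y)) differentiable at y"
    unfolding differentiable_def by (auto intro!: derivative_eq_intros)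
  ultimately show "iter_partial bs (\<lambda>y. K (x, y)) differentiable at y"
    unfolding iter_partial_snd_slice[OF assms bs]
    using differentiable_chain_at[of "\<lambda>y. (x, y)" y] by (simp add: o_def)
qed

text \<open>
  Every coordinate direction of a product space is \<open>(b, 0)\<close> or \<open>(0, b)\<close>. A mixed derivative of a
  tensor product splits accordingly into a derivative of each factor.
\<close>

definition fst_dirs :: "('a::euclidean_space \<times> 'b::euclidean_space) list \<Rightarrow> 'a list" where
  "fst_dirs bs = map fst (filter (\<lambda>b. snd b = 0) bs)"

definition snd_dirs :: "('a::euclidean_space \<times> 'b::euclidean_space) list \<Rightarrow> 'b list" where
  "snd_dirs bs = map snd (filter (\<lambda>b. snd b \<noteq> 0) bs)"

lemma dirs_Basis:
  "set bs \<subseteq> Basis \<Longrightarrow> set (fst_dirs bs) \<subseteq> Basis"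
  "set bs \<subseteq> Basis \<Longrightarrow> set (snd_dirs bs) \<subseteq> Basis"
  by (auto simp: fst_dirs_def snd_dirs_def Basis_prod_def)

lemma length_dirs: "length (fst_dirs bs) \<le> length bs" "length (snd_dirs bs) \<le> length bs"
  by (simp_all add: fst_dirs_def snd_dirs_def)

lemma tensor_has_derivative:
  fixes f :: "'a::euclidean_space \<Rightarrow> complex" and g :: "'b::euclidean_space \<Rightarrow> complex"
  assumes "f differentiable (at (fst p))" "g differentiable (at (snd p))"
  shows "((\<lambda>p. f (fst p) * g (snd p)) has_derivative
    (\<lambda>h. f (fst p) * frechet_derivative g (at (snd p)) (snd h)
       + frechet_derivative f (at (fst p)) (fst h) * g (snd p))) (at p)"
proof (rule has_derivative_mult)
  show "((\<lambda>p. f (fst p)) has_derivative (\<lambda>h. frechet_derivative f (at (fst p)) (fst h))) (at p)"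
    using assms(1) unfolding frechet_derivative_works
    by (rule has_derivative_compose[OF has_derivative_fst[OF has_derivative_ident]])
  show "((\<lambda>p. g (snd p)) has_derivative (\<lambda>h. frechet_derivative g (at (snd p)) (snd h))) (at p)"
    using assms(2) unfolding frechet_derivative_works
    by (rule has_derivative_compose[OF has_derivative_snd[OF has_derivative_ident]])
qed

lemma iter_partial_tensor:
  fixes f :: "'a::euclidean_space \<Rightarrow> complex" and g :: "'b::euclidean_space \<Rightarrow> complex"
  assumes "f \<in> smooth" "g \<in> smooth" "set bs \<subseteq> Basis"
  shows "iter_partial bs (\<lambda>p. f (fst p) * g (snd p))
    = (\<lambda>p. iter_partial (fst_dirs bs) f (fst p) * iter_partial (snd_dirs bs) g (snd p))"
  using assms(3)
proof (induction bs)
  case (Cons b bs)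
  let ?f = "iter_partial (fst_dirs bs) f" and ?g = "iter_partial (snd_dirs bs) g"
  have diff: "?f differentiable (at x)" "?g differentiable (at y)" for x y
    using Cons.prems assms dirs_Basis[of bs] by (auto intro!: smooth_differentiable)
  then have zero: "frechet_derivative ?f (at x) 0 = 0" "frechet_derivative ?g (at y) 0 = 0" for x y
    by (simp_all add: linear_0 linear_frechet_derivative)
  have pd: "partial_deriv b (iter_partial bs (\<lambda>p. f (fst p) * g (snd p))) p
      = ?f (fst p) * frechet_derivative ?g (at (snd p)) (snd b)
       + frechet_derivative ?f (at (fst p)) (fst b) * ?g (snd p)" for p
    using Cons diff by (simp add: partial_deriv_eq[OF tensor_has_derivative])
  have "b \<in> Basis"
    using Cons.prems by simp
  then consider "snd b = 0" | "fst b = 0" "snd b \<noteq> 0"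
    by (cases "snd b = 0") (auto simp: Basis_prod_def)
  then show ?case
  proof cases
    case 1
    then have dirs: "fst_dirs (b # bs) = fst b # fst_dirs bs" "snd_dirs (b # bs) = snd_dirs bs"
      by (simp_all add: fst_dirs_def snd_dirs_def)
    have "iter_partial (b # bs) (\<lambda>p. f (fst p) * g (snd p)) p
        = iter_partial (fst_dirs (b # bs)) f (fst p) * iter_partial (snd_dirs (b # bs)) g (snd p)" for p
      unfolding iter_partial.simps(2) pd dirs by (simp add: 1 zero partial_deriv_def)
    then show ?thesis by (rule ext)
  next
    case 2
    then have dirs: "fst_dirs (b # bs) = fst_dirs bs" "snd_dirs (b # bs) = snd b # snd_dirs bs"
      by (simp_all add: fst_dirs_def snd_dirs_def)
    have "iter_partial (b # bs) (\<lambda>p. f (fst p) * g (snd p)) p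
        = iter_partial (fst_dirs (b # bs)) f (fst p) * iter_partial (snd_dirs (b # bs)) g (snd p)" for p
      unfolding iter_partial.simps(2) pd dirs by (simp add: 2 zero partial_deriv_def)
    then show ?thesis by (rule ext)
  qed
qed (simp add: fst_dirs_def snd_dirs_def)

lemma smooth_tensor:
  fixes f :: "'a::euclidean_space \<Rightarrow> complex" and g :: "'b::euclidean_space \<Rightarrow> complex"
  assumes "f \<in> smooth" "g \<in> smooth"
  shows "(\<lambda>p. f (fst p) * g (snd p)) \<in> smooth"
  unfolding smooth_def
proof (intro CollectI allI impI)
  fix bs :: "('a \<times> 'b) list" and p
  assume bs: "set bs \<subseteq> Basis"
  have "iter_partial (fst_dirs bs) f differentiable (at (fst p))"
       "iter_partial (snd_dirs bs) g differentiable (at (snd p))"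
    using assms dirs_Basis[OF bs] by (auto intro: smooth_differentiable)
  from tensor_has_derivative[OF this]
  show "iter_partial bs (\<lambda>p. f (fst p) * g (snd p)) differentiable at p"
    unfolding iter_partial_tensor[OF assms bs] differentiable_def by blast
qed


section \<open>Gaussians\<close>

definition gauss :: "real \<Rightarrow> 'a::euclidean_space \<Rightarrow> complex" where
  "gauss \<delta> x = of_real (exp (- \<delta> * (norm x)\<^sup>2))"

lemma norm_gauss: "norm (gauss \<delta> x) = exp (- \<delta> * (norm x)\<^sup>2)"
  by (simp add: gauss_def)

lemma gauss_has_derivative:
  "(gauss \<delta> has_derivative (\<lambda>h. of_real (- 2 * \<delta> * (x \<bullet> h)) * gauss \<delta> x)) (at x)"
proof -
  have "((\<lambda>x. exp (- \<delta> * (x \<bullet> x))) has_derivative (\<lambda>h. - 2 * \<delta> * (x \<bullet> h) * exp (- \<delta> * (x \<bullet> x)))) (at x)"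
    by (auto intro!: derivative_eq_intros simp: inner_commute)
  from has_derivative_of_real[OF this] show ?thesis
    by (simp add: gauss_def[abs_def] power2_norm_eq_inner)
qed

lemma inner_smooth: "(\<lambda>x. of_real (c * (x \<bullet> b)) :: complex) \<in> smooth"
  and norm_iter_partial_inner_le:
    "set bs \<subseteq> Basis \<Longrightarrow> norm b \<le> 1 \<Longrightarrow>
      norm (iter_partial bs (\<lambda>x. of_real (c * (x \<bullet> b)) :: complex) x) \<le> \<bar>c\<bar> * (1 + norm x)"
proof -
  let ?f = "\<lambda>x. of_real (c * (x \<bullet> b)) :: complex"
  have d: "(?f has_derivative (\<lambda>h. of_real (c * (h \<bullet> b)))) (at x)" for x
    by (auto intro!: derivative_eq_intros)
  have eq: "iter_partial bs ?f =
      (if bs = [] then ?f else if length bs = 1 then (\<lambda>x. of_real (c * (hd bs \<bullet> b))) else (\<lambda>x. 0))" for bs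
  proof (induction bs)
    case (Cons a bs)
    have "partial_deriv a ?f = (\<lambda>x. of_real (c * (a \<bullet> b)))"
      using partial_deriv_eq[OF d] by blast
    moreover have "partial_deriv a (\<lambda>x. k) = (\<lambda>x. 0)" for k :: complex
      by (simp add: partial_deriv_def)
    ultimately show ?case
      using Cons by auto
  qed simp
  show "?f \<in> smooth"
    unfolding smooth_def mem_Collect_eq eq using d
    by (auto simp: differentiable_def intro: has_derivative_const)
  assume bs: "set bs \<subseteq> Basis" and b: "norm b \<le> 1"
  have "\<bar>v \<bullet> b\<bar> \<le> norm v" for v
    by (rule order_trans[OF Cauchy_Schwarz_ineq2 mult_left_le[OF b norm_ge_zero]])
  then have ip: "norm (of_real (c * (v \<bullet> b)) :: complex) \<le> \<bar>c\<bar> * norm v" for v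
    by (simp add: norm_mult abs_mult mult_left_mono)
  have le: "\<bar>c\<bar> * norm x \<le> \<bar>c\<bar> * (1 + norm x)" "\<bar>c\<bar> * 1 \<le> \<bar>c\<bar> * (1 + norm x)" 
    by (auto simp: distrib_left)
  consider "bs = []" | a where "bs = [a]" "norm a = 1" | "length bs > 1"
    using bs by (cases bs; cases "tl bs") auto
  then show "norm (iter_partial bs ?f x) \<le> \<bar>c\<bar> * (1 + norm x)"
  proof cases
    case 1
    then show ?thesis using order_trans[OF ip[of x] le(1)] by simp
  next
    case 2
    then have "norm (of_real (c * (a \<bullet> b)) :: complex) \<le> \<bar>c\<bar> * 1"
      using ip[of a] by simp
    then show ?thesis using 2 order_trans[OF _ le(2)] unfolding eq by simp
  next
    case 3
    then have "bs \<noteq> []" "length bs \<noteq> 1" by auto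
    then show ?thesis unfolding eq by simp
  qed
qed

text \<open>
  Peeling off the innermost derivative leaves a Gaussian times a linear function, which lets the
  Leibniz rule reduce each order to the lower ones.
\<close>

lemma iter_partial_gauss_snoc:
  "iter_partial (bs @ [b]) (gauss \<delta>) = iter_partial bs (\<lambda>x. of_real (- 2 * \<delta> * (x \<bullet> b)) * gauss \<delta> x)"
proof -
  have "partial_deriv b (gauss \<delta>) = (\<lambda>x. of_real (- 2 * \<delta> * (x \<bullet> b)) * gauss \<delta> x)"
    using partial_deriv_eq[OF gauss_has_derivative] by blast
  then show ?thesis
    by (simp add: iter_partial_append)
qed

lemma gauss_smooth: "gauss \<delta> \<in> smooth"
proof -
  have "iter_partial bs (gauss \<delta>) differentiable (at x)" if "set bs \<subseteq> Basis" for bs :: "'a list" and x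
    using that
  proof (induction "length bs" arbitrary: bs x rule: less_induct)
    case less
    show ?case
    proof (cases bs rule: rev_cases)
      case Nil
      then show ?thesis
        using gauss_has_derivative by (auto simp: differentiable_def)
    next
      case (snoc as b)
      let ?l = "\<lambda>x. of_real (- 2 * \<delta> * (x \<bullet> b)) :: complex"
      have as: "set as \<subseteq> Basis" and l: "?l \<in> smooth"
        using snoc less.prems inner_smooth[of "- 2 * \<delta>" b] by auto
      have IH: "iter_partial cs (gauss \<delta>) differentiable (at x)"
        if "set cs \<subseteq> Basis" "length cs \<le> length as" for cs :: "'a list" and x
        using that snoc by (intro less.hyps) auto
      have eq: "iter_partial bs (gauss \<delta>)
          = (\<lambda>x. \<Sum>p\<leftarrow>splits as. iter_partial (fst p) ?l x * iter_partial (snd p) (gauss \<delta>) x)"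
        unfolding snoc iter_partial_gauss_snoc
        by (subst iter_partial_mult)
           (use as l IH in \<open>auto simp: case_prod_unfold intro: smooth_differentiable\<close>)
      have "(\<lambda>x. iter_partial (fst p) ?l x * iter_partial (snd p) (gauss \<delta>) x) differentiable at x"
        if "p \<in> set (splits as)" for p
        using splitsD[of "fst p" "snd p" as] that as l
        by (intro differentiable_mult smooth_differentiable IH) auto
      then show ?thesis
        unfolding eq by (intro differentiable_sum_list)
    qed
  qed
  then show ?thesis
    by (simp add: smooth_def)
qed

text \<open>
  Each derivative brings down one factor \<open>- 2 * \<delta> * (x \<bullet> b)\<close>, hence at most one power of \<open>1 + norm x\<close>
  and, uniformly in \<open>\<delta>\<close>, at least one factor \<open>\<delta>\<close> as soon as any derivative is taken. The factor \<open>\<delta>\<close> later makes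
  \<open>1 - gauss \<delta>\<close> negligible, and the surviving exponential makes damped functions bounded.
\<close>

lemma iter_partial_gauss_bound:
  "\<exists>C\<ge>0. \<forall>\<delta>\<in>{0..1}. \<forall>bs\<in>indices l. \<forall>x::'a::euclidean_space.
     norm (iter_partial bs (gauss \<delta>) x)
       \<le> C * (if bs = [] then 1 else \<delta>) * (1 + norm x) ^ l * exp (- \<delta> * (norm x)\<^sup>2)"
proof (induction l)
  case 0
  show ?case
    by (intro exI[of _ 1]) (auto simp: norm_gauss indices_def)
next
  case (Suc l)
  then obtain C where C: "0 \<le> C" and IH: "\<And>\<delta> bs x. \<delta> \<in> {0..1} \<Longrightarrow> bs \<in> indices l \<Longrightarrow>
     norm (iter_partial bs (gauss \<delta>) (x::'a))
       \<le> C * (if bs = [] then 1 else \<delta>) * (1 + norm x) ^ l * exp (- \<delta> * (norm x)\<^sup>2)"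
    by metis
  have "norm (iter_partial bs (gauss \<delta>) x)
      \<le> (1 + 2 ^ l * 2 * C) * (if bs = [] then 1 else \<delta>) * (1 + norm x) ^ Suc l * exp (- \<delta> * (norm x)\<^sup>2)"
    if \<delta>: "\<delta> \<in> {0..1}" and bs: "bs \<in> indices (Suc l)" for \<delta> bs and x :: 'a
  proof (cases bs rule: rev_cases)
    case Nil
    have "exp (- \<delta> * (norm x)\<^sup>2) * (1 * 1)
        \<le> exp (- \<delta> * (norm x)\<^sup>2) * ((1 + 2 ^ l * 2 * C) * (1 + norm x) ^ Suc l)"
      using C by (intro mult_left_mono mult_mono one_le_power) auto
    then show ?thesis
      using Nil by (simp add: norm_gauss mult_ac)
  next
    case (snoc as b)
    let ?l = "\<lambda>x. of_real (- 2 * \<delta> * (x \<bullet> b)) :: complex"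
    let ?E = "(1 + norm x) ^ l * exp (- \<delta> * (norm x)\<^sup>2)"
    have as: "as \<in> indices l" and b: "b \<in> Basis"
      using snoc bs by (auto simp: indices_def)
    have "norm (iter_partial as (\<lambda>x. ?l x * gauss \<delta> x) x)
        \<le> 2 ^ l * ((\<bar>-2 * \<delta>\<bar> * (1 + norm x)) * (C * ?E))"
    proof (rule norm_iter_partial_mult_le[OF inner_smooth gauss_smooth as])
      fix cs :: "'a list"
      assume cs: "cs \<in> indices l"
      show "norm (iter_partial cs ?l x) \<le> \<bar>-2 * \<delta>\<bar> * (1 + norm x)"
        using cs b by (intro norm_iter_partial_inner_le) (auto simp: indices_def)
      have "C * (if cs = [] then 1 else \<delta>) * ?E \<le> C * 1 * ?E"
        using C \<delta> by (intro mult_right_mono mult_left_mono) auto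
      then show "norm (iter_partial cs (gauss \<delta>) x) \<le> C * ?E"
        using IH[OF \<delta> cs, of x] by (simp add: mult.assoc)
    qed
    also have "\<dots> = (2 ^ l * 2 * C) * (\<delta> * (1 + norm x) * ?E)"
      using \<delta> by (simp add: mult_ac)
    also have "\<dots> \<le> (1 + 2 ^ l * 2 * C) * (\<delta> * (1 + norm x) * ?E)"
      using \<delta> by (intro mult_right_mono) auto
    finally show ?thesis
      using snoc by (simp add: iter_partial_gauss_snoc mult_ac)
  qed
  then show ?case
    using C by (intro exI[of _ "1 + 2 ^ l * 2 * C"]) auto
qed

lemma power_le_exp: "0 \<le> (t::real) \<Longrightarrow> t ^ k \<le> fact k * exp t"
proof -
  assume t: "0 \<le> t"
  have "t ^ k / fact k = (\<Sum>i\<in>{k}. t ^ i /\<^sub>R fact i)"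
    by (simp add: field_simps)
  also have "\<dots> \<le> exp t"
    unfolding exp_def using t summable_exp_generic[of t] by (intro sum_le_suminf) auto
  finally show ?thesis
    by (simp add: field_simps)
qed

text \<open>
  Trading exponential for polynomial decay costs a power of \<open>1 / \<eta>\<close>: apply \<open>power_le_exp\<close> at
  \<open>1 + \<eta> * t\<^sup>2\<close>, which is at least \<open>\<eta> * (1 + t\<^sup>2)\<close>.
\<close>

lemma exp_minus_le:
  fixes \<eta> t :: real
  assumes "0 < \<eta>" "\<eta> \<le> 1" "0 \<le> t"
  shows "exp (- \<eta> * t\<^sup>2) \<le> exp 1 * fact k * (1 / \<eta>) ^ k / (1 + t\<^sup>2) ^ k"
proof -
  have "(\<eta> * (1 + t\<^sup>2)) ^ k \<le> (1 + \<eta> * t\<^sup>2) ^ k"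
    using assms by (intro power_mono) (auto simp: algebra_simps)
  also have "\<dots> \<le> fact k * exp (1 + \<eta> * t\<^sup>2)"
    using assms by (intro power_le_exp) auto
  finally have le: "\<eta> ^ k * (1 + t\<^sup>2) ^ k \<le> fact k * exp 1 * exp (\<eta> * t\<^sup>2)"
    by (simp add: power_mult_distrib exp_add mult.assoc)
  have "0 < (1 + t\<^sup>2) ^ k"
    by (simp add: add_pos_nonneg)
  with le assms(1) show ?thesis
    by (simp add: exp_minus field_simps power_divide)
qed

lemma power_mult_gauss_le:
  fixes \<eta> t :: real
  assumes "0 < \<eta>" "\<eta> \<le> 1" "0 \<le> t"
  shows "(1 + t) ^ q * exp (- \<eta> * t\<^sup>2)
    \<le> (2 ^ q * exp 1 * fact (q + k)) * (1 / \<eta>) ^ (q + k) * (1 / (1 + t\<^sup>2)) ^ k"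
proof -
  have pos: "0 < 1 + t\<^sup>2"
    by (simp add: add_pos_nonneg)
  have "1 + t \<le> 2 * (1 + t\<^sup>2)"
    using zero_le_power2[of "t - 1/4"] by (simp add: power2_eq_square algebra_simps)
  then have "(1 + t) ^ q \<le> (2 * (1 + t\<^sup>2)) ^ q"
    using assms by (intro power_mono) auto
  then have "(1 + t) ^ q * exp (- \<eta> * t\<^sup>2)
      \<le> (2 * (1 + t\<^sup>2)) ^ q * (exp 1 * fact (q + k) * (1 / \<eta>) ^ (q + k) / (1 + t\<^sup>2) ^ (q + k))"
    using pos assms by (intro mult_mono exp_minus_le) auto
  also have "\<dots> = (2 ^ q * exp 1 * fact (q + k)) * (1 / \<eta>) ^ (q + k) * (1 / (1 + t\<^sup>2)) ^ k"
    unfolding power_mult_distrib power_add power_divide using pos by simp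
  finally show ?thesis .
qed

text \<open>
  Since \<open>\<bar>y \<bullet> b\<bar> \<le> norm y\<close> for every basis vector, the function is dominated by the product over the coordinates of
  \<open>1 / (1 + (y \<bullet> b)\<^sup>2)\<close>, whose integral factors into one-dimensional arctangent integrals.
\<close>

lemma integrable_inverse_1_plus_norm_square:
  "integrable lborel (\<lambda>y::'a::euclidean_space. (1 / (1 + (norm y)\<^sup>2)) ^ DIM('a))"
proof -
  let ?h = "\<lambda>y::'a. \<Prod>b\<in>Basis. 1 / (1 + (y \<bullet> b)\<^sup>2)"
  have one: "(\<integral>\<^sup>+x. ennreal (1 / (1 + (x::real)\<^sup>2)) \<partial>lborel) < \<infinity>"
  proof -
    have "integrable lborel (\<lambda>x::real. 1 / (1 + x\<^sup>2))"
      using integrable_inverse_1_plus_square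
      by (simp add: set_integrable_def einterval_eq_UNIV inverse_eq_divide)
    moreover have "(\<integral>\<^sup>+x. ennreal (norm (1 / (1 + (x::real)\<^sup>2))) \<partial>lborel) = (\<integral>\<^sup>+x. ennreal (1 / (1 + x\<^sup>2)) \<partial>lborel)"
      by (intro nn_integral_cong) (simp add: add_nonneg_nonneg)
    ultimately show ?thesis
      by (simp add: integrable_iff_bounded)
  qed
  have "(\<integral>\<^sup>+y. ennreal (?h y) \<partial>lborel) = (\<integral>\<^sup>+y. (\<Prod>b\<in>Basis. ennreal (1 / (1 + ((y::'a) \<bullet> b)\<^sup>2))) \<partial>lborel)"
    by (intro nn_integral_cong prod_ennreal[symmetric]) (simp add: add_nonneg_nonneg)
  also have "\<dots> = (\<Prod>b\<in>(Basis :: 'a set). (\<integral>\<^sup>+x. ennreal (1 / (1 + x\<^sup>2)) \<partial>lborel))"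
    by (rule nn_integral_lborel_prod) auto
  also have "\<dots> < \<infinity>"
    using one by (simp add: power_less_top_ennreal)
  finally have "integrable lborel ?h"
    by (intro integrableI_nonneg) (auto intro!: prod_nonneg AE_I2 simp: add_nonneg_nonneg)
  then show ?thesis
  proof (rule Bochner_Integration.integrable_bound)
    show "AE y::'a in lborel. norm ((1 / (1 + (norm y)\<^sup>2)) ^ DIM('a)) \<le> norm (?h y)"
    proof (rule AE_I2)
      fix y :: 'a
      have "(1 / (1 + (norm y)\<^sup>2)) ^ DIM('a) = (\<Prod>b\<in>(Basis::'a set). 1 / (1 + (norm y)\<^sup>2))"
        by simp
      also have "\<dots> \<le> ?h y"
      proof (intro prod_mono conjI)
        fix b :: 'a assume b: "b \<in> Basis"
        have "(y \<bullet> b)\<^sup>2 \<le> (norm y)\<^sup>2"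
          using Basis_le_norm[OF b, of y] by (metis abs_ge_zero power2_abs power_mono)
        then show "1 / (1 + (norm y)\<^sup>2) \<le> 1 / (1 + (y \<bullet> b)\<^sup>2)"
          by (intro divide_left_mono) (auto intro!: mult_pos_pos add_pos_nonneg)
      qed (simp add: add_nonneg_nonneg)
      finally show "norm ((1 / (1 + (norm y)\<^sup>2)) ^ DIM('a)) \<le> norm (?h y)"
        by (simp add: abs_of_nonneg add_nonneg_nonneg)
    qed
  qed simp
qed

text \<open>
  The Gaussian decay is converted into \<open>q + DIM('a)\<close> powers of \<open>1 / (1 + (norm y)\<^sup>2)\<close>: the first \<open>q\<close> absorb
  the polynomial and the others are integrable.
\<close>

lemma gauss_moment_bound:
  "\<exists>C\<ge>0. \<exists>N::nat. \<forall>\<eta>\<in>{0<..1}.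
     integrable lborel (\<lambda>y::'a::euclidean_space. (1 + norm y) ^ q * exp (- \<eta> * (norm y)\<^sup>2)) \<and>
     (\<integral>y. (1 + norm (y::'a)) ^ q * exp (- \<eta> * (norm y)\<^sup>2) \<partial>lborel) \<le> C * (1 / \<eta>) ^ N"
proof -
  let ?k = "DIM('a)" and ?h = "\<lambda>y::'a. (1 / (1 + (norm y)\<^sup>2)) ^ DIM('a)"
  let ?c = "2 ^ q * exp 1 * fact (q + ?k) :: real"
  have int: "integrable lborel ?h"
    by (rule integrable_inverse_1_plus_norm_square)
  have "integrable lborel (\<lambda>y::'a. (1 + norm y) ^ q * exp (- \<eta> * (norm y)\<^sup>2)) \<and>
     (\<integral>y. (1 + norm (y::'a)) ^ q * exp (- \<eta> * (norm y)\<^sup>2) \<partial>lborel) \<le> (?c * integral\<^sup>L lborel ?h) * (1 / \<eta>) ^ (q + ?k)"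
    if \<eta>: "\<eta> \<in> {0<..1}" for \<eta>
  proof -
    have le: "(1 + norm y) ^ q * exp (- \<eta> * (norm y)\<^sup>2) \<le> (?c * (1 / \<eta>) ^ (q + ?k)) * ?h y" for y :: 'a
      using \<eta> by (intro power_mult_gauss_le) auto
    have int': "integrable lborel (\<lambda>y::'a. (1 + norm y) ^ q * exp (- \<eta> * (norm y)\<^sup>2))"
    proof (rule Bochner_Integration.integrable_bound)
      show "integrable lborel (\<lambda>y. (?c * (1 / \<eta>) ^ (q + ?k)) * ?h y)"
        by (intro integrable_mult_right int)
    qed (use order_trans[OF le abs_ge_self] in auto)
    have "(\<integral>y. (1 + norm (y::'a)) ^ q * exp (- \<eta> * (norm y)\<^sup>2) \<partial>lborel)
        \<le> (\<integral>y. (?c * (1 / \<eta>) ^ (q + ?k)) * ?h y \<partial>lborel)"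
      by (intro integral_mono int' integrable_mult_right int le)
    also have "\<dots> = (?c * integral\<^sup>L lborel ?h) * (1 / \<eta>) ^ (q + ?k)"
      by (simp add: mult_ac)
    finally show ?thesis
      using int' by blast
  qed
  moreover have "0 \<le> ?c * integral\<^sup>L lborel ?h"
    by (intro mult_nonneg_nonneg Bochner_Integration.integral_nonneg) (auto simp: add_nonneg_nonneg)
  ultimately show ?thesis
    by blast
qed

lemma gauss_schwartz:
  assumes "0 < \<delta>" "\<delta> \<le> 1"
  shows "gauss \<delta> \<in> schwartz"
proof -
  have "mu (int q) l (gauss \<delta> :: 'a \<Rightarrow> complex) < \<infinity>" for q l
  proof -
    obtain C where C: "0 \<le> C" and le: "\<And>bs x. bs \<in> indices l \<Longrightarrow>
     norm (iter_partial bs (gauss \<delta>) (x::'a))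
       \<le> C * (if bs = [] then 1 else \<delta>) * (1 + norm x) ^ l * exp (- \<delta> * (norm x)\<^sup>2)"
      using iter_partial_gauss_bound[of l] assms by force
    let ?c = "(2 ^ (q + l) * exp 1 * fact (q + l + 0)) * (1 / \<delta>) ^ (q + l + 0)"
    have "mu (int q) l (gauss \<delta> :: 'a \<Rightarrow> complex) \<le> ennreal (C * ?c)"
      unfolding mu_le_iff
    proof (intro allI ballI ennreal_leI)
      fix x :: 'a and bs :: "'a list"
      assume bs: "bs \<in> indices l"
      have "C * (if bs = [] then 1 else \<delta>) * (1 + norm x) ^ l * exp (- \<delta> * (norm x)\<^sup>2)
          \<le> C * 1 * (1 + norm x) ^ l * exp (- \<delta> * (norm x)\<^sup>2)"
        using C assms by (intro mult_right_mono mult_left_mono) auto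
      then have "(1 + norm x) ^ q * norm (iter_partial bs (gauss \<delta>) x)
          \<le> (1 + norm x) ^ q * (C * 1 * (1 + norm x) ^ l * exp (- \<delta> * (norm x)\<^sup>2))"
        using order_trans[OF le[OF bs, of x]] by (intro mult_left_mono) auto
      also have "\<dots> = C * ((1 + norm x) ^ (q + l) * exp (- \<delta> * (norm x)\<^sup>2))"
        by (simp add: power_add mult_ac)
      also have "\<dots> \<le> C * ?c"
        using power_mult_gauss_le[OF assms norm_ge_zero, of x "q + l" 0] C by (intro mult_left_mono) auto
      finally show "(1 + norm x) powi int q * norm (iter_partial bs (gauss \<delta>) x) \<le> C * ?c"
        by simp
    qed
    then show ?thesis
      by (rule le_less_trans) simp
  qed
  then show ?thesis
    by (simp add: schwartz_def gauss_smooth)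
qed

section \<open>Differentiation under the integral sign\<close>

text \<open>
  Dominated convergence for the difference quotients: by the mean value inequality they are bounded
  near \<open>p0\<close> by a multiple of the majorant of the partial derivatives.
\<close>

lemma has_derivative_integral:
  fixes g :: "'p::euclidean_space \<Rightarrow> 'z \<Rightarrow> complex" and D :: "'p \<Rightarrow> 'p \<Rightarrow> 'z \<Rightarrow> complex"
  assumes deriv: "\<And>p z. ((\<lambda>p. g p z) has_derivative (\<lambda>h. \<Sum>b\<in>Basis. (h \<bullet> b) *\<^sub>R D b p z)) (at p)"
    and g: "\<And>p. integrable M (g p)"
    and D: "\<And>b p. b \<in> Basis \<Longrightarrow> integrable M (D b p)"
    and dom: "\<And>b p z. b \<in> Basis \<Longrightarrow> p \<in> ball p0 1 \<Longrightarrow> norm (D b p z) \<le> W z"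
    and W: "integrable M W"
  shows "((\<lambda>p. \<integral>z. g p z \<partial>M) has_derivative (\<lambda>h. \<Sum>b\<in>Basis. (h \<bullet> b) *\<^sub>R (\<integral>z. D b p0 z \<partial>M))) (at p0)"
proof -
  let ?L = "\<lambda>p h z. \<Sum>b\<in>Basis. (h \<bullet> b) *\<^sub>R D b p z"
  let ?J = "\<lambda>h. \<Sum>b\<in>Basis. (h \<bullet> b) *\<^sub>R (\<integral>z. D b p0 z \<partial>M)"
  let ?B = "\<lambda>z. real DIM('p) * W z"
  have p0: "p0 \<in> ball p0 1" by simp
  have L_bound: "norm (?L p h z) \<le> ?B z * norm h" if p: "p \<in> ball p0 1" for p h z
  proof -
    have "norm (?L p h z) \<le> (\<Sum>b\<in>(Basis::'p set). norm h * W z)"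
    proof (rule sum_norm_le)
      fix b :: 'p assume "b \<in> Basis"
      then show "norm ((h \<bullet> b) *\<^sub>R D b p z) \<le> norm h * W z"
        using Basis_le_norm[of b h] dom[OF _ p, of b z] by (auto intro!: mult_mono)
    qed
    then show ?thesis by (simp add: mult_ac)
  qed
  have L_int: "integrable M (?L p h)" "(\<integral>z. ?L p h z \<partial>M) = (\<Sum>b\<in>Basis. (h \<bullet> b) *\<^sub>R (\<integral>z. D b p z \<partial>M))" for p h
    using D by (auto intro!: Bochner_Integration.integrable_sum)
  have g_lip: "norm (g p z - g p0 z) \<le> ?B z * norm (p - p0)" if p: "p \<in> ball p0 1" for p z
  proof (rule differentiable_bound[OF convex_ball _ _ p p0])
    fix p assume p: "p \<in> ball p0 1"
    show "((\<lambda>p. g p z) has_derivative (\<lambda>h. ?L p h z)) (at p within ball p0 1)"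
      using deriv by (rule has_derivative_at_withinI)
    show "onorm (\<lambda>h. ?L p h z) \<le> ?B z"
      using L_bound[OF p] by (rule onorm_le)
  qed
  show ?thesis
    unfolding has_derivative_iff_norm
  proof (intro conjI)
    show "bounded_linear ?J"
      by (intro bounded_linear_sum bounded_linear_scaleR_const bounded_linear_inner_left)
    \<comment> \<open>Staying within the ball makes the majorant valid along the whole sequence, not only eventually.\<close>
    have "((\<lambda>p. norm ((\<integral>z. g p z \<partial>M) - (\<integral>z. g p0 z \<partial>M) - ?J (p - p0)) / norm (p - p0)) \<longlongrightarrow> 0)
        (at p0 within ball p0 1)"
      unfolding tendsto_at_iff_sequentially
    proof (intro allI impI)
      fix X :: "nat \<Rightarrow> 'p"
      assume X: "\<forall>i. X i \<in> ball p0 1 - {p0}" and lim: "X \<longlonglongrightarrow> p0"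
      let ?r = "\<lambda>i z. (g (X i) z - g p0 z - ?L p0 (X i - p0) z) /\<^sub>R norm (X i - p0)"
      have r_meas: "?r i \<in> borel_measurable M" for i
        using g L_int(1) by (intro borel_measurable_scaleR borel_measurable_diff) auto
      have "(\<lambda>i. \<integral>z. ?r i z \<partial>M) \<longlonglongrightarrow> (\<integral>z. 0 \<partial>M)"
      proof (rule integral_dominated_convergence[where w = "\<lambda>z. 2 * ?B z"])
        show "integrable M (\<lambda>z. 2 * ?B z)"
          using W by simp
        show "AE z in M. (\<lambda>i. ?r i z) \<longlonglongrightarrow> 0"
        proof (rule AE_I2)
          fix z
          have "((\<lambda>p. (g p z - g p0 z - ?L p0 (p - p0) z) /\<^sub>R norm (p - p0)) \<longlongrightarrow> 0) (at p0)"
            using deriv[of z p0] by (simp add: has_derivative_at_within)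
          moreover have "filterlim X (at p0) sequentially"
            using X lim by (auto simp: filterlim_at)
          ultimately show "(\<lambda>i. ?r i z) \<longlonglongrightarrow> 0"
            by (rule filterlim_compose)
        qed
        show "AE z in M. norm (?r i z) \<le> 2 * ?B z" for i
        proof (rule AE_I2)
          fix z
          have Xi: "X i \<in> ball p0 1" "0 < norm (X i - p0)"
            using X by auto
          have "norm (g (X i) z - g p0 z - ?L p0 (X i - p0) z)
              \<le> ?B z * norm (X i - p0) + ?B z * norm (X i - p0)"
            using norm_triangle_ineq4 g_lip[OF Xi(1)] L_bound[OF p0] by (rule order_trans[OF _ add_mono])
          then show "norm (?r i z) \<le> 2 * ?B z"
            using Xi(2) unfolding norm_scaleR by (simp add: field_simps)
        qed
      qed (use r_meas in auto)
      moreover have "(\<integral>z. ?r i z \<partial>M)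
          = ((\<integral>z. g (X i) z \<partial>M) - (\<integral>z. g p0 z \<partial>M) - ?J (X i - p0)) /\<^sub>R norm (X i - p0)" for i
        using g L_int by (simp del: sum_distrib_left)
      ultimately have "(\<lambda>i. norm (((\<integral>z. g (X i) z \<partial>M) - (\<integral>z. g p0 z \<partial>M) - ?J (X i - p0)) /\<^sub>R norm (X i - p0))) \<longlonglongrightarrow> 0"
        by (simp only:) (intro tendsto_norm_zero, simp)
      then show "((\<lambda>p. norm ((\<integral>z. g p z \<partial>M) - (\<integral>z. g p0 z \<partial>M) - ?J (p - p0)) / norm (p - p0)) \<circ> X) \<longlonglongrightarrow> 0"
        by (simp add: o_def divide_inverse mult.commute)
    qed
    then show "((\<lambda>p. norm ((\<integral>z. g p z \<partial>M) - (\<integral>z. g p0 z \<partial>M) - ?J (p - p0)) / norm (p - p0)) \<longlongrightarrow> 0) (at p0)"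
      by (simp only: at_within_open[OF p0 open_ball])
  qed
qed

text \<open>
  For integrands whose derivatives of every order are dominated by an integrable function of the
  integration variable times a polynomial in the parameter, differentiation under the integral can be
  iterated. Polynomial growth in the parameter is harmless since differentiability is local.
\<close>

lemma
  fixes G :: "'z \<Rightarrow> 'p::euclidean_space \<Rightarrow> complex"
  assumes smooth: "\<And>z. G z \<in> smooth"
    and meas: "\<And>bs p. set bs \<subseteq> Basis \<Longrightarrow> (\<lambda>z. iter_partial bs (G z) p) \<in> borel_measurable M"
    and dom: "\<And>bs. set bs \<subseteq> Basis \<Longrightarrow> \<exists>W (q::nat). integrable M W \<and>
      (\<forall>p z. norm (iter_partial bs (G z) p) \<le> W z * (1 + norm p) ^ q)"
  shows integrable_iter_partial: "set bs \<subseteq> Basis \<Longrightarrow> integrable M (\<lambda>z. iter_partial bs (G z) p)"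
    and iter_partial_integral:
      "set bs \<subseteq> Basis \<Longrightarrow> iter_partial bs (\<lambda>p. \<integral>z. G z p \<partial>M) = (\<lambda>p. \<integral>z. iter_partial bs (G z) p \<partial>M)"
    and smooth_integral: "(\<lambda>p. \<integral>z. G z p \<partial>M) \<in> smooth"
proof -
  show int: "integrable M (\<lambda>z. iter_partial bs (G z) p)" if bs: "set bs \<subseteq> Basis" for bs p
  proof -
    obtain W and q :: nat where W: "integrable M W" "\<And>p z. norm (iter_partial bs (G z) p) \<le> W z * (1 + norm p) ^ q"
      using dom[OF bs] by blast
    have "integrable M (\<lambda>z. W z * (1 + norm p) ^ q)"
      using W(1) by simp
    then show ?thesis
      by (rule Bochner_Integration.integrable_bound)
         (use W(2) meas[OF bs] in \<open>auto intro!: AE_I2 intro: order_trans[OF W(2) abs_ge_self]\<close>)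
  qed
  have deriv: "((\<lambda>p. \<integral>z. iter_partial bs (G z) p \<partial>M) has_derivative
      (\<lambda>h. \<Sum>b\<in>Basis. (h \<bullet> b) *\<^sub>R (\<integral>z. iter_partial (b # bs) (G z) p0 \<partial>M))) (at p0)"
    if bs: "set bs \<subseteq> Basis" for bs p0
  proof -
    have "\<forall>b\<in>Basis. \<exists>W. integrable M W \<and> (\<forall>p\<in>ball p0 1. \<forall>z. norm (iter_partial (b # bs) (G z) p) \<le> W z)"
    proof
      fix b :: 'p assume "b \<in> Basis"
      then obtain W and q :: nat where W: "integrable M W"
          "\<And>p z. norm (iter_partial (b # bs) (G z) p) \<le> W z * (1 + norm p) ^ q"
        using dom[of "b # bs"] bs by (auto simp del: iter_partial.simps)
      have "norm (iter_partial (b # bs) (G z) p) \<le> W z * (2 + norm p0) ^ q" if p: "p \<in> ball p0 1" for p z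
      proof -
        have "0 \<le> W z"
          using order_trans[OF norm_ge_zero W(2)[of z 0]] by simp
        moreover have "norm p \<le> 1 + norm p0"
          using p norm_triangle_ineq2[of p p0] by (simp add: dist_norm norm_minus_commute)
        ultimately have "W z * (1 + norm p) ^ q \<le> W z * (2 + norm p0) ^ q"
          by (intro mult_left_mono power_mono) auto
        then show ?thesis
          using W(2) order_trans by blast
      qed
      then show "\<exists>W. integrable M W \<and> (\<forall>p\<in>ball p0 1. \<forall>z. norm (iter_partial (b # bs) (G z) p) \<le> W z)"
        using W(1) by (intro exI[of _ "\<lambda>z. W z * (2 + norm p0) ^ q"]) auto
    qed
    then obtain W where W: "\<And>b. b \<in> Basis \<Longrightarrow> integrable M (W b)"
        "\<And>b p z. b \<in> Basis \<Longrightarrow> p \<in> ball p0 1 \<Longrightarrow> norm (iter_partial (b # bs) (G z) p) \<le> W b z"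
      by metis
    have "0 \<le> W b z" if "b \<in> Basis" for b z
      using order_trans[OF norm_ge_zero W(2)[OF that, of p0 z]] by simp
    then have le: "W b z \<le> (\<Sum>b\<in>Basis. W b z)" if "b \<in> Basis" for b z
      using that by (intro member_le_sum) auto
    show ?thesis
    proof (rule has_derivative_integral[where W = "\<lambda>z. \<Sum>b\<in>Basis. W b z"])
      show "norm (iter_partial (b # bs) (G z) p) \<le> (\<Sum>b\<in>Basis. W b z)"
        if "b \<in> Basis" "p \<in> ball p0 1" for b p z
        using order_trans[OF W(2)[OF that] le[OF that(1)]] .
    qed (use smooth bs W(1) int in \<open>auto intro!: smooth_has_derivative simp del: iter_partial.simps\<close>)
  qed
  show eq: "iter_partial bs (\<lambda>p. \<integral>z. G z p \<partial>M) = (\<lambda>p. \<integral>z. iter_partial bs (G z) p \<partial>M)"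
    if "set bs \<subseteq> Basis" for bs
    using that
  proof (induction bs)
    case (Cons b bs)
    then have b: "b \<in> Basis" and bs: "set bs \<subseteq> Basis" by auto
    have "partial_deriv b (\<lambda>p. \<integral>z. iter_partial bs (G z) p \<partial>M) p = (\<integral>z. iter_partial (b # bs) (G z) p \<partial>M)" for p
      unfolding partial_deriv_eq[OF deriv[OF bs]]
      using b by (simp add: inner_Basis if_distrib[of "\<lambda>c. c *\<^sub>R _"] sum.delta cong: if_cong del: iter_partial.simps)
    then show ?case
      unfolding iter_partial.simps(2)[of b bs "\<lambda>p. \<integral>z. G z p \<partial>M"] Cons.IH[OF bs] by (rule ext)
  qed simp
  show "(\<lambda>p. \<integral>z. G z p \<partial>M) \<in> smooth"
    unfolding smooth_def using eq deriv by (auto simp: differentiable_def)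
qed


section \<open>Polynomial bounds\<close>

lemma OM_bound:
  assumes "f \<in> OM"
  shows "\<exists>q::nat. \<exists>M\<ge>0. \<forall>bs\<in>indices l. \<forall>x. norm (iter_partial bs f x) \<le> M * (1 + norm x) ^ q"
proof -
  obtain q :: nat where "mu (- int q) l f < \<infinity>"
    using assms by (auto simp: OM_def)
  then have "mu (- int q) l f \<le> ennreal (enn2real (mu (- int q) l f))"
    by simp
  then show ?thesis
    unfolding mu_le_ennreal_iff[OF enn2real_nonneg]
    by (intro exI[of _ q] exI[of _ "enn2real (mu (- int q) l f)"] conjI enn2real_nonneg)
qed

lemma OM_I:
  assumes "f \<in> smooth"
    and "\<And>l. \<exists>q::nat. \<exists>M\<ge>0. \<forall>bs\<in>indices l. \<forall>x. norm (iter_partial bs f x) \<le> M * (1 + norm x) ^ q"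
  shows "f \<in> OM"
proof -
  have "\<exists>q::nat. mu (- int q) l f < \<infinity>" for l
  proof -
    obtain q :: nat and M where "0 \<le> M" "\<forall>bs\<in>indices l. \<forall>x. norm (iter_partial bs f x) \<le> M * (1 + norm x) ^ q"
      using assms(2)[of l] by blast
    then have "mu (- int q) l f \<le> ennreal M"
      by (simp add: mu_le_ennreal_iff)
    then show ?thesis
      by (intro exI[of _ q]) (simp add: le_less_trans[OF _ ennreal_less_top])
  qed
  with assms(1) show ?thesis
    by (simp add: OM_def)
qed

lemma OM_measurable: "f \<in> OM \<Longrightarrow> f \<in> borel_measurable borel"
  using smooth_continuous[of f "[]" UNIV] by (auto intro: borel_measurable_continuous_onI simp: OM_smooth)

lemma powi_minus_eq: "\<epsilon> powi (- int m) = (1 / \<epsilon>) ^ m" for \<epsilon> :: real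
  by (simp add: power_int_minus power_one_over inverse_eq_divide)

lemma E_tau_OM: "f \<in> E_tau \<Longrightarrow> \<epsilon> \<in> {0<..1} \<Longrightarrow> f \<epsilon> \<in> OM"
  by (simp add: E_tau_def)

lemma E_tau_bound:
  assumes "f \<in> E_tau"
  shows "\<exists>q m. \<exists>C\<ge>0. \<forall>\<^sub>F \<epsilon> in at_right 0. \<forall>bs\<in>indices l. \<forall>x.
    norm (iter_partial bs (f \<epsilon>) x) \<le> C * (1 / \<epsilon>) ^ m * (1 + norm x) ^ q"
proof -
  obtain q m :: nat and C where f: "\<forall>\<^sub>F \<epsilon> in at_right 0. mu (- int q) l (f \<epsilon>) \<le> ennreal (C * (1 / \<epsilon>) ^ m)"
    using assms unfolding E_tau_def powi_minus_eq by blast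
  have "\<forall>\<^sub>F \<epsilon> in at_right 0. \<forall>bs\<in>indices l. \<forall>x.
    norm (iter_partial bs (f \<epsilon>) x) \<le> \<bar>C\<bar> * (1 / \<epsilon>) ^ m * (1 + norm x) ^ q"
    using f at_right_0_in_unit
  proof eventually_elim
    case (elim \<epsilon>)
    then have pos: "0 \<le> (1 / \<epsilon>) ^ m"
      by simp
    have "mu (- int q) l (f \<epsilon>) \<le> ennreal (\<bar>C\<bar> * (1 / \<epsilon>) ^ m)"
      using elim(1) pos by (rule order_trans[OF _ ennreal_leI[OF mult_right_mono[OF abs_ge_self]]])
    then show ?case
      using pos by (simp only: mu_le_ennreal_iff mult_nonneg_nonneg abs_ge_zero)
  qed
  then show ?thesis
    by (intro exI[of _ q] exI[of _ m] exI[of _ "\<bar>C\<bar>"]) simp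
qed

lemma E_tau_I:
  assumes "\<And>\<epsilon>. \<epsilon> \<in> {0<..1} \<Longrightarrow> f \<epsilon> \<in> OM"
    and "\<And>l. \<exists>q m. \<exists>C\<ge>0. \<forall>\<^sub>F \<epsilon> in at_right 0. \<forall>bs\<in>indices l. \<forall>x.
      norm (iter_partial bs (f \<epsilon>) x) \<le> C * (1 / \<epsilon>) ^ m * (1 + norm x) ^ q"
  shows "f \<in> E_tau"
proof -
  have "\<exists>(q::nat) (m::nat). \<exists>C::real. \<forall>\<^sub>F \<epsilon> in at_right 0.
      mu (- int q) l (f \<epsilon>) \<le> ennreal (C * \<epsilon> powi (- int m))" for l
  proof -
    obtain q m C where C: "0 \<le> C" and f: "\<forall>\<^sub>F \<epsilon> in at_right 0. \<forall>bs\<in>indices l. \<forall>x.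
      norm (iter_partial bs (f \<epsilon>) x) \<le> C * (1 / \<epsilon>) ^ m * (1 + norm x) ^ q"
      using assms(2)[of l] by blast
    have "\<forall>\<^sub>F \<epsilon> in at_right 0. mu (- int q) l (f \<epsilon>) \<le> ennreal (C * \<epsilon> powi (- int m))"
      using f at_right_0_in_unit
    proof eventually_elim
      case (elim \<epsilon>)
      then have "0 \<le> C * (1 / \<epsilon>) ^ m"
        using C by simp
      then show ?case
        unfolding powi_minus_eq using elim(1) by (simp only: mu_le_ennreal_iff)
    qed
    then show ?thesis by blast
  qed
  with assms(1) show ?thesis
    by (simp add: E_tau_def)
qed

lemma one_plus_norm_Pair_le: "1 + norm (x, y) \<le> (1 + norm x) * (1 + norm y)"
  using order_trans[OF norm_Pair_le[of x y], of "norm x + norm y + norm x * norm y"]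
  by (simp add: algebra_simps)

lemma norm_integral_le:
  fixes f :: "'z \<Rightarrow> 'c::{banach, second_countable_topology}"
  assumes "integrable M f" "integrable M W" "\<And>z. norm (f z) \<le> R * W z"
  shows "norm (\<integral>z. f z \<partial>M) \<le> R * (\<integral>z. W z \<partial>M)"
proof -
  have "norm (\<integral>z. f z \<partial>M) \<le> (\<integral>z. norm (f z) \<partial>M)"
    by (rule integral_norm_bound)
  also have "\<dots> \<le> (\<integral>z. R * W z \<partial>M)"
    using assms by (intro integral_mono) auto
  finally show ?thesis
    by simp
qed

lemma integrable_pair_mult:
  fixes a :: "'a::euclidean_space \<Rightarrow> real" and b :: "'b::euclidean_space \<Rightarrow> real"
  assumes "integrable lborel a" "integrable lborel b"
  shows "integrable (lborel \<Otimes>\<^sub>M lborel) (\<lambda>(x, y). a x * b y)"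
proof (rule lborel_pair.Fubini_integrable)
  have [measurable]: "a \<in> borel_measurable lborel" "b \<in> borel_measurable lborel"
    using assms by auto
  show "(\<lambda>(x, y). a x * b y) \<in> borel_measurable (lborel \<Otimes>\<^sub>M lborel)"
    by measurable
  show "integrable lborel (\<lambda>x. \<integral>y. norm (case (x, y) of (x, y) \<Rightarrow> a x * b y) \<partial>lborel)"
    using assms by (simp add: abs_mult)
qed (use assms in auto)

section \<open>Integral operators\<close>

lemma fst_slice_measurable:
  fixes K :: "'a::euclidean_space \<times> 'b::euclidean_space \<Rightarrow> complex"
  assumes "K \<in> smooth" "set bs \<subseteq> Basis"
  shows "(\<lambda>y. iter_partial bs K (x, y)) \<in> borel_measurable borel"
  by (intro borel_measurable_continuous_onI continuous_on_compose2[OF smooth_continuous[OF assms, of UNIV]])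
     (auto intro!: continuous_intros)

lemma snd_slice_measurable:
  fixes K :: "'a::euclidean_space \<times> 'b::euclidean_space \<Rightarrow> complex"
  assumes "K \<in> smooth" "set bs \<subseteq> Basis"
  shows "(\<lambda>x. iter_partial bs K (x, y)) \<in> borel_measurable borel"
  by (intro borel_measurable_continuous_onI continuous_on_compose2[OF smooth_continuous[OF assms, of UNIV]])
     (auto intro!: continuous_intros)

text \<open>
  The argument is only asked to be tame after multiplication by the weight. Two instances matter:
  \<open>\<eta> = \<epsilon>\<close> with a polynomially bounded \<open>f\<close>, and \<open>\<eta> = \<epsilon> / 2\<close> with an \<open>f\<close> controlled by a single
  Gaussian seminorm, which yields continuity.
\<close>

context
  fixes K :: "'a::euclidean_space \<times> 'a \<Rightarrow> complex" and f :: "'a \<Rightarrow> complex" and \<epsilon> \<eta> S :: real and r :: nat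
  assumes K: "K \<in> OM" and f: "f \<in> borel_measurable borel"
    and f_bound: "\<And>y. norm (f y) * exp (- \<epsilon> * (norm y)\<^sup>2) \<le> S * (1 + norm y) ^ r * exp (- \<eta> * (norm y)\<^sup>2)"
    and \<eta>: "0 < \<eta>" "\<eta> \<le> 1"
begin

abbreviation (input) weight :: "'a \<Rightarrow> complex" where
  "weight y \<equiv> f y * of_real (exp (- \<epsilon> * (norm y)\<^sup>2))"

lemma norm_weight_le: "norm (weight y) \<le> S * (1 + norm y) ^ r * exp (- \<eta> * (norm y)\<^sup>2)"
  using f_bound[of y] by (simp add: norm_mult)

lemma weight_bound_nonneg: "0 \<le> S"
  using f_bound[of 0] order_trans[OF norm_ge_zero[of "f 0"]] by simp

lemma kernel_op_integrand_bound:
  assumes "bs \<in> indices l" "0 \<le> M"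
    and "\<And>bs p. bs \<in> indices l \<Longrightarrow> norm (iter_partial bs K p) \<le> M * (1 + norm p) ^ q"
  shows "norm (iter_partial bs (\<lambda>x. weight y * K (x, y)) x)
    \<le> (M * S * (1 + norm x) ^ q) * ((1 + norm y) ^ (q + r) * exp (- \<eta> * (norm y)\<^sup>2))"
proof -
  let ?bs = "map (\<lambda>b. (b, 0)) bs :: ('a \<times> 'a) list"
  have bs: "set bs \<subseteq> Basis" "?bs \<in> indices l"
    using assms(1) fst_directions_Basis[of bs] by (auto simp: indices_def)
  have "(1 + norm (x, y)) ^ q \<le> ((1 + norm x) * (1 + norm y)) ^ q"
    by (intro power_mono one_plus_norm_Pair_le) simp
  then have "M * (1 + norm (x, y)) ^ q \<le> M * ((1 + norm x) ^ q * (1 + norm y) ^ q)"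
    using assms(2) by (auto simp: power_mult_distrib intro: mult_left_mono)
  then have "norm (iter_partial ?bs K (x, y)) \<le> M * ((1 + norm x) ^ q * (1 + norm y) ^ q)"
    by (rule order_trans[OF assms(3)[OF bs(2)]])
  then have "norm (weight y) * norm (iter_partial ?bs K (x, y))
      \<le> (S * (1 + norm y) ^ r * exp (- \<eta> * (norm y)\<^sup>2)) * (M * ((1 + norm x) ^ q * (1 + norm y) ^ q))"
    using weight_bound_nonneg by (intro mult_mono norm_weight_le) auto
  then show ?thesis
    unfolding iter_partial_cmult[OF smooth_fst_slice[OF OM_smooth[OF K]] bs(1)]
      iter_partial_fst_slice[OF OM_smooth[OF K] bs(1)] norm_mult[of "weight y"]
    by (simp add: power_add mult_ac)
qed

lemma integrable_moment: "integrable lborel (\<lambda>y::'a. (1 + norm y) ^ q * exp (- \<eta> * (norm y)\<^sup>2))"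
  using gauss_moment_bound[where 'a = 'a, of q] \<eta> by auto

lemma kernel_op_slices_smooth: "(\<lambda>x. weight y * K (x, y)) \<in> smooth"
  by (intro smooth_cmult smooth_fst_slice OM_smooth K)

lemma kernel_op_integrand_measurable:
  assumes bs: "set bs \<subseteq> Basis"
  shows "(\<lambda>y. iter_partial bs (\<lambda>x. weight y * K (x, y)) x) \<in> borel_measurable lborel"
  unfolding iter_partial_cmult[OF smooth_fst_slice[OF OM_smooth[OF K]] bs]
    iter_partial_fst_slice[OF OM_smooth[OF K] bs]
  using fst_slice_measurable[OF OM_smooth[OF K] fst_directions_Basis[OF bs]] f by measurable

lemma kernel_op_integrand_dominated:
  assumes bs: "set bs \<subseteq> Basis"
  shows "\<exists>W (q::nat). integrable lborel W \<and>
    (\<forall>x y. norm (iter_partial bs (\<lambda>x. weight y * K (x, y)) x) \<le> W y * (1 + norm x) ^ q)"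
proof -
  have bs: "bs \<in> indices (length bs)"
    using bs by (simp add: indices_def)
  obtain q :: nat and M where M: "0 \<le> M"
      "\<And>bs' p. bs' \<in> indices (length bs) \<Longrightarrow> norm (iter_partial bs' K p) \<le> M * (1 + norm p) ^ q"
    using OM_bound[OF K, of "length bs"] by blast
  let ?W = "\<lambda>y::'a. (M * S) * ((1 + norm y) ^ (q + r) * exp (- \<eta> * (norm y)\<^sup>2))"
  have "integrable lborel ?W"
    by (intro integrable_mult_right integrable_moment)
  moreover have "norm (iter_partial bs (\<lambda>x. weight y * K (x, y)) x) \<le> ?W y * (1 + norm x) ^ q" for x y
    using kernel_op_integrand_bound[OF bs M] by (simp add: mult_ac)
  ultimately show ?thesis
    by (intro exI[of _ ?W] exI[of _ q]) simp
qed

lemma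
  shows integrable_kernel_op_integrand:
      "set bs \<subseteq> Basis \<Longrightarrow> integrable lborel (\<lambda>y. iter_partial bs (\<lambda>x. weight y * K (x, y)) x)"
    and iter_partial_kernel_op_integrand: "set bs \<subseteq> Basis \<Longrightarrow>
      iter_partial bs (\<lambda>x. \<integral>y. weight y * K (x, y) \<partial>lborel)
        = (\<lambda>x. \<integral>y. iter_partial bs (\<lambda>x. weight y * K (x, y)) x \<partial>lborel)"
    and smooth_kernel_op_integrand: "(\<lambda>x. \<integral>y. weight y * K (x, y) \<partial>lborel) \<in> smooth"
proof -
  note prems = kernel_op_slices_smooth kernel_op_integrand_measurable kernel_op_integrand_dominated
  show "set bs \<subseteq> Basis \<Longrightarrow> integrable lborel (\<lambda>y. iter_partial bs (\<lambda>x. weight y * K (x, y)) x)"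
    by (rule integrable_iter_partial[where G = "\<lambda>y x. weight y * K (x, y)"]) (rule prems | assumption)+
  show "set bs \<subseteq> Basis \<Longrightarrow> iter_partial bs (\<lambda>x. \<integral>y. weight y * K (x, y) \<partial>lborel)
        = (\<lambda>x. \<integral>y. iter_partial bs (\<lambda>x. weight y * K (x, y)) x \<partial>lborel)"
    by (rule iter_partial_integral[where G = "\<lambda>y x. weight y * K (x, y)"]) (rule prems | assumption)+
  show "(\<lambda>x. \<integral>y. weight y * K (x, y) \<partial>lborel) \<in> smooth"
    by (rule smooth_integral[where G = "\<lambda>y x. weight y * K (x, y)"]) (rule prems | assumption)+
qed

lemma kernel_op_eq: "kernel_op \<epsilon> K f = (\<lambda>x. \<integral>y. weight y * K (x, y) \<partial>lborel)"
  by (simp add: kernel_op_def[abs_def] mult_ac)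

lemma kernel_op_smooth: "kernel_op \<epsilon> K f \<in> smooth"
  unfolding kernel_op_eq by (rule smooth_kernel_op_integrand)

lemma integrable_kernel_op: "integrable lborel (\<lambda>y. K (x, y) * f y * of_real (exp (- \<epsilon> * (norm y)\<^sup>2)))"
  using integrable_kernel_op_integrand[of "[]" x] by (simp add: mult_ac)

text \<open>
  The right-hand side is linear in the bound \<open>M\<close> on the kernel and in the bound \<open>S\<close> on the argument, and the
  polynomial order in \<open>x\<close> is that of the kernel: this gives moderateness of nets as well as
  the operator bounds.
\<close>

lemma norm_iter_partial_kernel_op_le:
  assumes "bs \<in> indices l" "0 \<le> M"
    and "\<And>bs p. bs \<in> indices l \<Longrightarrow> norm (iter_partial bs K p) \<le> M * (1 + norm p) ^ q"
  shows "norm (iter_partial bs (kernel_op \<epsilon> K f) x)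
    \<le> M * S * (1 + norm x) ^ q * (\<integral>y. (1 + norm (y::'a)) ^ (q + r) * exp (- \<eta> * (norm y)\<^sup>2) \<partial>lborel)"
proof -
  have bs: "set bs \<subseteq> Basis"
    using assms(1) by (simp add: indices_def)
  show ?thesis
    unfolding kernel_op_eq iter_partial_kernel_op_integrand[OF bs]
    by (intro norm_integral_le integrable_kernel_op_integrand bs integrable_moment kernel_op_integrand_bound[OF assms])
qed

lemma kernel_op_in_OM: "kernel_op \<epsilon> K f \<in> OM"
proof (rule OM_I[OF kernel_op_smooth])
  fix l
  obtain q :: nat and M where M: "0 \<le> M"
      "\<And>bs p. bs \<in> indices l \<Longrightarrow> norm (iter_partial bs K p) \<le> M * (1 + norm p) ^ q"
    using OM_bound[OF K, of l] by blast
  let ?J = "\<integral>y. (1 + norm (y::'a)) ^ (q + r) * exp (- \<eta> * (norm y)\<^sup>2) \<partial>lborel"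
  have "norm (iter_partial bs (kernel_op \<epsilon> K f) x) \<le> (M * S * ?J) * (1 + norm x) ^ q"
    if "bs \<in> indices l" for bs x
    using norm_iter_partial_kernel_op_le[OF that M] by (simp add: mult_ac)
  moreover have "0 \<le> M * S * ?J"
    using M(1) weight_bound_nonneg by (intro mult_nonneg_nonneg Bochner_Integration.integral_nonneg) auto
  ultimately show "\<exists>q::nat. \<exists>C\<ge>0. \<forall>bs\<in>indices l. \<forall>x.
      norm (iter_partial bs (kernel_op \<epsilon> K f) x) \<le> C * (1 + norm x) ^ q"
    by (intro exI[of _ q] exI[of _ "M * S * ?J"]) simp
qed

end

lemma OM_weight_bound:
  assumes "f \<in> OM"
  shows "\<exists>(r::nat). \<exists>S\<ge>0. \<forall>y. norm (f y) \<le> S * (1 + norm y) ^ r"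
proof -
  have "[] \<in> indices 0"
    by (simp add: indices_def)
  then show ?thesis
    using OM_bound[OF assms, of 0] by force
qed

lemma OM_weight:
  assumes "f \<in> OM"
  shows "\<exists>S r. \<forall>\<epsilon> y. norm (f y) * exp (- \<epsilon> * (norm y)\<^sup>2) \<le> S * (1 + norm y) ^ r * exp (- \<epsilon> * (norm y)\<^sup>2)"
  using OM_weight_bound[OF assms] by (meson exp_ge_zero mult_right_mono)

lemma kernel_op_OM:
  assumes "K \<in> OM" "f \<in> OM" "\<epsilon> \<in> {0<..1}"
  shows "kernel_op \<epsilon> K f \<in> OM"
proof -
  obtain S r where "\<And>y. norm (f y) * exp (- \<epsilon> * (norm y)\<^sup>2) \<le> S * (1 + norm y) ^ r * exp (- \<epsilon> * (norm y)\<^sup>2)"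
    using OM_weight[OF assms(2)] by blast
  from kernel_op_in_OM[OF assms(1) OM_measurable[OF assms(2)] this] assms(3) show ?thesis
    by simp
qed

lemma integrable_kernel_op_OM:
  fixes K :: "'a::euclidean_space \<times> 'a \<Rightarrow> complex"
  assumes "K \<in> OM" "f \<in> OM" "\<epsilon> \<in> {0<..1}"
  shows "integrable lborel (\<lambda>y. K (x, y) * f y * of_real (exp (- \<epsilon> * (norm y)\<^sup>2)))"
proof -
  obtain S r where "\<And>y. norm (f y) * exp (- \<epsilon> * (norm y)\<^sup>2) \<le> S * (1 + norm y) ^ r * exp (- \<epsilon> * (norm y)\<^sup>2)"
    using OM_weight[OF assms(2)] by blast
  from integrable_kernel_op[OF assms(1) OM_measurable[OF assms(2)] this] assms(3) show ?thesis
    by simp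
qed

lemma kernel_op_add:
  assumes "K \<in> OM" "f \<in> OM" "g \<in> OM" "\<epsilon> \<in> {0<..1}"
  shows "kernel_op \<epsilon> K (\<lambda>y. f y + g y) = (\<lambda>x. kernel_op \<epsilon> K f x + kernel_op \<epsilon> K g x)"
  using integrable_kernel_op_OM[OF assms(1,2,4)] integrable_kernel_op_OM[OF assms(1,3,4)]
  by (simp add: kernel_op_def fun_eq_iff distrib_left distrib_right)

lemma kernel_op_cmult: "kernel_op \<epsilon> K (\<lambda>y. c * f y) = (\<lambda>x. c * kernel_op \<epsilon> K f x)"
  by (simp add: kernel_op_def fun_eq_iff mult_ac flip: integral_mult_right_zero)

lemma kernel_op_E_tau:
  fixes f :: "real \<Rightarrow> 'a::euclidean_space \<Rightarrow> complex"
  assumes K: "K \<in> E_tau" and f: "f \<in> E_tau"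
  shows "(\<lambda>\<epsilon>. kernel_op \<epsilon> (K \<epsilon>) (f \<epsilon>)) \<in> E_tau"
proof (rule E_tau_I)
  show "kernel_op \<epsilon> (K \<epsilon>) (f \<epsilon>) \<in> OM" if "\<epsilon> \<in> {0<..1}" for \<epsilon>
    using that K f by (intro kernel_op_OM) (auto simp: E_tau_OM)
  fix l
  obtain q m C where C: "0 \<le> C" and Kb: "\<forall>\<^sub>F \<epsilon> in at_right 0. \<forall>bs\<in>indices l. \<forall>p.
      norm (iter_partial bs (K \<epsilon>) p) \<le> C * (1 / \<epsilon>) ^ m * (1 + norm p) ^ q"
    using E_tau_bound[OF K, of l] by blast
  obtain r m' C' where C': "0 \<le> C'" and fb: "\<forall>\<^sub>F \<epsilon> in at_right 0. \<forall>bs\<in>indices 0. \<forall>y.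
      norm (iter_partial bs (f \<epsilon>) y) \<le> C' * (1 / \<epsilon>) ^ m' * (1 + norm y) ^ r"
    using E_tau_bound[OF f, of 0] by blast
  obtain D and N :: nat where D: "0 \<le> D" and J: "\<And>\<eta>. \<eta> \<in> {0<..1} \<Longrightarrow>
      (\<integral>y. (1 + norm (y::'a)) ^ (q + r) * exp (- \<eta> * (norm y)\<^sup>2) \<partial>lborel) \<le> D * (1 / \<eta>) ^ N"
    using gauss_moment_bound[where 'a = 'a, of "q + r"] by blast
  have "\<forall>\<^sub>F \<epsilon> in at_right 0. \<forall>bs\<in>indices l. \<forall>x. norm (iter_partial bs (kernel_op \<epsilon> (K \<epsilon>) (f \<epsilon>)) x)
      \<le> (C * C' * D) * (1 / \<epsilon>) ^ (m + m' + N) * (1 + norm x) ^ q"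
    using Kb fb at_right_0_in_unit
  proof eventually_elim
    case (elim \<epsilon>)
    let ?J = "\<integral>y. (1 + norm (y::'a)) ^ (q + r) * exp (- \<epsilon> * (norm y)\<^sup>2) \<partial>lborel"
    show ?case
    proof (intro ballI allI)
      fix bs :: "'a list" and x
      assume bs: "bs \<in> indices l"
      have "norm (f \<epsilon> y) \<le> C' * (1 / \<epsilon>) ^ m' * (1 + norm y) ^ r" for y
        using elim(2) by (auto simp: indices_def dest: bspec[of _ _ "[]"])
      then have "norm (f \<epsilon> y) * exp (- \<epsilon> * (norm y)\<^sup>2)
          \<le> (C' * (1 / \<epsilon>) ^ m') * (1 + norm y) ^ r * exp (- \<epsilon> * (norm y)\<^sup>2)" for y
        by (intro mult_right_mono) auto
      then have "norm (iter_partial bs (kernel_op \<epsilon> (K \<epsilon>) (f \<epsilon>)) x)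
          \<le> (C * (1 / \<epsilon>) ^ m) * (C' * (1 / \<epsilon>) ^ m') * (1 + norm x) ^ q * ?J"
        using elim C bs K f
        by (intro norm_iter_partial_kernel_op_le[where l = l]) (auto simp: E_tau_OM OM_measurable)
      also have "\<dots> \<le> (C * (1 / \<epsilon>) ^ m) * (C' * (1 / \<epsilon>) ^ m') * (1 + norm x) ^ q * (D * (1 / \<epsilon>) ^ N)"
        using elim(3) C C' by (intro mult_left_mono J) auto
      finally show "norm (iter_partial bs (kernel_op \<epsilon> (K \<epsilon>) (f \<epsilon>)) x)
          \<le> (C * C' * D) * (1 / \<epsilon>) ^ (m + m' + N) * (1 + norm x) ^ q"
        by (simp add: power_add mult_ac)
    qed
  qed
  then show "\<exists>q m. \<exists>C\<ge>0. \<forall>\<^sub>F \<epsilon> in at_right 0. \<forall>bs\<in>indices l. \<forall>x.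
      norm (iter_partial bs (kernel_op \<epsilon> (K \<epsilon>) (f \<epsilon>)) x) \<le> C * (1 / \<epsilon>) ^ m * (1 + norm x) ^ q"
    using C C' D by (intro exI[of _ q] exI[of _ "m + m' + N"] exI[of _ "C * C' * D"]) simp
qed

section \<open>The kernel of a composition\<close>

text \<open>
  For fixed \<open>z\<close> the integrand is a tensor product in the two outer variables, so its derivatives are
  products of derivatives of slices of the two kernels.
\<close>

context
  fixes K1 K2 :: "'a::euclidean_space \<times> 'a \<Rightarrow> complex" and \<epsilon> :: real
  assumes K1: "K1 \<in> OM" and K2: "K2 \<in> OM" and \<epsilon>: "0 < \<epsilon>" "\<epsilon> \<le> 1"
begin

abbreviation (input) comp_integrand :: "'a \<Rightarrow> 'a \<times> 'a \<Rightarrow> complex" where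
  "comp_integrand z \<equiv> \<lambda>p. (of_real (exp (- \<epsilon> * (norm z)\<^sup>2)) * K2 (fst p, z)) * K1 (z, snd p)"

lemma comp_integrand_smooth: "comp_integrand z \<in> smooth"
  by (intro smooth_tensor[of "\<lambda>x. of_real (exp (- \<epsilon> * (norm z)\<^sup>2)) * K2 (x, z)"]
      smooth_cmult smooth_fst_slice smooth_snd_slice OM_smooth K1 K2)

lemma iter_partial_comp_integrand:
  assumes bs: "set bs \<subseteq> Basis"
  shows "iter_partial bs (comp_integrand z) p = of_real (exp (- \<epsilon> * (norm z)\<^sup>2))
    * iter_partial (map (\<lambda>b. (b, 0)) (fst_dirs bs)) K2 (fst p, z)
    * iter_partial (map (\<lambda>b. (0, b)) (snd_dirs bs)) K1 (z, snd p)"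
proof -
  have s: "(\<lambda>x. K2 (x, z)) \<in> smooth" "(\<lambda>y. K1 (z, y)) \<in> smooth"
    by (intro smooth_fst_slice smooth_snd_slice OM_smooth K1 K2)+
  show ?thesis
    by (subst iter_partial_tensor[OF smooth_cmult[OF s(1)] s(2) bs])
       (simp add: iter_partial_cmult[OF s(1) dirs_Basis(1)[OF bs]]
         iter_partial_fst_slice[OF OM_smooth[OF K2] dirs_Basis(1)[OF bs]]
         iter_partial_snd_slice[OF OM_smooth[OF K1] dirs_Basis(2)[OF bs]])
qed

lemma comp_integrand_bound:
  assumes bs: "bs \<in> indices l"
    and "0 \<le> M1" "\<And>bs p. bs \<in> indices l \<Longrightarrow> norm (iter_partial bs K1 p) \<le> M1 * (1 + norm p) ^ q1"
    and "0 \<le> M2" "\<And>bs p. bs \<in> indices l \<Longrightarrow> norm (iter_partial bs K2 p) \<le> M2 * (1 + norm p) ^ q2"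
  shows "norm (iter_partial bs (comp_integrand z) p)
    \<le> (M1 * M2 * (1 + norm p) ^ (q1 + q2)) * ((1 + norm z) ^ (q1 + q2) * exp (- \<epsilon> * (norm z)\<^sup>2))"
proof -
  let ?c1 = "map (\<lambda>b. (0, b)) (snd_dirs bs) :: ('a \<times> 'a) list"
  let ?c2 = "map (\<lambda>b. (b, 0)) (fst_dirs bs) :: ('a \<times> 'a) list"
  have bs': "set bs \<subseteq> Basis"
    using bs by (simp add: indices_def)
  have cs: "?c1 \<in> indices l" "?c2 \<in> indices l"
    using bs dirs_Basis[OF bs'] fst_directions_Basis[of "fst_dirs bs"] snd_directions_Basis[of "snd_dirs bs"]
      length_dirs[of bs] by (auto simp: indices_def)
  have aux: "M * (1 + norm v) ^ q \<le> M * ((1 + norm p) ^ q * (1 + norm z) ^ q)"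
    if "0 \<le> M" "1 + norm v \<le> (1 + norm p) * (1 + norm z)" for M v q
    unfolding power_mult_distrib[symmetric] using that by (intro mult_left_mono power_mono) auto
  have n: "norm (fst p) \<le> norm p" "norm (snd p) \<le> norm p"
    using norm_fst_le[of "fst p" "snd p"] norm_snd_le[of "snd p" "fst p"] by auto
  have "1 + norm (fst p, z) \<le> (1 + norm p) * (1 + norm z)"
    using n by (intro order_trans[OF one_plus_norm_Pair_le] mult_right_mono) auto
  then have 2: "norm (iter_partial ?c2 K2 (fst p, z)) \<le> M2 * ((1 + norm p) ^ q2 * (1 + norm z) ^ q2)"
    by (intro order_trans[OF assms(5)[OF cs(2)] aux[OF assms(4)]])
  have "1 + norm (z, snd p) \<le> (1 + norm z) * (1 + norm p)"
    using n by (intro order_trans[OF one_plus_norm_Pair_le] mult_left_mono) auto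
  then have 1: "norm (iter_partial ?c1 K1 (z, snd p)) \<le> M1 * ((1 + norm p) ^ q1 * (1 + norm z) ^ q1)"
    by (intro order_trans[OF assms(3)[OF cs(1)] aux[OF assms(2)]]) (simp add: mult.commute)
  have "norm (iter_partial bs (comp_integrand z) p)
      = exp (- \<epsilon> * (norm z)\<^sup>2) * norm (iter_partial ?c2 K2 (fst p, z)) * norm (iter_partial ?c1 K1 (z, snd p))"
    unfolding iter_partial_comp_integrand[OF bs'] norm_mult by simp
  also have "\<dots> \<le> exp (- \<epsilon> * (norm z)\<^sup>2) * (M2 * ((1 + norm p) ^ q2 * (1 + norm z) ^ q2))
      * (M1 * ((1 + norm p) ^ q1 * (1 + norm z) ^ q1))"
    using assms by (intro mult_mono 1 2) auto
  finally show ?thesis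
    by (simp add: power_add mult_ac)
qed

lemma comp_integrand_measurable:
  assumes bs: "set bs \<subseteq> Basis"
  shows "(\<lambda>z. iter_partial bs (comp_integrand z) p) \<in> borel_measurable lborel"
  unfolding iter_partial_comp_integrand[OF bs]
  using fst_slice_measurable[OF OM_smooth[OF K2] fst_directions_Basis[OF dirs_Basis(1)[OF bs]]]
    snd_slice_measurable[OF OM_smooth[OF K1] snd_directions_Basis[OF dirs_Basis(2)[OF bs]]]
  by measurable

lemma integrable_comp_moment: "integrable lborel (\<lambda>y::'a. (1 + norm y) ^ q * exp (- \<epsilon> * (norm y)\<^sup>2))"
  using gauss_moment_bound[where 'a = 'a, of q] \<epsilon> by auto

lemma comp_integrand_dominated:
  assumes bs: "set bs \<subseteq> Basis"
  shows "\<exists>W (q::nat). integrable lborel W \<and>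
    (\<forall>p z. norm (iter_partial bs (comp_integrand z) p) \<le> W z * (1 + norm p) ^ q)"
proof -
  let ?l = "length bs"
  have bs: "bs \<in> indices ?l"
    using bs by (simp add: indices_def)
  obtain q1 :: nat and M1 where M1: "0 \<le> M1"
      "\<And>bs' p. bs' \<in> indices ?l \<Longrightarrow> norm (iter_partial bs' K1 p) \<le> M1 * (1 + norm p) ^ q1"
    using OM_bound[OF K1, of ?l] by blast
  obtain q2 :: nat and M2 where M2: "0 \<le> M2"
      "\<And>bs' p. bs' \<in> indices ?l \<Longrightarrow> norm (iter_partial bs' K2 p) \<le> M2 * (1 + norm p) ^ q2"
    using OM_bound[OF K2, of ?l] by blast
  let ?W = "\<lambda>z::'a. (M1 * M2) * ((1 + norm z) ^ (q1 + q2) * exp (- \<epsilon> * (norm z)\<^sup>2))"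
  have "integrable lborel ?W"
    by (intro integrable_mult_right integrable_comp_moment)
  moreover have "norm (iter_partial bs (comp_integrand z) p) \<le> ?W z * (1 + norm p) ^ (q1 + q2)" for p z
    using comp_integrand_bound[OF bs M1 M2] by (simp add: mult_ac)
  ultimately show ?thesis
    by (intro exI[of _ ?W] exI[of _ "q1 + q2"]) simp
qed

lemma
  shows integrable_comp_integrand:
      "set bs \<subseteq> Basis \<Longrightarrow> integrable lborel (\<lambda>z. iter_partial bs (comp_integrand z) p)"
    and iter_partial_comp_integral: "set bs \<subseteq> Basis \<Longrightarrow>
      iter_partial bs (\<lambda>p. \<integral>z. comp_integrand z p \<partial>lborel)
        = (\<lambda>p. \<integral>z. iter_partial bs (comp_integrand z) p \<partial>lborel)"
    and smooth_comp_integral: "(\<lambda>p. \<integral>z. comp_integrand z p \<partial>lborel) \<in> smooth"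
proof -
  note prems = comp_integrand_smooth comp_integrand_measurable comp_integrand_dominated
  show "set bs \<subseteq> Basis \<Longrightarrow> integrable lborel (\<lambda>z. iter_partial bs (comp_integrand z) p)"
    by (rule integrable_iter_partial[where G = "comp_integrand"]) (rule prems | assumption)+
  show "set bs \<subseteq> Basis \<Longrightarrow> iter_partial bs (\<lambda>p. \<integral>z. comp_integrand z p \<partial>lborel)
        = (\<lambda>p. \<integral>z. iter_partial bs (comp_integrand z) p \<partial>lborel)"
    by (rule iter_partial_integral[where G = "comp_integrand"]) (rule prems | assumption)+
  show "(\<lambda>p. \<integral>z. comp_integrand z p \<partial>lborel) \<in> smooth"
    by (rule smooth_integral[where G = "comp_integrand"]) (rule prems | assumption)+
qed

lemma kernel_comp_eq: "kernel_comp \<epsilon> K2 K1 = (\<lambda>p. \<integral>z. comp_integrand z p \<partial>lborel)"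
  by (simp add: kernel_comp_def fun_eq_iff mult_ac)

lemma norm_iter_partial_kernel_comp_le:
  assumes "bs \<in> indices l"
    and "0 \<le> M1" "\<And>bs p. bs \<in> indices l \<Longrightarrow> norm (iter_partial bs K1 p) \<le> M1 * (1 + norm p) ^ q1"
    and "0 \<le> M2" "\<And>bs p. bs \<in> indices l \<Longrightarrow> norm (iter_partial bs K2 p) \<le> M2 * (1 + norm p) ^ q2"
  shows "norm (iter_partial bs (kernel_comp \<epsilon> K2 K1) p) \<le> M1 * M2 * (1 + norm p) ^ (q1 + q2)
    * (\<integral>z. (1 + norm (z::'a)) ^ (q1 + q2) * exp (- \<epsilon> * (norm z)\<^sup>2) \<partial>lborel)"
proof -
  have bs: "set bs \<subseteq> Basis"
    using assms(1) by (simp add: indices_def)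
  show ?thesis
    unfolding kernel_comp_eq iter_partial_comp_integral[OF bs]
    by (intro norm_integral_le integrable_comp_integrand bs integrable_comp_moment comp_integrand_bound[OF assms])
qed

lemma kernel_comp_OM: "kernel_comp \<epsilon> K2 K1 \<in> OM"
proof (rule OM_I)
  show "kernel_comp \<epsilon> K2 K1 \<in> smooth"
    unfolding kernel_comp_eq by (rule smooth_comp_integral)
  fix l
  obtain q1 :: nat and M1 where M1: "0 \<le> M1"
      "\<And>bs p. bs \<in> indices l \<Longrightarrow> norm (iter_partial bs K1 p) \<le> M1 * (1 + norm p) ^ q1"
    using OM_bound[OF K1, of l] by blast
  obtain q2 :: nat and M2 where M2: "0 \<le> M2"
      "\<And>bs p. bs \<in> indices l \<Longrightarrow> norm (iter_partial bs K2 p) \<le> M2 * (1 + norm p) ^ q2"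
    using OM_bound[OF K2, of l] by blast
  let ?J = "\<integral>z. (1 + norm (z::'a)) ^ (q1 + q2) * exp (- \<epsilon> * (norm z)\<^sup>2) \<partial>lborel"
  have "norm (iter_partial bs (kernel_comp \<epsilon> K2 K1) p) \<le> (M1 * M2 * ?J) * (1 + norm p) ^ (q1 + q2)"
    if "bs \<in> indices l" for bs p
    using norm_iter_partial_kernel_comp_le[OF that M1 M2] by (simp add: mult_ac)
  moreover have "0 \<le> M1 * M2 * ?J"
    using M1(1) M2(1) by (intro mult_nonneg_nonneg Bochner_Integration.integral_nonneg) auto
  ultimately show "\<exists>q::nat. \<exists>C\<ge>0. \<forall>bs\<in>indices l. \<forall>p.
      norm (iter_partial bs (kernel_comp \<epsilon> K2 K1) p) \<le> C * (1 + norm p) ^ q"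
    by (intro exI[of _ "q1 + q2"] exI[of _ "M1 * M2 * ?J"]) simp
qed

text \<open>
  Fubini's theorem: the double integrand is dominated by a product of a function of \<open>z\<close> and a function of \<open>y\<close>, each
  a polynomial times a Gaussian.
\<close>

lemma kernel_op_kernel_op:
  assumes f: "f \<in> OM"
  shows "kernel_op \<epsilon> K2 (kernel_op \<epsilon> K1 f) = kernel_op \<epsilon> (kernel_comp \<epsilon> K2 K1) f"
proof
  fix x
  let ?e = "\<lambda>y::'a. exp (- \<epsilon> * (norm y)\<^sup>2)"
  let ?F = "\<lambda>z y. K2 (x, z) * of_real (?e z) * (K1 (z, y) * f y * of_real (?e y))"
  obtain q1 :: nat and M1 where M1: "0 \<le> M1" "\<And>p. norm (K1 p) \<le> M1 * (1 + norm p) ^ q1"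
    using OM_weight_bound[OF K1] by blast
  obtain q2 :: nat and M2 where M2: "0 \<le> M2" "\<And>p. norm (K2 p) \<le> M2 * (1 + norm p) ^ q2"
    using OM_weight_bound[OF K2] by blast
  obtain r :: nat and S where S: "0 \<le> S" "\<And>y. norm (f y) \<le> S * (1 + norm y) ^ r"
    using OM_weight_bound[OF f] by blast
  let ?a = "\<lambda>z. M2 * (1 + norm x) ^ q2 * ((1 + norm z) ^ (q1 + q2) * ?e z)"
  let ?b = "\<lambda>y. M1 * S * ((1 + norm y) ^ (q1 + r) * ?e y)"
  have pair: "integrable (lborel \<Otimes>\<^sub>M lborel) (case_prod ?F)"
  proof (rule Bochner_Integration.integrable_bound)
    show "integrable (lborel \<Otimes>\<^sub>M lborel) (\<lambda>(z, y). ?a z * ?b y)"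
      by (intro integrable_pair_mult integrable_mult_right integrable_comp_moment)
    have c: "continuous_on UNIV K1" "continuous_on UNIV K2" "continuous_on UNIV f"
      using smooth_continuous[OF OM_smooth[OF K1], of "[]"] smooth_continuous[OF OM_smooth[OF K2], of "[]"]
        smooth_continuous[OF OM_smooth[OF f], of "[]"] by simp_all
    have "continuous_on UNIV (case_prod ?F)"
      unfolding case_prod_unfold
      by (intro continuous_intros continuous_on_compose2[OF c(1)] continuous_on_compose2[OF c(2)]
          continuous_on_compose2[OF c(3)]) auto
    then show "case_prod ?F \<in> borel_measurable (lborel \<Otimes>\<^sub>M lborel)"
      by (simp add: lborel_prod borel_measurable_continuous_onI)
    have "norm (?F z y) \<le> ?a z * ?b y" for z y
    proof -
      have aux: "M * (1 + norm (v, w)) ^ q \<le> M * ((1 + norm v) ^ q * (1 + norm w) ^ q)"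
        if "0 \<le> M" for M q and v w :: 'a
        unfolding power_mult_distrib[symmetric] using that
        by (intro mult_left_mono power_mono one_plus_norm_Pair_le) auto
      have "norm (?F z y) = norm (K2 (x, z)) * ?e z * (norm (K1 (z, y)) * norm (f y) * ?e y)"
        by (simp add: norm_mult)
      also have "\<dots> \<le> M2 * ((1 + norm x) ^ q2 * (1 + norm z) ^ q2) * ?e z
          * (M1 * ((1 + norm z) ^ q1 * (1 + norm y) ^ q1) * (S * (1 + norm y) ^ r) * ?e y)"
        using M1(1) M2(1) S(1)
        by (intro mult_mono order_trans[OF M1(2) aux] order_trans[OF M2(2) aux] S(2)) auto
      also have "\<dots> = ?a z * ?b y"
        by (simp add: power_add mult_ac)
      finally show ?thesis .
    qed
    then show "AE p in lborel \<Otimes>\<^sub>M lborel. norm (case_prod ?F p) \<le> norm (case p of (z, y) \<Rightarrow> ?a z * ?b y)"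
      by (auto intro!: AE_I2 intro: order_trans[OF _ abs_ge_self])
  qed
  have "(\<integral>y. ?F z y \<partial>lborel) = K2 (x, z) * of_real (?e z) * kernel_op \<epsilon> K1 f z" for z
    unfolding kernel_op_def by (rule integral_mult_right_zero)
  then have "kernel_op \<epsilon> K2 (kernel_op \<epsilon> K1 f) x = (\<integral>z. (\<integral>y. ?F z y \<partial>lborel) \<partial>lborel)"
    unfolding kernel_op_def[of \<epsilon> K2] by (simp add: mult_ac)
  also have "\<dots> = (\<integral>y. (\<integral>z. ?F z y \<partial>lborel) \<partial>lborel)"
    using lborel_pair.Fubini_integral[OF pair] by simp
  also have "\<dots> = kernel_op \<epsilon> (kernel_comp \<epsilon> K2 K1) f x"
  proof -
    have "?F z y = K2 (x, z) * K1 (z, y) * of_real (?e z) * (f y * of_real (?e y))" for z y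
      by (simp add: mult_ac)
    then have "(\<integral>z. ?F z y \<partial>lborel) = kernel_comp \<epsilon> K2 K1 (x, y) * (f y * of_real (?e y))" for y
      unfolding kernel_comp_def by (simp only: integral_mult_left_zero prod.case)
    then show ?thesis
      unfolding kernel_op_def[of \<epsilon> "kernel_comp \<epsilon> K2 K1"] by (simp add: mult.assoc)
  qed
  finally show "kernel_op \<epsilon> K2 (kernel_op \<epsilon> K1 f) x = kernel_op \<epsilon> (kernel_comp \<epsilon> K2 K1) f x" .
qed

end

lemma kernel_comp_E_tau:
  fixes K1 K2 :: "real \<Rightarrow> 'a::euclidean_space \<times> 'a \<Rightarrow> complex"
  assumes K1: "K1 \<in> E_tau" and K2: "K2 \<in> E_tau"
  shows "(\<lambda>\<epsilon>. kernel_comp \<epsilon> (K2 \<epsilon>) (K1 \<epsilon>)) \<in> E_tau"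
proof (rule E_tau_I)
  show "kernel_comp \<epsilon> (K2 \<epsilon>) (K1 \<epsilon>) \<in> OM" if "\<epsilon> \<in> {0<..1}" for \<epsilon>
    using that K1 K2 by (intro kernel_comp_OM) (auto simp: E_tau_OM)
  fix l
  obtain q1 m1 C1 where C1: "0 \<le> C1" and K1b: "\<forall>\<^sub>F \<epsilon> in at_right 0. \<forall>bs\<in>indices l. \<forall>p.
      norm (iter_partial bs (K1 \<epsilon>) p) \<le> C1 * (1 / \<epsilon>) ^ m1 * (1 + norm p) ^ q1"
    using E_tau_bound[OF K1, of l] by blast
  obtain q2 m2 C2 where C2: "0 \<le> C2" and K2b: "\<forall>\<^sub>F \<epsilon> in at_right 0. \<forall>bs\<in>indices l. \<forall>p.
      norm (iter_partial bs (K2 \<epsilon>) p) \<le> C2 * (1 / \<epsilon>) ^ m2 * (1 + norm p) ^ q2"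
    using E_tau_bound[OF K2, of l] by blast
  obtain D and N :: nat where D: "0 \<le> D" and J: "\<And>\<eta>. \<eta> \<in> {0<..1} \<Longrightarrow>
      (\<integral>y. (1 + norm (y::'a)) ^ (q1 + q2) * exp (- \<eta> * (norm y)\<^sup>2) \<partial>lborel) \<le> D * (1 / \<eta>) ^ N"
    using gauss_moment_bound[where 'a = 'a, of "q1 + q2"] by blast
  have "\<forall>\<^sub>F \<epsilon> in at_right 0. \<forall>bs\<in>indices l. \<forall>p. norm (iter_partial bs (kernel_comp \<epsilon> (K2 \<epsilon>) (K1 \<epsilon>)) p)
      \<le> (C1 * C2 * D) * (1 / \<epsilon>) ^ (m1 + m2 + N) * (1 + norm p) ^ (q1 + q2)"
    using K1b K2b at_right_0_in_unit
  proof eventually_elim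
    case (elim \<epsilon>)
    let ?J = "\<integral>y. (1 + norm (y::'a)) ^ (q1 + q2) * exp (- \<epsilon> * (norm y)\<^sup>2) \<partial>lborel"
    show ?case
    proof (intro ballI allI)
      fix bs :: "('a \<times> 'a) list" and p
      assume bs: "bs \<in> indices l"
      have "norm (iter_partial bs (kernel_comp \<epsilon> (K2 \<epsilon>) (K1 \<epsilon>)) p)
          \<le> (C1 * (1 / \<epsilon>) ^ m1) * (C2 * (1 / \<epsilon>) ^ m2) * (1 + norm p) ^ (q1 + q2) * ?J"
        using elim C1 C2 bs K1 K2
        by (intro norm_iter_partial_kernel_comp_le[where l = l]) (auto simp: E_tau_OM)
      also have "\<dots> \<le> (C1 * (1 / \<epsilon>) ^ m1) * (C2 * (1 / \<epsilon>) ^ m2) * (1 + norm p) ^ (q1 + q2) * (D * (1 / \<epsilon>) ^ N)"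
        using elim(3) C1 C2 by (intro mult_left_mono J) auto
      finally show "norm (iter_partial bs (kernel_comp \<epsilon> (K2 \<epsilon>) (K1 \<epsilon>)) p)
          \<le> (C1 * C2 * D) * (1 / \<epsilon>) ^ (m1 + m2 + N) * (1 + norm p) ^ (q1 + q2)"
        by (simp add: power_add mult_ac)
    qed
  qed
  then show "\<exists>q m. \<exists>C\<ge>0. \<forall>\<^sub>F \<epsilon> in at_right 0. \<forall>bs\<in>indices l. \<forall>p.
      norm (iter_partial bs (kernel_comp \<epsilon> (K2 \<epsilon>) (K1 \<epsilon>)) p) \<le> C * (1 / \<epsilon>) ^ m * (1 + norm p) ^ q"
    using C1 C2 D
    by (intro exI[of _ "q1 + q2"] exI[of _ "m1 + m2 + N"] exI[of _ "C1 * C2 * D"]) simp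
qed


section \<open>Damping by a flat Gaussian\<close>

lemma OM_mult:
  assumes "f \<in> OM" "g \<in> OM"
  shows "(\<lambda>x. f x * g x) \<in> OM"
proof (rule OM_I)
  show "(\<lambda>x. f x * g x) \<in> smooth"
    using assms by (intro smooth_mult OM_smooth)
  fix l
  obtain q :: nat and M where M: "0 \<le> M"
      "\<And>bs x. bs \<in> indices l \<Longrightarrow> norm (iter_partial bs f x) \<le> M * (1 + norm x) ^ q"
    using OM_bound[OF assms(1), of l] by blast
  obtain r :: nat and N where N: "0 \<le> N"
      "\<And>bs x. bs \<in> indices l \<Longrightarrow> norm (iter_partial bs g x) \<le> N * (1 + norm x) ^ r"
    using OM_bound[OF assms(2), of l] by blast
  have "norm (iter_partial bs (\<lambda>x. f x * g x) x) \<le> (2 ^ l * M * N) * (1 + norm x) ^ (q + r)"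
    if "bs \<in> indices l" for bs x
    using norm_iter_partial_mult_le[OF OM_smooth[OF assms(1)] OM_smooth[OF assms(2)] that M(2) N(2)]
    by (simp add: power_add mult_ac)
  then show "\<exists>q::nat. \<exists>M\<ge>0. \<forall>bs\<in>indices l. \<forall>x. norm (iter_partial bs (\<lambda>x. f x * g x) x) \<le> M * (1 + norm x) ^ q"
    using M(1) N(1) by (intro exI[of _ "q + r"] exI[of _ "2 ^ l * M * N"]) simp
qed

lemma one_minus_gauss_smooth: "(\<lambda>x. 1 - gauss \<delta> x) \<in> smooth"
  using smooth_add[OF const_smooth[of 1] smooth_cmult[OF gauss_smooth[of \<delta>], of "-1"]] by simp

lemma one_minus_gauss_bound:
  "\<exists>C\<ge>0. \<forall>\<delta>\<in>{0..1}. \<forall>bs\<in>indices l. \<forall>x::'a::euclidean_space.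
     norm (iter_partial bs (\<lambda>x. 1 - gauss \<delta> x) x) \<le> C * \<delta> * (1 + norm x) ^ (l + 2)"
proof -
  obtain C where C: "0 \<le> C" and le: "\<And>\<delta> bs x. \<delta> \<in> {0..1} \<Longrightarrow> bs \<in> indices l \<Longrightarrow>
     norm (iter_partial bs (gauss \<delta>) (x::'a))
       \<le> C * (if bs = [] then 1 else \<delta>) * (1 + norm x) ^ l * exp (- \<delta> * (norm x)\<^sup>2)"
    using iter_partial_gauss_bound[where 'a = 'a, of l] by blast
  have "norm (iter_partial bs (\<lambda>x. 1 - gauss \<delta> x) x) \<le> (1 + C) * \<delta> * (1 + norm x) ^ (l + 2)"
    if \<delta>: "\<delta> \<in> {0..1}" and bs: "bs \<in> indices l" for \<delta> bs and x :: 'a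
  proof (cases bs)
    case Nil
    have "1 - gauss \<delta> x = of_real (1 - exp (- \<delta> * (norm x)\<^sup>2))"
      by (simp add: gauss_def)
    then have "norm (1 - gauss \<delta> x) = 1 - exp (- \<delta> * (norm x)\<^sup>2)"
      using \<delta> by (simp only: norm_of_real) simp
    also have "\<dots> \<le> \<delta> * (norm x)\<^sup>2"
      using exp_ge_add_one_self[of "- \<delta> * (norm x)\<^sup>2"] by simp
    also have "\<dots> \<le> \<delta> * (1 + norm x) ^ 2"
      using \<delta> by (intro mult_left_mono power_mono) auto
    also have "\<dots> \<le> \<delta> * (1 + norm x) ^ (l + 2)"
      using \<delta> by (intro mult_left_mono power_increasing) auto
    also have "\<dots> \<le> (1 + C) * (\<delta> * (1 + norm x) ^ (l + 2))"
      using \<delta> C mult_right_mono[of 1 "1 + C" "\<delta> * (1 + norm x) ^ (l + 2)"] by simp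
    finally show ?thesis
      using Nil by (simp add: mult.assoc)
  next
    case (Cons a as)
    have zero: "iter_partial bs (\<lambda>x::'a. 1) = (\<lambda>x. 0)" if "bs \<noteq> []" for bs
      using that
    proof (induction bs)
      case (Cons b bs)
      then show ?case
        by (cases bs) (simp_all add: partial_deriv_def)
    qed simp
    have B: "set bs \<subseteq> Basis"
      using bs by (simp add: indices_def)
    have "(\<lambda>x::'a. 1 - gauss \<delta> x) = (\<lambda>x. 1 + (-1) * gauss \<delta> x)"
      by simp
    then have "iter_partial bs (\<lambda>x. 1 - gauss \<delta> x) x
        = iter_partial bs (\<lambda>x. 1) x + (-1) * iter_partial bs (gauss \<delta>) x"
      by (simp only: iter_partial_add[OF const_smooth smooth_cmult[OF gauss_smooth] B]
          iter_partial_cmult[OF gauss_smooth B])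
    then have "norm (iter_partial bs (\<lambda>x. 1 - gauss \<delta> x) x) = norm (iter_partial bs (gauss \<delta>) x)"
      using zero[of bs] Cons by (simp del: iter_partial.simps)
    then have "norm (iter_partial bs (\<lambda>x. 1 - gauss \<delta> x) x) \<le> C * \<delta> * (1 + norm x) ^ l * exp (- \<delta> * (norm x)\<^sup>2)"
      using le[OF \<delta> bs, of x] Cons by (simp del: iter_partial.simps)
    also have "\<dots> \<le> (1 + C) * \<delta> * (1 + norm x) ^ (l + 2) * 1"
      using \<delta> C by (intro mult_mono power_increasing) auto
    finally show ?thesis
      by simp
  qed
  then show ?thesis
    using C by (intro exI[of _ "1 + C"]) simp
qed

lemma one_minus_gauss_OM:
  assumes "\<delta> \<in> {0..1}"
  shows "(\<lambda>x::'a::euclidean_space. 1 - gauss \<delta> x) \<in> OM"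
proof (rule OM_I[OF one_minus_gauss_smooth])
  fix l
  obtain C where "0 \<le> C" "\<And>bs x. bs \<in> indices l \<Longrightarrow>
     norm (iter_partial bs (\<lambda>x. 1 - gauss \<delta> x) (x::'a)) \<le> C * \<delta> * (1 + norm x) ^ (l + 2)"
    using one_minus_gauss_bound[where 'a = 'a, of l] assms by blast
  then show "\<exists>q::nat. \<exists>M\<ge>0. \<forall>bs\<in>indices l. \<forall>x::'a.
      norm (iter_partial bs (\<lambda>x. 1 - gauss \<delta> x) x) \<le> M * (1 + norm x) ^ q"
    using assms by (intro exI[of _ "l + 2"] exI[of _ "C * \<delta>"]) simp
qed

lemma gauss_OM:
  assumes "0 < \<delta>" "\<delta> \<le> 1"
  shows "(gauss \<delta> :: 'a::euclidean_space \<Rightarrow> complex) \<in> OM"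
proof -
  have "mu (int 0) l (gauss \<delta> :: 'a \<Rightarrow> complex) < \<infinity>" for l
    using gauss_schwartz[OF assms, where 'a = 'a] unfolding schwartz_def by blast
  then have "mu (- int 0) l (gauss \<delta> :: 'a \<Rightarrow> complex) < \<infinity>" for l
    by simp
  then show ?thesis
    using gauss_smooth unfolding OM_def by blast
qed

text \<open>
  The rate \<open>exp (- 1 / \<epsilon>)\<close> is positive for every \<open>\<epsilon>\<close>, so that damping enforces decay, and smaller than
  every power of \<open>\<epsilon>\<close>, so that it does not change the generalised function.
\<close>

definition damp :: "real \<Rightarrow> 'a::euclidean_space \<Rightarrow> complex" where
  "damp \<epsilon> = gauss (exp (- 1 / \<epsilon>))"

lemma damp_rate: "\<epsilon> \<in> {0<..1} \<Longrightarrow> exp (- 1 / \<epsilon>) \<in> {0<..1}" for \<epsilon> :: real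
  by auto

lemma damp_OM: "\<epsilon> \<in> {0<..1} \<Longrightarrow> damp \<epsilon> \<in> OM"
  unfolding damp_def using damp_rate[of \<epsilon>] by (intro gauss_OM) auto

lemma damp_rate_le:
  assumes "0 < (\<epsilon>::real)"
  shows "exp (- 1 / \<epsilon>) \<le> fact N * \<epsilon> ^ N"
proof -
  have "(1 / \<epsilon>) ^ N \<le> fact N * exp (1 / \<epsilon>)"
    using assms by (intro power_le_exp) simp
  then show ?thesis
    using assms by (simp add: exp_minus field_simps power_one_over)
qed

lemma N_tau_I:
  assumes "\<And>\<epsilon>. \<epsilon> \<in> {0<..1} \<Longrightarrow> f \<epsilon> \<in> OM"
    and "\<And>l. \<exists>q. \<forall>p. \<exists>C\<ge>0. \<forall>\<^sub>F \<epsilon> in at_right 0. \<forall>bs\<in>indices l. \<forall>x.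
      norm (iter_partial bs (f \<epsilon>) x) \<le> C * \<epsilon> ^ p * (1 + norm x) ^ q"
  shows "f \<in> N_tau"
proof -
  have "\<exists>q::nat. \<forall>p::nat. \<exists>C::real. \<forall>\<^sub>F \<epsilon> in at_right 0. mu (- int q) l (f \<epsilon>) \<le> ennreal (C * \<epsilon> ^ p)" for l
  proof -
    obtain q where q: "\<And>p. \<exists>C\<ge>0. \<forall>\<^sub>F \<epsilon> in at_right 0. \<forall>bs\<in>indices l. \<forall>x.
      norm (iter_partial bs (f \<epsilon>) x) \<le> C * \<epsilon> ^ p * (1 + norm x) ^ q"
      using assms(2)[of l] by blast
    have "\<exists>C. \<forall>\<^sub>F \<epsilon> in at_right 0. mu (- int q) l (f \<epsilon>) \<le> ennreal (C * \<epsilon> ^ p)" for p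
    proof -
      obtain C where C: "0 \<le> C" and f: "\<forall>\<^sub>F \<epsilon> in at_right 0. \<forall>bs\<in>indices l. \<forall>x.
        norm (iter_partial bs (f \<epsilon>) x) \<le> C * \<epsilon> ^ p * (1 + norm x) ^ q"
        using q[of p] by blast
      have "\<forall>\<^sub>F \<epsilon> in at_right 0. mu (- int q) l (f \<epsilon>) \<le> ennreal (C * \<epsilon> ^ p)"
        using f at_right_0_in_unit
      proof eventually_elim
        case (elim \<epsilon>)
        then have "0 \<le> C * \<epsilon> ^ p"
          using C by simp
        then show ?case
          using elim(1) by (simp only: mu_le_ennreal_iff)
      qed
      then show ?thesis by blast
    qed
    then show ?thesis by blast
  qed
  with assms(1) show ?thesis
    by (simp add: N_tau_def)
qed

text \<open>
  Near the origin the damping factor is almost \<open>1\<close>; far away the loss is paid for by raising the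
  polynomial order \<open>q\<close> by \<open>l + 2\<close>, which \<open>N_tau\<close> permits.
\<close>

lemma undamped_part_N_tau:
  fixes u :: "real \<Rightarrow> 'a::euclidean_space \<Rightarrow> complex"
  assumes u: "u \<in> E_tau"
  shows "(\<lambda>\<epsilon> x. (1 - damp \<epsilon> x) * u \<epsilon> x) \<in> N_tau"
proof (rule N_tau_I)
  show "(\<lambda>x. (1 - damp \<epsilon> x) * u \<epsilon> x) \<in> OM" if "\<epsilon> \<in> {0<..1}" for \<epsilon>
    unfolding damp_def using that u damp_rate[OF that]
    by (intro OM_mult one_minus_gauss_OM) (auto simp: E_tau_OM)
  fix l
  obtain q m C where C: "0 \<le> C" and ub: "\<forall>\<^sub>F \<epsilon> in at_right 0. \<forall>bs\<in>indices l. \<forall>x.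
      norm (iter_partial bs (u \<epsilon>) x) \<le> C * (1 / \<epsilon>) ^ m * (1 + norm x) ^ q"
    using E_tau_bound[OF u, of l] by blast
  obtain D where D: "0 \<le> D" and gb: "\<And>\<delta> bs x. \<delta> \<in> {0..1} \<Longrightarrow> bs \<in> indices l \<Longrightarrow>
     norm (iter_partial bs (\<lambda>x. 1 - gauss \<delta> x) (x::'a)) \<le> D * \<delta> * (1 + norm x) ^ (l + 2)"
    using one_minus_gauss_bound[where 'a = 'a, of l] by blast
  have "\<forall>\<^sub>F \<epsilon> in at_right 0. \<forall>bs\<in>indices l. \<forall>x. norm (iter_partial bs (\<lambda>x. (1 - damp \<epsilon> x) * u \<epsilon> x) x)
      \<le> (2 ^ l * D * C * fact (p + m)) * \<epsilon> ^ p * (1 + norm x) ^ (l + 2 + q)" for p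
    using ub at_right_0_in_unit
  proof eventually_elim
    case (elim \<epsilon>)
    let ?\<delta> = "exp (- 1 / \<epsilon>)"
    have \<delta>: "?\<delta> \<in> {0..1}"
      using damp_rate[OF elim(2)] by auto
    have "?\<delta> * (1 / \<epsilon>) ^ m \<le> (fact (p + m) * \<epsilon> ^ (p + m)) * (1 / \<epsilon>) ^ m"
      using elim(2) by (intro mult_right_mono damp_rate_le) auto
    also have "\<dots> = fact (p + m) * \<epsilon> ^ p"
      using elim(2) by (simp add: power_add power_one_over)
    finally have rate: "?\<delta> * (1 / \<epsilon>) ^ m \<le> fact (p + m) * \<epsilon> ^ p" .
    show ?case
    proof (intro ballI allI)
      fix bs :: "'a list" and x
      assume bs: "bs \<in> indices l"
      have "norm (iter_partial bs (\<lambda>x. (1 - damp \<epsilon> x) * u \<epsilon> x) x)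
          \<le> 2 ^ l * ((D * ?\<delta> * (1 + norm x) ^ (l + 2)) * (C * (1 / \<epsilon>) ^ m * (1 + norm x) ^ q))"
        unfolding damp_def
      proof (rule norm_iter_partial_mult_le[OF one_minus_gauss_smooth _ bs gb[OF \<delta>]])
        show "u \<epsilon> \<in> smooth"
          using elim(2) u by (intro OM_smooth E_tau_OM)
      qed (use elim(1) in auto)
      also have "\<dots> = (2 ^ l * D * C * (1 + norm x) ^ (l + 2 + q)) * (?\<delta> * (1 / \<epsilon>) ^ m)"
        by (simp only: power_add mult_ac)
      also have "\<dots> \<le> (2 ^ l * D * C * (1 + norm x) ^ (l + 2 + q)) * (fact (p + m) * \<epsilon> ^ p)"
        using C D rate by (intro mult_left_mono) auto
      finally show "norm (iter_partial bs (\<lambda>x. (1 - damp \<epsilon> x) * u \<epsilon> x) x)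
          \<le> (2 ^ l * D * C * fact (p + m)) * \<epsilon> ^ p * (1 + norm x) ^ (l + 2 + q)"
        by (simp only: mult_ac)
    qed
  qed
  then have "\<forall>p. \<exists>C\<ge>0. \<forall>\<^sub>F \<epsilon> in at_right 0. \<forall>bs\<in>indices l. \<forall>x.
      norm (iter_partial bs (\<lambda>x. (1 - damp \<epsilon> x) * u \<epsilon> x) x) \<le> C * \<epsilon> ^ p * (1 + norm x) ^ (l + 2 + q)"
    using C D by (intro allI exI[of _ "2 ^ l * D * C * fact (_ + m)"] conjI) auto
  then show "\<exists>q. \<forall>p. \<exists>C\<ge>0. \<forall>\<^sub>F \<epsilon> in at_right 0. \<forall>bs\<in>indices l. \<forall>x.
      norm (iter_partial bs (\<lambda>x. (1 - damp \<epsilon> x) * u \<epsilon> x) x) \<le> C * \<epsilon> ^ p * (1 + norm x) ^ q"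
    by blast
qed

lemma N_tau_subset_E_tau: "N_tau \<subseteq> E_tau"
proof
  fix f :: "real \<Rightarrow> 'a \<Rightarrow> complex"
  assume f: "f \<in> N_tau"
  have "\<exists>(q::nat) (m::nat). \<exists>C::real. \<forall>\<^sub>F \<epsilon> in at_right 0.
      mu (- int q) l (f \<epsilon>) \<le> ennreal (C * \<epsilon> powi (- int m))" for l
  proof -
    obtain q C where "\<forall>\<^sub>F \<epsilon> in at_right 0. mu (- int q) l (f \<epsilon>) \<le> ennreal (C * \<epsilon> ^ 0)"
      using N_tau_bound[OF f, of l] by blast
    then show ?thesis
      by (intro exI[of _ q] exI[of _ 0] exI[of _ C]) simp
  qed
  with f show "f \<in> E_tau"
    by (simp add: E_tau_def N_tau_def)
qed

lemma tau_rel_damp: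
  assumes u: "u \<in> E_tau"
  shows "tau_rel u (\<lambda>\<epsilon> x. damp \<epsilon> x * u \<epsilon> x)"
proof -
  note N = undamped_part_N_tau[OF u]
  have "(\<lambda>\<epsilon> x. u \<epsilon> x + (-1) * ((1 - damp \<epsilon> x) * u \<epsilon> x)) \<in> E_tau"
    using N N_tau_subset_E_tau by (intro E_tau_add E_tau_cmult u) auto
  moreover have "(\<lambda>\<epsilon> x. u \<epsilon> x + (-1) * ((1 - damp \<epsilon> x) * u \<epsilon> x)) = (\<lambda>\<epsilon> x. damp \<epsilon> x * u \<epsilon> x)"
    by (simp add: fun_eq_iff left_diff_distrib)
  moreover have "(\<lambda>\<epsilon> x. (1 - damp \<epsilon> x) * u \<epsilon> x) = (\<lambda>\<epsilon> x. u \<epsilon> x - damp \<epsilon> x * u \<epsilon> x)"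
    by (simp add: fun_eq_iff left_diff_distrib)
  ultimately show ?thesis
    using u N by (simp only: tau_rel_def)
qed


section \<open>Continuity and moderate growth of damped kernel operators\<close>

text \<open>
  The constant \<open>D\<close> depends on the order \<open>l\<close> only. The bound is used twice: for small \<open>\<epsilon>\<close>, where the last
  exponential is estimated by \<open>1\<close> and \<open>M\<close> is moderate with \<open>q\<close> fixed, and for a single \<open>\<epsilon>\<close>, where that
  exponential absorbs the polynomial whatever \<open>q\<close> is.
\<close>

lemma norm_iter_partial_damped_kernel_op_le:
  "\<exists>D\<ge>0. \<forall>K\<in>OM. \<forall>f\<in>OM. \<forall>\<epsilon>\<in>{0<..1}. \<forall>\<eta>\<in>{0<..1}. \<forall>S M q.
    0 \<le> M \<longrightarrow> (\<forall>bs\<in>indices l. \<forall>p. norm (iter_partial bs K p) \<le> M * (1 + norm p) ^ q) \<longrightarrow>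
    (\<forall>y::'a::euclidean_space. norm (f y) * exp (- \<epsilon> * (norm y)\<^sup>2) \<le> S * exp (- \<eta> * (norm y)\<^sup>2)) \<longrightarrow>
    (\<forall>bs\<in>indices l. \<forall>x. norm (iter_partial bs (\<lambda>x. damp \<epsilon> x * kernel_op \<epsilon> K f x) x)
      \<le> D * M * (\<integral>y. (1 + norm (y::'a)) ^ q * exp (- \<eta> * (norm y)\<^sup>2) \<partial>lborel)
        * ((1 + norm x) ^ (l + q) * exp (- exp (- 1 / \<epsilon>) * (norm x)\<^sup>2)) * S)"
proof -
  obtain C where C: "0 \<le> C" and gb: "\<And>\<delta> bs x. \<delta> \<in> {0..1} \<Longrightarrow> bs \<in> indices l \<Longrightarrow>
     norm (iter_partial bs (gauss \<delta>) (x::'a))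
       \<le> C * (if bs = [] then 1 else \<delta>) * (1 + norm x) ^ l * exp (- \<delta> * (norm x)\<^sup>2)"
    using iter_partial_gauss_bound[where 'a = 'a, of l] by blast
  show ?thesis
  proof (intro exI[of _ "2 ^ l * C"] conjI ballI allI impI)
    fix K :: "'a \<times> 'a \<Rightarrow> complex" and f :: "'a \<Rightarrow> complex" and \<epsilon> \<eta> S M :: real
      and q and bs :: "'a list" and x
    assume K: "K \<in> OM" and f: "f \<in> OM" and \<epsilon>: "\<epsilon> \<in> {0<..1}" and \<eta>: "\<eta> \<in> {0<..1}" and M: "0 \<le> M"
      and Kb: "\<forall>bs\<in>indices l. \<forall>p. norm (iter_partial bs K p) \<le> M * (1 + norm p) ^ q"
      and fb: "\<forall>y::'a. norm (f y) * exp (- \<epsilon> * (norm y)\<^sup>2) \<le> S * exp (- \<eta> * (norm y)\<^sup>2)"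
      and bs: "bs \<in> indices l"
    let ?\<delta> = "exp (- 1 / \<epsilon>)"
    let ?J = "\<integral>y. (1 + norm (y::'a)) ^ q * exp (- \<eta> * (norm y)\<^sup>2) \<partial>lborel"
    have \<delta>: "?\<delta> \<in> {0..1}"
      using damp_rate[OF \<epsilon>] by auto
    have fb': "norm (f y) * exp (- \<epsilon> * (norm y)\<^sup>2) \<le> S * (1 + norm y) ^ 0 * exp (- \<eta> * (norm y)\<^sup>2)" for y
      using fb by simp
    have "norm (iter_partial bs (\<lambda>x. damp \<epsilon> x * kernel_op \<epsilon> K f x) x)
        \<le> 2 ^ l * ((C * ((1 + norm x) ^ l * exp (- ?\<delta> * (norm x)\<^sup>2))) * (M * S * (1 + norm x) ^ q * ?J))"
    proof (rule norm_iter_partial_mult_le[OF _ _ bs])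
      show "damp \<epsilon> \<in> smooth" "kernel_op \<epsilon> K f \<in> smooth"
        using damp_OM[OF \<epsilon>] kernel_op_OM[OF K f \<epsilon>] by (auto intro: OM_smooth)
      fix cs :: "'a list" assume cs: "cs \<in> indices l"
      have "C * (if cs = [] then 1 else ?\<delta>) * ((1 + norm x) ^ l * exp (- ?\<delta> * (norm x)\<^sup>2))
          \<le> C * 1 * ((1 + norm x) ^ l * exp (- ?\<delta> * (norm x)\<^sup>2))"
        using C \<delta> by (intro mult_right_mono mult_left_mono) auto
      then show "norm (iter_partial cs (damp \<epsilon>) x) \<le> C * ((1 + norm x) ^ l * exp (- ?\<delta> * (norm x)\<^sup>2))"
        unfolding damp_def mult_1_right by (rule order_trans[OF gb[OF \<delta> cs, unfolded mult.assoc[of _ "_ ^ l"]]])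
      show "norm (iter_partial cs (kernel_op \<epsilon> K f) x) \<le> M * S * (1 + norm x) ^ q * ?J"
        using norm_iter_partial_kernel_op_le[OF K OM_measurable[OF f] fb' _ _ cs M, of q x] \<eta> Kb by simp
    qed
    then show "norm (iter_partial bs (\<lambda>x. damp \<epsilon> x * kernel_op \<epsilon> K f x) x)
        \<le> 2 ^ l * C * M * ?J * ((1 + norm x) ^ (l + q) * exp (- ?\<delta> * (norm x)\<^sup>2)) * S"
      by (simp only: power_add mult_ac)
  qed (use C in simp)
qed

lemma damped_kernel_op_bounded:
  fixes K :: "'a::euclidean_space \<times> 'a \<Rightarrow> complex"
  assumes K: "K \<in> OM" and \<epsilon>: "\<epsilon> \<in> {0<..1}" and \<eta>: "\<eta> \<in> {0<..1}"
  shows "\<exists>c>0. \<forall>f\<in>OM. \<forall>S. (\<forall>y. norm (f y) * exp (- \<epsilon> * (norm y)\<^sup>2) \<le> S * exp (- \<eta> * (norm y)\<^sup>2)) \<longrightarrow>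
    (\<forall>bs\<in>indices l. \<forall>x. norm (iter_partial bs (\<lambda>x. damp \<epsilon> x * kernel_op \<epsilon> K f x) x) \<le> c * S)"
proof -
  obtain q :: nat and M where M: "0 \<le> M"
      "\<forall>bs\<in>indices l. \<forall>p. norm (iter_partial bs K p) \<le> M * (1 + norm p) ^ q"
    using OM_bound[OF K, of l] by blast
  let ?\<delta> = "exp (- 1 / \<epsilon>)"
  let ?J = "\<integral>y. (1 + norm (y::'a)) ^ q * exp (- \<eta> * (norm y)\<^sup>2) \<partial>lborel"
  let ?g = "(2 ^ (l + q) * exp 1 * fact (l + q + 0)) * (1 / ?\<delta>) ^ (l + q + 0)"
  obtain D where D: "0 \<le> D" and le: "\<forall>K\<in>OM. \<forall>f\<in>OM. \<forall>\<epsilon>\<in>{0<..1}. \<forall>\<eta>\<in>{0<..1}. \<forall>S M q.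
    0 \<le> M \<longrightarrow> (\<forall>bs\<in>indices l. \<forall>p. norm (iter_partial bs K p) \<le> M * (1 + norm p) ^ q) \<longrightarrow>
    (\<forall>y::'a. norm (f y) * exp (- \<epsilon> * (norm y)\<^sup>2) \<le> S * exp (- \<eta> * (norm y)\<^sup>2)) \<longrightarrow>
    (\<forall>bs\<in>indices l. \<forall>x. norm (iter_partial bs (\<lambda>x. damp \<epsilon> x * kernel_op \<epsilon> K f x) x)
      \<le> D * M * (\<integral>y. (1 + norm (y::'a)) ^ q * exp (- \<eta> * (norm y)\<^sup>2) \<partial>lborel)
        * ((1 + norm x) ^ (l + q) * exp (- exp (- 1 / \<epsilon>) * (norm x)\<^sup>2)) * S)"
    using norm_iter_partial_damped_kernel_op_le[where 'a = 'a, of l] by (elim exE conjE)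
  have J: "0 \<le> ?J"
    by (intro Bochner_Integration.integral_nonneg) simp
  have "norm (iter_partial bs (\<lambda>x. damp \<epsilon> x * kernel_op \<epsilon> K f x) x) \<le> (D * M * ?J * ?g + 1) * S"
    if f: "f \<in> OM" and fb: "\<forall>y. norm (f y) * exp (- \<epsilon> * (norm y)\<^sup>2) \<le> S * exp (- \<eta> * (norm y)\<^sup>2)"
      and bs: "bs \<in> indices l" for f S bs x
  proof -
    have S: "0 \<le> S"
      using spec[OF fb, of 0] order_trans[OF norm_ge_zero[of "f 0"]] by simp
    have "norm (iter_partial bs (\<lambda>x. damp \<epsilon> x * kernel_op \<epsilon> K f x) x)
        \<le> D * M * ?J * ((1 + norm x) ^ (l + q) * exp (- ?\<delta> * (norm x)\<^sup>2)) * S"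
      using le K f \<epsilon> \<eta> M fb bs by blast
    moreover have "(1 + norm x) ^ (l + q) * exp (- ?\<delta> * (norm x)\<^sup>2) \<le> ?g"
      using power_mult_gauss_le[of ?\<delta> "norm x" "l + q" 0] damp_rate[OF \<epsilon>] by simp
    then have "D * M * ?J * ((1 + norm x) ^ (l + q) * exp (- ?\<delta> * (norm x)\<^sup>2)) * S \<le> D * M * ?J * ?g * S"
      using D M(1) J S by (intro mult_right_mono mult_left_mono mult_nonneg_nonneg)
    moreover have "D * M * ?J * ?g * S \<le> (D * M * ?J * ?g + 1) * S"
      using S by (simp only: distrib_right)
    ultimately show ?thesis
      by linarith
  qed
  moreover have "0 < D * M * ?J * ?g + 1"
    using D M(1) J \<epsilon> by (intro add_nonneg_pos mult_nonneg_nonneg) auto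
  ultimately show ?thesis
    by blast
qed

lemma OM_seminorm_le_iff: "OM_seminorm \<phi> bs f \<le> B \<longleftrightarrow> (\<forall>x. ennreal (norm (\<phi> x * iter_partial bs f x)) \<le> B)"
  by (auto simp: OM_seminorm_def SUP_le_iff)

lemma OM_seminorm_triangle:
  assumes "f \<in> OM" "g \<in> OM" "set bs \<subseteq> Basis"
  shows "OM_seminorm \<phi> bs (\<lambda>x. f x + g x) \<le> OM_seminorm \<phi> bs f + OM_seminorm \<phi> bs g"
  unfolding OM_seminorm_le_iff
proof
  fix x
  have "norm (\<phi> x * iter_partial bs (\<lambda>x. f x + g x) x)
      \<le> norm (\<phi> x * iter_partial bs f x) + norm (\<phi> x * iter_partial bs g x)"
    unfolding iter_partial_add[OF OM_smooth[OF assms(1)] OM_smooth[OF assms(2)] assms(3)] distrib_left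
    by (rule norm_triangle_ineq)
  from ennreal_leI[OF this] have "ennreal (norm (\<phi> x * iter_partial bs (\<lambda>x. f x + g x) x))
      \<le> ennreal (norm (\<phi> x * iter_partial bs f x)) + ennreal (norm (\<phi> x * iter_partial bs g x))"
    by (simp only: ennreal_plus norm_ge_zero)
  also have "\<dots> \<le> OM_seminorm \<phi> bs f + OM_seminorm \<phi> bs g"
    by (intro add_mono) (auto simp: OM_seminorm_def intro: SUP_upper)
  finally show "ennreal (norm (\<phi> x * iter_partial bs (\<lambda>x. f x + g x) x))
      \<le> OM_seminorm \<phi> bs f + OM_seminorm \<phi> bs g" .
qed

lemma OM_seminorm_zero: "OM_seminorm \<phi> bs (\<lambda>x. 0) = 0"
  by (simp add: OM_seminorm_def iter_partial_zero)

lemma OM_diff: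
  assumes "f \<in> OM" "g \<in> OM"
  shows "(\<lambda>x. f x - g x) \<in> OM"
  using OM_add[OF assms(1) OM_cmult[OF assms(2), of "-1"]] by simp

definition OM_ball :: "('a::euclidean_space \<Rightarrow> complex) \<Rightarrow> 'a list \<Rightarrow> ('a \<Rightarrow> complex) \<Rightarrow> real \<Rightarrow> ('a \<Rightarrow> complex) set" where
  "OM_ball \<phi> bs f r = {g \<in> OM. OM_seminorm \<phi> bs (\<lambda>x. g x - f x) < ennreal r}"

lemma OM_topology_eq: "OM_topology = topology_generated_by
    {OM_ball \<phi> bs f r | \<phi> bs f r. \<phi> \<in> schwartz \<and> set bs \<subseteq> Basis \<and> f \<in> OM \<and> 0 < r}"
  by (simp add: OM_topology_def OM_ball_def)

lemma openin_OM_ball: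
  assumes "\<phi> \<in> schwartz" "set bs \<subseteq> Basis" "f \<in> OM" "0 < r"
  shows "openin OM_topology (OM_ball \<phi> bs f r)"
  unfolding OM_topology_eq using assms by (intro topology_generated_by_Basis) blast

lemma centre_in_OM_ball: "f \<in> OM \<Longrightarrow> 0 < r \<Longrightarrow> f \<in> OM_ball \<phi> bs f r"
  by (simp add: OM_ball_def OM_seminorm_zero)

lemma topspace_OM_topology: "topspace OM_topology = (OM :: ('a::euclidean_space \<Rightarrow> complex) set)"
proof
  show "topspace OM_topology \<subseteq> (OM :: ('a \<Rightarrow> complex) set)"
    unfolding OM_topology_eq topology_generated_by_topspace by (auto simp: OM_ball_def)
  show "OM \<subseteq> topspace (OM_topology :: ('a \<Rightarrow> complex) topology)"
  proof
    fix f :: "'a \<Rightarrow> complex" assume f: "f \<in> OM"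
    have "openin OM_topology (OM_ball (gauss 1) [] f 1)"
      using f gauss_schwartz[of 1, where 'a = 'a] by (intro openin_OM_ball) auto
    then show "f \<in> topspace OM_topology"
      using centre_in_OM_ball[OF f, of 1 "gauss 1" "[]"] openin_subset by fastforce
  qed
qed

text \<open>
  The usual seminorm criterion. A single seminorm on the right suffices here, so that preimages of
  subbasic sets contain subbasic neighbourhoods of each of their points.
\<close>

lemma continuous_map_OM_I:
  fixes A :: "('a::euclidean_space \<Rightarrow> complex) \<Rightarrow> 'a \<Rightarrow> complex"
  assumes A: "\<And>f. f \<in> OM \<Longrightarrow> A f \<in> OM"
    and diff: "\<And>f g. f \<in> OM \<Longrightarrow> g \<in> OM \<Longrightarrow> A (\<lambda>x. f x - g x) = (\<lambda>x. A f x - A g x)"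
    and bounded: "\<And>\<phi> bs. \<phi> \<in> schwartz \<Longrightarrow> set bs \<subseteq> Basis \<Longrightarrow>
      \<exists>\<psi>\<in>schwartz. \<exists>cs. \<exists>C>0. set cs \<subseteq> Basis \<and>
        (\<forall>h\<in>OM. OM_seminorm \<phi> bs (A h) \<le> ennreal C * OM_seminorm \<psi> cs h)"
  shows "continuous_map OM_topology OM_topology A"
proof -
  have "openin OM_topology (A -` OM_ball \<phi> bs f r \<inter> OM)"
    if \<phi>: "\<phi> \<in> schwartz" and bs: "set bs \<subseteq> Basis" and f: "f \<in> OM" and r: "0 < r" for \<phi> bs f r
  proof (subst openin_subopen, intro ballI)
    fix g assume g: "g \<in> A -` OM_ball \<phi> bs f r \<inter> OM"
    then have gO: "g \<in> OM" and s: "OM_seminorm \<phi> bs (\<lambda>x. A g x - f x) < ennreal r"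
      by (auto simp: OM_ball_def)
    obtain \<psi> cs C where \<psi>: "\<psi> \<in> schwartz" "set cs \<subseteq> Basis" and C: "0 < C"
      and le: "\<And>h. h \<in> OM \<Longrightarrow> OM_seminorm \<phi> bs (A h) \<le> ennreal C * OM_seminorm \<psi> cs h"
      using bounded[OF \<phi> bs] by blast
    obtain t where t: "0 \<le> t" "OM_seminorm \<phi> bs (\<lambda>x. A g x - f x) = ennreal t"
      using s by (cases "OM_seminorm \<phi> bs (\<lambda>x. A g x - f x)") auto
    then have tr: "t < r"
      using s by (simp add: ennreal_less_iff)
    let ?U = "OM_ball \<psi> cs g ((r - t) / C)"
    have "?U \<subseteq> A -` OM_ball \<phi> bs f r \<inter> OM"
    proof
      fix h assume "h \<in> ?U"
      then have h: "h \<in> OM" "OM_seminorm \<psi> cs (\<lambda>x. h x - g x) < ennreal ((r - t) / C)"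
        by (auto simp: OM_ball_def)
      obtain k where k: "0 \<le> k" "OM_seminorm \<psi> cs (\<lambda>x. h x - g x) = ennreal k"
        using h(2) by (cases "OM_seminorm \<psi> cs (\<lambda>x. h x - g x)") auto
      then have kr: "C * k < r - t"
        using h(2) C by (simp add: ennreal_less_iff field_simps)
      have "OM_seminorm \<phi> bs (\<lambda>x. A h x - A g x) \<le> ennreal C * ennreal k"
        using le[OF OM_diff[OF h(1) gO]] unfolding diff[OF h(1) gO] k(2) .
      also have "\<dots> = ennreal (C * k)"
        using C k(1) by (simp add: ennreal_mult)
      finally have "OM_seminorm \<phi> bs (\<lambda>x. (A h x - A g x) + (A g x - f x)) \<le> ennreal (C * k) + ennreal t"
        using A h(1) gO f bs t(2)
        by (intro order_trans[OF OM_seminorm_triangle] add_mono OM_diff) auto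
      also have "\<dots> = ennreal (C * k + t)"
        using t(1) C k(1) by (simp add: ennreal_plus)
      also have "\<dots> < ennreal r"
        using kr r by (intro ennreal_lessI) auto
      finally show "h \<in> A -` OM_ball \<phi> bs f r \<inter> OM"
        using h(1) A by (simp add: OM_ball_def)
    qed
    moreover have "openin OM_topology ?U" "g \<in> ?U"
      using \<psi> gO tr C by (auto intro!: openin_OM_ball centre_in_OM_ball)
    ultimately show "\<exists>U. openin OM_topology U \<and> g \<in> U \<and> U \<subseteq> A -` OM_ball \<phi> bs f r \<inter> OM"
      by blast
  qed
  moreover have "A ` OM \<subseteq> \<Union> {OM_ball \<phi> bs f r | \<phi> bs f r. \<phi> \<in> schwartz \<and> set bs \<subseteq> Basis \<and> f \<in> OM \<and> 0 < r}"
    using A topspace_OM_topology[where 'a = 'a] unfolding OM_topology_eq topology_generated_by_topspace by blast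
  ultimately have "continuous_map OM_topology (topology_generated_by
      {OM_ball \<phi> bs f r | \<phi> bs f r. \<phi> \<in> schwartz \<and> set bs \<subseteq> Basis \<and> f \<in> OM \<and> 0 < r}) A"
    unfolding continuous_on_generated_topo_iff topspace_OM_topology by blast
  then show ?thesis
    by (simp only: OM_topology_eq[symmetric])
qed

lemma kernel_op_diff:
  assumes "K \<in> OM" "f \<in> OM" "g \<in> OM" "\<epsilon> \<in> {0<..1}"
  shows "kernel_op \<epsilon> K (\<lambda>y. f y - g y) = (\<lambda>x. kernel_op \<epsilon> K f x - kernel_op \<epsilon> K g x)"
  using kernel_op_add[OF assms(1,2) OM_cmult[OF assms(3), of "-1"] assms(4)] kernel_op_cmult[of \<epsilon> K "-1" g]
  by simp

lemma schwartz_bounded: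
  assumes "\<phi> \<in> schwartz"
  shows "\<exists>M>0. \<forall>x. norm (\<phi> x) \<le> M"
proof -
  have "mu (int 0) 0 \<phi> < \<infinity>"
    using assms by (simp only: schwartz_def mem_Collect_eq)
  then have "mu (- int 0) 0 \<phi> \<le> ennreal (enn2real (mu (int 0) 0 \<phi>))"
    by simp
  then have "\<forall>x. norm (\<phi> x) \<le> enn2real (mu (int 0) 0 \<phi>)"
    unfolding mu_le_ennreal_iff[OF enn2real_nonneg] by (auto simp: indices_def)
  then have "\<forall>x. norm (\<phi> x) \<le> enn2real (mu (int 0) 0 \<phi>) + 1"
    by (meson add_increasing2 zero_le_one)
  then show ?thesis
    using enn2real_nonneg[of "mu (int 0) 0 \<phi>"]
    by (intro exI[of _ "enn2real (mu (int 0) 0 \<phi>) + 1"]) (simp add: add_nonneg_pos)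
qed

text \<open>
  Every derivative of the output is bounded by a multiple of one seminorm of the input, the one given by
  the Gaussian \<open>gauss (\<epsilon> / 2)\<close>, and Schwartz functions are bounded.
\<close>

lemma cont_linear_damped_kernel_op:
  fixes K :: "'a::euclidean_space \<times> 'a \<Rightarrow> complex"
  assumes K: "K \<in> OM" and \<epsilon>: "\<epsilon> \<in> {0<..1}"
  shows "cont_linear_OM (\<lambda>f x. damp \<epsilon> x * kernel_op \<epsilon> K f x)"
proof -
  let ?A = "\<lambda>f x. damp \<epsilon> x * kernel_op \<epsilon> K f x"
  have A: "?A f \<in> OM" if "f \<in> OM" for f
    by (intro OM_mult damp_OM kernel_op_OM K \<epsilon> that)
  have "continuous_map OM_topology OM_topology ?A"
  proof (rule continuous_map_OM_I[OF A])
    show "?A (\<lambda>x. f x - g x) = (\<lambda>x. ?A f x - ?A g x)" if "f \<in> OM" "g \<in> OM" for f g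
      by (simp add: kernel_op_diff[OF K that \<epsilon>] right_diff_distrib)
    fix \<phi> :: "'a \<Rightarrow> complex" and bs :: "'a list"
    assume \<phi>: "\<phi> \<in> schwartz" and bs: "set bs \<subseteq> Basis"
    have bs: "bs \<in> indices (length bs)"
      using bs by (simp add: indices_def)
    \<comment> \<open>Half of the weight controls the input, the other half keeps the kernel integrable.\<close>
    have \<eta>: "\<epsilon> / 2 \<in> {0<..1}"
      using \<epsilon> by simp
    let ?\<psi> = "gauss (\<epsilon> / 2) :: 'a \<Rightarrow> complex"
    obtain c where c: "0 < c" and le: "\<And>f S x. f \<in> OM \<Longrightarrow>
        \<forall>y. norm (f y) * exp (- \<epsilon> * (norm y)\<^sup>2) \<le> S * exp (- (\<epsilon> / 2) * (norm y)\<^sup>2) \<Longrightarrow>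
        norm (iter_partial bs (?A f) x) \<le> c * S"
      using damped_kernel_op_bounded[OF K \<epsilon> \<eta>, of "length bs"] bs by blast
    obtain M where M: "0 < M" "\<And>x. norm (\<phi> x) \<le> M"
      using schwartz_bounded[OF \<phi>] by blast
    have "OM_seminorm \<phi> bs (?A h) \<le> ennreal (M * c) * OM_seminorm ?\<psi> [] h" if h: "h \<in> OM" for h
    proof (cases "OM_seminorm ?\<psi> [] h")
      case (real S)
      have hb: "\<forall>y. norm (h y) * exp (- \<epsilon> * (norm y)\<^sup>2) \<le> S * exp (- (\<epsilon> / 2) * (norm y)\<^sup>2)"
      proof
        fix y
        have "norm (?\<psi> y * h y) \<le> S"
          using real OM_seminorm_le_iff[of ?\<psi> "[]" h "ennreal S"] by simp
        then have "norm (h y) * exp (- (\<epsilon> / 2) * (norm y)\<^sup>2) * exp (- (\<epsilon> / 2) * (norm y)\<^sup>2)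
            \<le> S * exp (- (\<epsilon> / 2) * (norm y)\<^sup>2)"
          by (intro mult_right_mono) (simp_all add: norm_mult norm_gauss mult.commute)
        moreover have "exp (- \<epsilon> * (norm y)\<^sup>2) = exp (- (\<epsilon> / 2) * (norm y)\<^sup>2) * exp (- (\<epsilon> / 2) * (norm y)\<^sup>2)"
          unfolding exp_add[symmetric] by simp
        ultimately show "norm (h y) * exp (- \<epsilon> * (norm y)\<^sup>2) \<le> S * exp (- (\<epsilon> / 2) * (norm y)\<^sup>2)"
          by (simp only: mult.assoc)
      qed
      have "norm (\<phi> x * iter_partial bs (?A h) x) \<le> M * c * S" for x
        unfolding norm_mult mult.assoc[of M] using M(1) by (intro mult_mono M(2) le[OF h hb]) auto
      then have "OM_seminorm \<phi> bs (?A h) \<le> ennreal (M * c * S)"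
        unfolding OM_seminorm_le_iff by (intro allI ennreal_leI)
      then show ?thesis
        unfolding real(2) using real(1) M(1) c by (simp add: ennreal_mult)
    next
      case top
      then show ?thesis
        using M(1) c by (simp add: ennreal_mult_top)
    qed
    then show "\<exists>\<psi>\<in>schwartz. \<exists>cs. \<exists>C>0. set cs \<subseteq> Basis \<and>
        (\<forall>h\<in>OM. OM_seminorm \<phi> bs (?A h) \<le> ennreal C * OM_seminorm \<psi> cs h)"
      using gauss_schwartz[of "\<epsilon> / 2", where 'a = 'a] \<eta> M(1) c
      by (intro bexI[of _ ?\<psi>] exI[of _ "[]"] exI[of _ "M * c"]) auto
  qed
  with A show ?thesis
    unfolding cont_linear_OM_def
    by (auto simp: kernel_op_add[OF K _ _ \<epsilon>] kernel_op_cmult distrib_left mult.left_commute)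
qed

text \<open>
  For derivatives up to order \<open>l\<close> the kernel has a fixed polynomial order \<open>q\<close> and a moderate constant when \<open>\<epsilon>\<close> is
  small. For the other \<open>\<epsilon>\<close> the damped output is bounded, in particular of order \<open>l + q\<close>, with some constant
  that need not be controlled. The input enters through its supremum only.
\<close>

lemma moderate_growth_damped_kernel_op:
  fixes K :: "real \<Rightarrow> 'a::euclidean_space \<times> 'a \<Rightarrow> complex"
  assumes K: "K \<in> E_tau"
  shows "moderate_growth (\<lambda>\<epsilon> f x. damp \<epsilon> x * kernel_op \<epsilon> (K \<epsilon>) f x)"
  unfolding moderate_growth_def
proof (intro conjI ballI allI)
  let ?B = "\<lambda>\<epsilon> f x. damp \<epsilon> x * kernel_op \<epsilon> (K \<epsilon>) f x"
  show "cont_linear_OM (?B \<epsilon>)" if "\<epsilon> \<in> {0<..1}" for \<epsilon>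
    using that K by (intro cont_linear_damped_kernel_op) (auto simp: E_tau_OM)
  fix l
  obtain q m C where C: "0 \<le> C" and Kb: "\<forall>\<^sub>F \<epsilon> in at_right 0. \<forall>bs\<in>indices l. \<forall>p.
      norm (iter_partial bs (K \<epsilon>) p) \<le> C * (1 / \<epsilon>) ^ m * (1 + norm p) ^ q"
    using E_tau_bound[OF K, of l] by blast
  obtain D where D: "0 \<le> D" and le: "\<forall>K\<in>OM. \<forall>f\<in>OM. \<forall>\<epsilon>\<in>{0<..1}. \<forall>\<eta>\<in>{0<..1}. \<forall>S M q.
    0 \<le> M \<longrightarrow> (\<forall>bs\<in>indices l. \<forall>p. norm (iter_partial bs K p) \<le> M * (1 + norm p) ^ q) \<longrightarrow>
    (\<forall>y::'a. norm (f y) * exp (- \<epsilon> * (norm y)\<^sup>2) \<le> S * exp (- \<eta> * (norm y)\<^sup>2)) \<longrightarrow>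
    (\<forall>bs\<in>indices l. \<forall>x. norm (iter_partial bs (\<lambda>x. damp \<epsilon> x * kernel_op \<epsilon> K f x) x)
      \<le> D * M * (\<integral>y. (1 + norm (y::'a)) ^ q * exp (- \<eta> * (norm y)\<^sup>2) \<partial>lborel)
        * ((1 + norm x) ^ (l + q) * exp (- exp (- 1 / \<epsilon>) * (norm x)\<^sup>2)) * S)"
    using norm_iter_partial_damped_kernel_op_le[where 'a = 'a, of l] by (elim exE conjE)
  obtain E and N :: nat where E: "0 \<le> E" and J: "\<And>\<eta>. \<eta> \<in> {0<..1} \<Longrightarrow>
      (\<integral>y. (1 + norm (y::'a)) ^ q * exp (- \<eta> * (norm y)\<^sup>2) \<partial>lborel) \<le> E * (1 / \<eta>) ^ N"
    using gauss_moment_bound[where 'a = 'a, of q] by blast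
  define P where "P \<epsilon> c \<longleftrightarrow> (\<forall>f\<in>OM. mu (- int (l + q)) l (?B \<epsilon> f) \<le> ennreal c * mu (- int 0) 0 f)" for \<epsilon> c
  \<comment> \<open>Positivity of \<open>c\<close> makes the bound trivial for unbounded \<open>f\<close>; with \<open>c = 0\<close> the right-hand side would be \<open>0 * \<infinity> = 0\<close>.\<close>
  have P_I: "P \<epsilon> c" if c: "0 < c" and bound: "\<And>f S bs x. f \<in> OM \<Longrightarrow> (\<forall>y. norm (f y) \<le> S) \<Longrightarrow> 0 \<le> S \<Longrightarrow> bs \<in> indices l \<Longrightarrow>
      norm (iter_partial bs (?B \<epsilon> f) x) \<le> c * S * (1 + norm x) ^ (l + q)" for \<epsilon> c
    unfolding P_def
  proof
    fix f :: "'a \<Rightarrow> complex" assume f: "f \<in> OM"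
    show "mu (- int (l + q)) l (?B \<epsilon> f) \<le> ennreal c * mu (- int 0) 0 f"
    proof (cases "mu (- int 0) 0 f")
      case (real S)
      have "mu (- int 0) 0 f \<le> ennreal S"
        unfolding real(2) by (rule order_refl)
      then have fS: "\<forall>y. norm (f y) \<le> S"
        unfolding mu_le_ennreal_iff[OF real(1)] by (auto simp: indices_def)
      have cS: "0 \<le> c * S"
        using c real(1) by simp
      have "mu (- int (l + q)) l (?B \<epsilon> f) \<le> ennreal (c * S)"
        unfolding mu_le_ennreal_iff[OF cS] using bound[OF f fS real(1)] by blast
      also have "\<dots> = ennreal c * mu (- int 0) 0 f"
        unfolding real(2) using c real(1) by (simp add: ennreal_mult)
      finally show ?thesis .
    next
      case top
      show ?thesis
        unfolding top using c by (simp add: ennreal_mult_top)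
    qed
  qed
  have ex: "\<exists>c>0. P \<epsilon> c" if \<epsilon>: "\<epsilon> \<in> {0<..1}" for \<epsilon>
  proof -
    obtain c where c: "0 < c" and cb: "\<And>f S bs x. f \<in> OM \<Longrightarrow>
        \<forall>y. norm (f y) * exp (- \<epsilon> * (norm y)\<^sup>2) \<le> S * exp (- \<epsilon> * (norm y)\<^sup>2) \<Longrightarrow> bs \<in> indices l \<Longrightarrow>
        norm (iter_partial bs (?B \<epsilon> f) x) \<le> c * S"
      using damped_kernel_op_bounded[OF E_tau_OM[OF K \<epsilon>] \<epsilon> \<epsilon>, of l] by blast
    have "P \<epsilon> c"
    proof (rule P_I[OF c])
      fix f :: "'a \<Rightarrow> complex" and S :: real and bs :: "'a list" and x :: 'a
      assume f: "f \<in> OM" "\<forall>y. norm (f y) \<le> S" "0 \<le> S" "bs \<in> indices l"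
      have "norm (iter_partial bs (?B \<epsilon> f) x) \<le> c * S"
        using f by (intro cb) auto
      also have "\<dots> \<le> c * S * (1 + norm x) ^ (l + q)"
        using c f(3) mult_left_mono[of 1 "(1 + norm x) ^ (l + q)" "c * S"] by simp
      finally show "norm (iter_partial bs (?B \<epsilon> f) x) \<le> c * S * (1 + norm x) ^ (l + q)" .
    qed
    with c show ?thesis by blast
  qed
  let ?C = "\<lambda>\<epsilon>. (D * C * E + 1) * (1 / \<epsilon>) ^ (m + N)"
  have Cpos: "0 < D * C * E + 1"
    using C D E by (simp add: add_nonneg_pos)
  have small: "\<forall>\<^sub>F \<epsilon> in at_right 0. P \<epsilon> (?C \<epsilon>)"
    using Kb at_right_0_in_unit
  proof eventually_elim
    case (elim \<epsilon>)
    let ?J = "\<integral>y. (1 + norm (y::'a)) ^ q * exp (- \<epsilon> * (norm y)\<^sup>2) \<partial>lborel"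
    have pos: "0 < (1 / \<epsilon>) ^ k" for k
      using elim(2) by simp
    show ?case
    proof (rule P_I)
      show Cp: "0 < ?C \<epsilon>"
        using Cpos pos by (rule mult_pos_pos)
      fix f :: "'a \<Rightarrow> complex" and S :: real and bs :: "'a list" and x :: 'a
      assume f: "f \<in> OM" "\<forall>y. norm (f y) \<le> S" "0 \<le> S" "bs \<in> indices l"
      have fb: "\<forall>y. norm (f y) * exp (- \<epsilon> * (norm y)\<^sup>2) \<le> S * exp (- \<epsilon> * (norm y)\<^sup>2)"
        using f(2) by simp
      have CM: "0 \<le> C * (1 / \<epsilon>) ^ m"
        using C pos[of m] by simp
      have "D * (C * (1 / \<epsilon>) ^ m) * ?J \<le> D * (C * (1 / \<epsilon>) ^ m) * (E * (1 / \<epsilon>) ^ N)"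
        by (intro mult_left_mono J mult_nonneg_nonneg C D elim(2) less_imp_le[OF pos])
      also have "\<dots> = D * C * E * (1 / \<epsilon>) ^ (m + N)"
        by (simp only: power_add mult_ac)
      also have "\<dots> \<le> ?C \<epsilon>"
        using pos[of "m + N"] by (intro mult_right_mono) auto
      finally have DJ: "D * (C * (1 / \<epsilon>) ^ m) * ?J \<le> ?C \<epsilon>" .
      have "exp (- exp (- 1 / \<epsilon>) * (norm x)\<^sup>2) \<le> 1"
        by simp
      then have e: "(1 + norm x) ^ (l + q) * exp (- exp (- 1 / \<epsilon>) * (norm x)\<^sup>2) \<le> (1 + norm x) ^ (l + q)"
        by (intro mult_left_le) auto
      have "norm (iter_partial bs (?B \<epsilon> f) x) \<le> D * (C * (1 / \<epsilon>) ^ m) * ?J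
          * ((1 + norm x) ^ (l + q) * exp (- exp (- 1 / \<epsilon>) * (norm x)\<^sup>2)) * S"
        using le E_tau_OM[OF K elim(2)] f(1,4) elim(1,2) CM fb by blast
      also have "\<dots> \<le> ?C \<epsilon> * (1 + norm x) ^ (l + q) * S"
        using f(3) Cp by (intro mult_right_mono mult_mono DJ e) auto
      finally show "norm (iter_partial bs (?B \<epsilon> f) x) \<le> ?C \<epsilon> * S * (1 + norm x) ^ (l + q)"
        by (simp only: mult_ac)
    qed
  qed
  \<comment> \<open>The moderate constant wherever it works, in particular for small \<open>\<epsilon>\<close>, and an arbitrary valid one elsewhere.\<close>
  define C' where "C' \<epsilon> = (if P \<epsilon> (?C \<epsilon>) then ?C \<epsilon> else SOME c. 0 < c \<and> P \<epsilon> c)" for \<epsilon>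
  have C': "0 \<le> C' \<epsilon> \<and> P \<epsilon> (C' \<epsilon>)" if \<epsilon>: "\<epsilon> \<in> {0<..1}" for \<epsilon>
  proof -
    have "0 < (SOME c. 0 < c \<and> P \<epsilon> c) \<and> P \<epsilon> (SOME c. 0 < c \<and> P \<epsilon> c)"
      by (rule someI_ex) (rule ex[OF \<epsilon>])
    moreover have "0 \<le> ?C \<epsilon>"
      using Cpos \<epsilon> by (intro mult_nonneg_nonneg) auto
    ultimately show ?thesis
      by (auto simp: C'_def)
  qed
  have "C' \<in> O[at_right 0](\<lambda>\<epsilon>. \<epsilon> powi (- int (m + N)))"
  proof (rule bigoI)
    show "\<forall>\<^sub>F \<epsilon> in at_right 0. norm (C' \<epsilon>) \<le> (D * C * E + 1) * norm (\<epsilon> powi (- int (m + N)))"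
      using small at_right_0_in_unit
    proof eventually_elim
      case (elim \<epsilon>)
      then have "0 \<le> (1 / \<epsilon>) ^ (m + N)"
        by simp
      moreover have "C' \<epsilon> = ?C \<epsilon>"
        using elim(1) by (simp only: C'_def if_True)
      ultimately show ?case
        unfolding powi_minus_eq using Cpos by (simp only: real_norm_def abs_mult abs_of_pos)
    qed
  qed
  then have "C' \<in> E_M"
    unfolding E_M_def using C' by blast
  then show "\<exists>C\<in>E_M. \<exists>(p::nat) (q::nat) (l'::nat). \<forall>f\<in>OM. \<forall>\<epsilon>\<in>{0<..1}.
      mu (- int p) l (?B \<epsilon> f) \<le> ennreal (C \<epsilon>) * mu (- int q) l' f"
    using C' unfolding P_def by blast
qed

section \<open>Generalised integral operators\<close>

lemma tau_rel_refl: "f \<in> E_tau \<Longrightarrow> tau_rel f f"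
  by (simp add: tau_rel_def zero_N_tau)

lemma Gtau_eqI: "tau_rel f g \<Longrightarrow> Gtau f = Gtau g"
  by (rule Quotient_rel_abs[OF Quotient_G_tau])

lemma Gtau_cases:
  obtains f where "f \<in> E_tau" "u = Gtau f"
  using Quotient_rep_reflp[OF Quotient_G_tau, of u] Quotient_abs_rep[OF Quotient_G_tau, of u]
  by (metis tau_rel_def)

text \<open>
  Identities between operators, such as additivity or Fubini's theorem, are available only for \<open>\<epsilon>\<close> in \<open>(0,1]\<close>, where the
  nets consist of functions of slow growth.
\<close>

lemma Gtau_cong:
  assumes "f \<in> E_tau" "\<And>\<epsilon>. \<epsilon> \<in> {0<..1} \<Longrightarrow> f \<epsilon> = g \<epsilon>"
  shows "Gtau f = Gtau g"
proof (rule Gtau_eqI)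
  have ev: "\<forall>\<^sub>F \<epsilon> in at_right 0. f \<epsilon> = g \<epsilon>"
    using at_right_0_in_unit by eventually_elim (rule assms(2))
  have "g \<in> E_tau"
  proof (rule E_tau_I)
    show "g \<epsilon> \<in> OM" if "\<epsilon> \<in> {0<..1}" for \<epsilon>
      using assms that by (metis E_tau_OM)
    fix l
    obtain q m C where C: "0 \<le> C" and fb: "\<forall>\<^sub>F \<epsilon> in at_right 0. \<forall>bs\<in>indices l. \<forall>x.
        norm (iter_partial bs (f \<epsilon>) x) \<le> C * (1 / \<epsilon>) ^ m * (1 + norm x) ^ q"
      using E_tau_bound[OF assms(1), of l] by blast
    have "\<forall>\<^sub>F \<epsilon> in at_right 0. \<forall>bs\<in>indices l. \<forall>x.
        norm (iter_partial bs (g \<epsilon>) x) \<le> C * (1 / \<epsilon>) ^ m * (1 + norm x) ^ q"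
      using fb ev by eventually_elim simp
    with C show "\<exists>q m. \<exists>C\<ge>0. \<forall>\<^sub>F \<epsilon> in at_right 0. \<forall>bs\<in>indices l. \<forall>x.
        norm (iter_partial bs (g \<epsilon>) x) \<le> C * (1 / \<epsilon>) ^ m * (1 + norm x) ^ q"
      by blast
  qed
  moreover have "(\<lambda>\<epsilon> x. f \<epsilon> x - g \<epsilon> x) \<in> N_tau"
  proof (rule N_tau_I)
    show "(\<lambda>x. f \<epsilon> x - g \<epsilon> x) \<in> OM" if "\<epsilon> \<in> {0<..1}" for \<epsilon>
      using assms(2)[OF that] zero_OM by simp
    have "\<forall>\<^sub>F \<epsilon> in at_right 0. \<forall>bs\<in>indices l. \<forall>x.
        norm (iter_partial bs (\<lambda>x. f \<epsilon> x - g \<epsilon> x) x) \<le> 0 * \<epsilon> ^ p * (1 + norm x) ^ 0" for l p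
      using ev by eventually_elim (simp add: iter_partial_zero)
    then show "\<exists>q. \<forall>p. \<exists>C\<ge>0. \<forall>\<^sub>F \<epsilon> in at_right 0. \<forall>bs\<in>indices l. \<forall>x.
        norm (iter_partial bs (\<lambda>x. f \<epsilon> x - g \<epsilon> x) x) \<le> C * \<epsilon> ^ p * (1 + norm x) ^ q" for l
      by (intro exI[of _ 0] allI exI[of _ "0::real"] conjI order_refl)
  qed
  ultimately show "tau_rel f g"
    using assms(1) by (simp add: tau_rel_def)
qed

text \<open>
  Linearity is read off from \<open>kernel_op\<close> itself, moderate growth from its damped version: both nets
  represent the same classes.
\<close>

lemma generalised_integral_operator_in_L:
  fixes K :: "real \<Rightarrow> 'a::euclidean_space \<times> 'a \<Rightarrow> complex"
  assumes K: "K \<in> E_tau"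
    and A: "\<And>\<phi>. \<phi> \<in> E_tau \<Longrightarrow> A (Gtau \<phi>) = Gtau (\<lambda>\<epsilon>. kernel_op \<epsilon> (K \<epsilon>) (\<phi> \<epsilon>))"
  shows "A \<in> L_G_tau"
proof -
  note op = kernel_op_E_tau[OF K]
  have "Vector_Spaces.linear gscale gscale A"
  proof (rule Vector_Spaces.linear_iff[THEN iffD2], intro conjI vector_space_gscale allI)
    fix u v :: "'a G_tau"
    obtain f where f: "f \<in> E_tau" "u = Gtau f" by (rule Gtau_cases)
    obtain g where g: "g \<in> E_tau" "v = Gtau g" by (rule Gtau_cases)
    have "A (u + v) = Gtau (\<lambda>\<epsilon>. kernel_op \<epsilon> (K \<epsilon>) (\<lambda>x. f \<epsilon> x + g \<epsilon> x))"
      using f g by (simp add: plus_G_tau.abs_eq tau_rel_refl A E_tau_add)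
    also have "\<dots> = Gtau (\<lambda>\<epsilon> x. kernel_op \<epsilon> (K \<epsilon>) (f \<epsilon>) x + kernel_op \<epsilon> (K \<epsilon>) (g \<epsilon>) x)"
      using f g K by (intro Gtau_cong op E_tau_add) (auto intro!: kernel_op_add simp: E_tau_OM)
    also have "\<dots> = A u + A v"
      using f g by (simp add: plus_G_tau.abs_eq tau_rel_refl A op)
    finally show "A (u + v) = A u + A v" .
  next
    fix c and u :: "'a G_tau"
    obtain f where f: "f \<in> E_tau" "u = Gtau f" by (rule Gtau_cases)
    have "A (gscale c u) = Gtau (\<lambda>\<epsilon> x. c * kernel_op \<epsilon> (K \<epsilon>) (f \<epsilon>) x)"
      using f by (simp add: gscale.abs_eq tau_rel_refl A E_tau_cmult kernel_op_cmult)
    also have "\<dots> = gscale c (A u)"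
      using f by (simp add: gscale.abs_eq tau_rel_refl A op)
    finally show "A (gscale c u) = gscale c (A u)" .
  qed
  moreover have "(\<lambda>\<epsilon> x. damp \<epsilon> x * kernel_op \<epsilon> (K \<epsilon>) (f \<epsilon>) x) \<in> E_tau \<and>
      A (Gtau f) = Gtau (\<lambda>\<epsilon> x. damp \<epsilon> x * kernel_op \<epsilon> (K \<epsilon>) (f \<epsilon>) x)" if f: "f \<in> E_tau" for f
    using tau_rel_damp[OF op[OF f]] Gtau_eqI[OF tau_rel_damp[OF op[OF f]]] A[OF f] by (simp add: tau_rel_def)
  ultimately show ?thesis
    using moderate_growth_damped_kernel_op[OF K] unfolding L_G_tau_def
    by (intro CollectI conjI exI[of _ "\<lambda>\<epsilon> f x. damp \<epsilon> x * kernel_op \<epsilon> (K \<epsilon>) f x"]) auto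
qed

theorem theorem1:
  fixes K1 K2 :: "real \<Rightarrow> (real ^ 'n) \<times> (real ^ 'n) \<Rightarrow> complex"
    and A1 A2 :: "(real ^ 'n) G_tau \<Rightarrow> (real ^ 'n) G_tau"
  assumes "K1 \<in> E_tau" and "K2 \<in> E_tau"
    and "\<And>\<phi>. \<phi> \<in> E_tau \<Longrightarrow> A1 (Gtau \<phi>) = Gtau (\<lambda>\<epsilon>. kernel_op \<epsilon> (K1 \<epsilon>) (\<phi> \<epsilon>))"
    and "\<And>\<phi>. \<phi> \<in> E_tau \<Longrightarrow> A2 (Gtau \<phi>) = Gtau (\<lambda>\<epsilon>. kernel_op \<epsilon> (K2 \<epsilon>) (\<phi> \<epsilon>))"
  defines "K \<equiv> (\<lambda>\<epsilon>. kernel_comp \<epsilon> (K2 \<epsilon>) (K1 \<epsilon>))"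
  shows "A1 \<in> L_G_tau \<and> A2 \<in> L_G_tau \<and> A2 \<circ> A1 \<in> L_G_tau \<and>
    K \<in> E_tau \<and>
    (\<forall>\<phi>\<in>E_tau. (\<lambda>\<epsilon>. kernel_op \<epsilon> (K \<epsilon>) (\<phi> \<epsilon>)) \<in> E_tau \<and>
       (A2 \<circ> A1) (Gtau \<phi>) = Gtau (\<lambda>\<epsilon>. kernel_op \<epsilon> (K \<epsilon>) (\<phi> \<epsilon>)))"
proof -
  have K: "K \<in> E_tau"
    unfolding K_def using assms(1,2) by (rule kernel_comp_E_tau)
  have comp: "(A2 \<circ> A1) (Gtau \<phi>) = Gtau (\<lambda>\<epsilon>. kernel_op \<epsilon> (K \<epsilon>) (\<phi> \<epsilon>))" if \<phi>: "\<phi> \<in> E_tau" for \<phi>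
  proof -
    have op: "(\<lambda>\<epsilon>. kernel_op \<epsilon> (K1 \<epsilon>) (\<phi> \<epsilon>)) \<in> E_tau"
      using assms(1) \<phi> by (rule kernel_op_E_tau)
    have "(A2 \<circ> A1) (Gtau \<phi>) = Gtau (\<lambda>\<epsilon>. kernel_op \<epsilon> (K2 \<epsilon>) (kernel_op \<epsilon> (K1 \<epsilon>) (\<phi> \<epsilon>)))"
      using assms(3)[OF \<phi>] assms(4)[OF op] by simp
    also have "\<dots> = Gtau (\<lambda>\<epsilon>. kernel_op \<epsilon> (K \<epsilon>) (\<phi> \<epsilon>))"
      unfolding K_def using assms(1,2) \<phi> kernel_op_E_tau[OF assms(2) op]
      by (intro Gtau_cong kernel_op_kernel_op) (auto simp: E_tau_OM)
    finally show ?thesis .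
  qed
  show ?thesis
    using generalised_integral_operator_in_L[OF assms(1,3)] generalised_integral_operator_in_L[OF assms(2,4)]
      generalised_integral_operator_in_L[OF K comp] K comp kernel_op_E_tau[OF K] by blast
qed

end
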